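(* Let $\Omega\subset\mathbb{R}^n$ be a bounded Lipschitz domain and let $\mathcal{F}[u]=\int_\Omega F(x,u,\nabla u)\,dx$, where $F:\Omega\times\mathbb{R}\times\mathbb{R}^n\to\mathbb{R}$ is measurable with respect to the first variable and continuous with respect to the second and the third variable. Let $M:\Omega\times\mathbb{R}^n\to[0,\infty)$ be a weak $N$-function that is continuous with respect to both variables and such that $M\in\Delta_2$, and suppose that there exist constants $0<\nu,\beta<1<L$ such that $$\nu M(x,\beta\xi)\le F(x,z,\xi)\le L\,(M(x,\xi)+1)\qquad\text{for all } x\in\Omega,\ z\in\mathbb{R},\ \xi\in\mathbb{R}^n.$$ Then the following hold. (i) If $\gamma=0$, $u_0\in V^1L_M(\Omega)$, and $M$ satisfies condition $\mathsf{(B^{iso}_\gamma)}$ or $\mathsf{(B^{ort}_\gamma)}$ (with $\gamma=0$), then $$\inf_{u\in u_0+V^1_0L_M(\Omega)}\mathcal{F}[u]=\inf_{u\in u_0+C_c^\infty(\Omega)}\mathcal{F}[u].$$ (ii) If $\gamma\in(0,1)$, $u_0\in V^1L_M(\Omega)\cap C^{0,\gamma}(\Omega)$, and $M$ satisfies condition $\mathsf{(B^{iso}_\gamma)}$ or $\mathsf{(B^{ort}_\gamma)}$, then $$\inf_{u\in u_0+(V^1_0L_M(\Omega)\cap C^{0,\gamma}(\Omega))}\mathcal{F}[u]=\inf_{u\in u_0+C_c^\infty(\Omega)}\mathcal{F}[u].$$ (iii) If $u_0\in V^1L_M(\Omega)\cap C^{0,1}(\Omega)$, then $$\inf_{u\in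 u_0+(V^1_0L_M(\Omega)\cap C^{0,1}(\Omega))}\mathcal{F}[u]=\inf_{u\in u_0+C_c^\infty(\Omega)}\mathcal{F}[u].$$
   Context: Weak $N$-functions. For $\ell\ge1$, a function $N:\Omega\times\mathbb{R}^\ell\to[0,\infty)$ is a weak $N$-function if: (1) it is Carathéodory (measurable in $x$, continuous in $\xi$); (2) $N(x,0)=0$ and $\xi\mapsto N(x,\xi)$ is convex for a.a. $x\in\Omega$; (3) $N(x,\xi)=N(x,-\xi)$ for a.a. $x\in\Omega$ and all $\xi$; (4) there exist convex functions $m_1,m_2:[0,\infty)\to[0,\infty)$ with $m_1(0)=0$, $m_1(s)>0$ for $s>0$, such that $m_1(|\xi|)\le N(x,\xi)\le m_2(|\xi|)$ for a.a. $x\in\Omega$ and all $\xi$. A function $m:\Omega\times[0,\infty)\to[0,\infty)$ is called a weak $N$-function if $(x,t)\mapsto m(x,|t|)$ is a weak $N$-function on $\Omega\times\mathbb{R}$. $M\in\Delta_2$ means: there exist constants $c,C>0$ and a nonnegative integrable $h:\Omega\to\mathbb{R}$ such that for a.e. $x\in\Omega$, $M(x,2\xi)\le cM(x,\xi)+h(x)$ for all $\xi$ with $|\xi|>C$. For a ball $B$ and a weak $N$-function $N$: $N_B^-(\xi)=\operatorname{ess\,inf}_{y\in B\cap\Omega}N(y,\xi)$ and $N_B^+(\xi)=\operatorname{ess\,sup}_{y\in B\cap\Omega}N(y,\xi)$. Condition $\mathsf{(B^{iso}_\gamma)}$: $M(x,\xi)=m(x,|\xi|)$ with a weak $N$-function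 $m:\Omega\times[0,\infty)\to[0,\infty)$, and there exist constants $c^\Diamond,C^\Diamond\ge1$ such that for every ball $B$ with radius $r\le1$ and all $\xi\in\mathbb{R}^n$ with $|\xi|\le c^\Diamond r^{\gamma-1}$ there holds $m_B^+(|\xi|)\le m_B^-(C^\Diamond|\xi|)+1$. Condition $\mathsf{(B^{ort}_\gamma)}$: $M(x,\xi)=\sum_{i=1}^nM_i(x,|\xi_i|)$ for $\xi=(\xi_1,\dots,\xi_n)$, with weak $N$-functions $M_i:\Omega\times[0,\infty)\to[0,\infty)$, and there exist constants $c^\Diamond,C^\Diamond\ge1$ such that for every ball $B$ with radius $r\le1$, all $i$, and all $\xi_i\in\mathbb{R}$ with $|\xi_i|\le c^\Diamond r^{\gamma-1}$ there holds $(M_i)_B^+(|\xi_i|)\le(M_i)_B^-(C^\Diamond|\xi_i|)+1$. Function spaces. $L_M(\Omega;\mathbb{R}^n)$ is the smallest linear space containing all measurable $\xi:\Omega\to\mathbb{R}^n$ with $\int_\Omega M(x,\xi(x))\,dx<\infty$. $V^1L_M(\Omega)=\{f\in W^{1,1}(\Omega):\nabla f\in L_M(\Omega;\mathbb{R}^n)\}$ and $V^1_0L_M(\Omega)=\{f\in W^{1,1}_0(\Omega):\nabla f\in L_M(\Omega;\mathbb{R}^n)\}$. For $\gamma\in(0,1]$, $h\in C^{0,\gamma}(\Omega)$ means $\sup_{x\ne y\in\Omega}|h(x)-h(y)|/|x-y|^\gamma<\infty$. *)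

theory Defs
  imports "HOL-Analysis.Analysis" "HOL-Probability.Essential_Supremum"
begin

text \<open>
  A function on a set \<open>\<Omega>\<close> is represented by a total function whose values outside \<open>\<Omega>\<close> are
  irrelevant. Function spaces are sets of functions rather than of almost-everywhere classes.
\<close>

section \<open>Lipschitz domains\<close>

text \<open>
  Near every boundary point, \<open>\<Omega>\<close> is the strict epigraph of a Lipschitz function over a hyperplane.
  The unit vector \<open>e\<close> is the direction of the graph; \<open>x - (x \<bullet> e) *\<^sub>R e\<close> is the projection of \<open>x\<close>
  onto the hyperplane orthogonal to \<open>e\<close>.
\<close>

definition lipschitz_domain :: "'a::euclidean_space set \<Rightarrow> bool" where
  "lipschitz_domain \<Omega> \<longleftrightarrow>
     open \<Omega> \<and> connected \<Omega> \<and> \<Omega> \<noteq> {} \<and>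
     (\<forall>p\<in>frontier \<Omega>. \<exists>e g K r. norm e = 1 \<and> K-lipschitz_on {y. y \<bullet> e = 0} g \<and> r > 0 \<and>
        (\<forall>x\<in>ball p r. x \<in> \<Omega> \<longleftrightarrow> g (x - (x \<bullet> e) *\<^sub>R e) < x \<bullet> e))"

section \<open>Smooth functions, weak gradients and Sobolev spaces\<close>

abbreviation partial_derivative ::
    "'a::euclidean_space \<Rightarrow> ('a \<Rightarrow> real) \<Rightarrow> 'a \<Rightarrow> real" where
  "partial_derivative i f \<equiv> (\<lambda>x. frechet_derivative f (at x) i)"

primrec C_k :: "nat \<Rightarrow> ('a::euclidean_space \<Rightarrow> real) \<Rightarrow> bool" where
  "C_k 0 f \<longleftrightarrow> continuous_on UNIV f"
| "C_k (Suc k) f \<longleftrightarrow>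
     (\<forall>x. f differentiable (at x)) \<and> (\<forall>i\<in>Basis. C_k k (partial_derivative i f))"

text \<open>Test functions are identified with their extension by zero.\<close>

definition test_functions :: "'a::euclidean_space set \<Rightarrow> ('a \<Rightarrow> real) set" where
  "test_functions \<Omega> =
     {\<phi>. (\<forall>k. C_k k \<phi>) \<and> compact (closure {x. \<phi> x \<noteq> 0}) \<and> closure {x. \<phi> x \<noteq> 0} \<subseteq> \<Omega>}"

definition locally_integrable ::
    "'a::euclidean_space set \<Rightarrow> ('a \<Rightarrow> 'b::euclidean_space) \<Rightarrow> bool" where
  "locally_integrable \<Omega> f \<longleftrightarrow> (\<forall>K. compact K \<and> K \<subseteq> \<Omega> \<longrightarrow> integrable (lebesgue_on K) f)"

definition has_weak_gradient ::
    "'a::euclidean_space set \<Rightarrow> ('a \<Rightarrow> real) \<Rightarrow> ('a \<Rightarrow> 'a) \<Rightarrow> bool" where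
  "has_weak_gradient \<Omega> u g \<longleftrightarrow>
     locally_integrable \<Omega> u \<and> locally_integrable \<Omega> g \<and>
     (\<forall>\<phi>\<in>test_functions \<Omega>. \<forall>i\<in>Basis.
        (\<integral>x. u x * partial_derivative i \<phi> x \<partial>lebesgue_on \<Omega>) =
        - (\<integral>x. (g x \<bullet> i) * \<phi> x \<partial>lebesgue_on \<Omega>))"

text \<open>Weak gradients are unique up to null sets, so nothing below depends on the choice.\<close>

definition weak_gradient ::
    "'a::euclidean_space set \<Rightarrow> ('a \<Rightarrow> real) \<Rightarrow> 'a \<Rightarrow> 'a" where
  "weak_gradient \<Omega> u = (SOME g. has_weak_gradient \<Omega> u g)"

definition W11 :: "'a::euclidean_space set \<Rightarrow> ('a \<Rightarrow> real) set" where
  "W11 \<Omega> = {u. integrable (lebesgue_on \<Omega>) u \<and>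
               (\<exists>g. has_weak_gradient \<Omega> u g \<and> integrable (lebesgue_on \<Omega>) g)}"

definition W11_norm :: "'a::euclidean_space set \<Rightarrow> ('a \<Rightarrow> real) \<Rightarrow> real" where
  "W11_norm \<Omega> u =
     (\<integral>x. \<bar>u x\<bar> \<partial>lebesgue_on \<Omega>) + (\<integral>x. norm (weak_gradient \<Omega> u x) \<partial>lebesgue_on \<Omega>)"

definition W11_0 :: "'a::euclidean_space set \<Rightarrow> ('a \<Rightarrow> real) set" where
  "W11_0 \<Omega> = {u \<in> W11 \<Omega>. \<exists>\<phi>. (\<forall>k::nat. \<phi> k \<in> test_functions \<Omega>) \<and>
                 (\<lambda>k. W11_norm \<Omega> (\<lambda>x. u x - \<phi> k x)) \<longlonglongrightarrow> 0}"

definition holder_functions :: "real \<Rightarrow> 'a::euclidean_space set \<Rightarrow> ('a \<Rightarrow> real) set" where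
  "holder_functions \<gamma> \<Omega> =
     {h. bdd_above {\<bar>h x - h y\<bar> / norm (x - y) powr \<gamma> | x y. x \<in> \<Omega> \<and> y \<in> \<Omega> \<and> x \<noteq> y}}"

section \<open>Weak N-functions\<close>

definition weak_N_function ::
    "'a::euclidean_space set \<Rightarrow> ('a \<Rightarrow> 'b::euclidean_space \<Rightarrow> real) \<Rightarrow> bool" where
  "weak_N_function \<Omega> N \<longleftrightarrow>
     (\<forall>x\<in>\<Omega>. \<forall>\<xi>. 0 \<le> N x \<xi>) \<and>
     (\<forall>\<xi>. (\<lambda>x. N x \<xi>) \<in> borel_measurable (lebesgue_on \<Omega>)) \<and>
     (\<forall>x\<in>\<Omega>. continuous_on UNIV (N x)) \<and>
     (AE x in lebesgue_on \<Omega>. N x 0 = 0 \<and> convex_on UNIV (N x)) \<and>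
     (AE x in lebesgue_on \<Omega>. \<forall>\<xi>. N x \<xi> = N x (- \<xi>)) \<and>
     (\<exists>m1 m2 :: real \<Rightarrow> real.
        convex_on {0..} m1 \<and> convex_on {0..} m2 \<and>
        (\<forall>s\<ge>0. 0 \<le> m1 s \<and> 0 \<le> m2 s) \<and> m1 0 = 0 \<and> (\<forall>s>0. 0 < m1 s) \<and>
        (AE x in lebesgue_on \<Omega>. \<forall>\<xi>. m1 (norm \<xi>) \<le> N x \<xi> \<and> N x \<xi> \<le> m2 (norm \<xi>)))"

text \<open>
  For \<open>m\<close> defined on \<open>\<Omega> \<times> [0,\<infinity>)\<close>; the values of \<open>m x\<close> at negative arguments are irrelevant.
\<close>

definition weak_N_function_radial ::
    "'a::euclidean_space set \<Rightarrow> ('a \<Rightarrow> real \<Rightarrow> real) \<Rightarrow> bool" where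
  "weak_N_function_radial \<Omega> m \<longleftrightarrow> weak_N_function \<Omega> (\<lambda>x (t::real). m x \<bar>t\<bar>)"

definition Delta2 ::
    "'a::euclidean_space set \<Rightarrow> ('a \<Rightarrow> 'b::euclidean_space \<Rightarrow> real) \<Rightarrow> bool" where
  "Delta2 \<Omega> M \<longleftrightarrow>
     (\<exists>c C h. c > 0 \<and> C > 0 \<and> integrable (lebesgue_on \<Omega>) h \<and> (\<forall>x\<in>\<Omega>. 0 \<le> h x) \<and>
        (AE x in lebesgue_on \<Omega>. \<forall>\<xi>. norm \<xi> > C \<longrightarrow> M x (2 *\<^sub>R \<xi>) \<le> c * M x \<xi> + h x))"

definition essinf :: "'a measure \<Rightarrow> ('a \<Rightarrow> ereal) \<Rightarrow> ereal" where
  "essinf M f = - esssup M (\<lambda>x. - f x)"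

text \<open>
  Extended real values: if \<open>B \<inter> \<Omega>\<close> is empty, then the essential infimum is \<open>\<infinity>\<close> and the
  essential supremum is \<open>-\<infinity>\<close>.
\<close>

definition N_minus ::
    "'a::euclidean_space set \<Rightarrow> ('a \<Rightarrow> 'b \<Rightarrow> real) \<Rightarrow> 'a set \<Rightarrow> 'b \<Rightarrow> ereal" where
  "N_minus \<Omega> N B \<xi> = essinf (lebesgue_on (B \<inter> \<Omega>)) (\<lambda>y. ereal (N y \<xi>))"

definition N_plus ::
    "'a::euclidean_space set \<Rightarrow> ('a \<Rightarrow> 'b \<Rightarrow> real) \<Rightarrow> 'a set \<Rightarrow> 'b \<Rightarrow> ereal" where
  "N_plus \<Omega> N B \<xi> = esssup (lebesgue_on (B \<inter> \<Omega>)) (\<lambda>y. ereal (N y \<xi>))"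

definition B_iso ::
    "real \<Rightarrow> 'a::euclidean_space set \<Rightarrow> ('a \<Rightarrow> 'a \<Rightarrow> real) \<Rightarrow> bool" where
  "B_iso \<gamma> \<Omega> M \<longleftrightarrow>
     (\<exists>m. weak_N_function_radial \<Omega> m \<and> (\<forall>x\<in>\<Omega>. \<forall>\<xi>. M x \<xi> = m x (norm \<xi>)) \<and>
       (\<exists>c\<ge>1. \<exists>C\<ge>1. \<forall>p r \<xi>. 0 < r \<and> r \<le> 1 \<and> norm (\<xi>::'a) \<le> c * r powr (\<gamma> - 1) \<longrightarrow>
          N_plus \<Omega> m (ball p r) (norm \<xi>) \<le> N_minus \<Omega> m (ball p r) (C * norm \<xi>) + 1))"

definition B_ort ::
    "real \<Rightarrow> (real^'n) set \<Rightarrow> (real^'n \<Rightarrow> real^'n \<Rightarrow> real) \<Rightarrow> bool" where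
  "B_ort \<gamma> \<Omega> M \<longleftrightarrow>
     (\<exists>m :: 'n \<Rightarrow> real^'n \<Rightarrow> real \<Rightarrow> real.
       (\<forall>i. weak_N_function_radial \<Omega> (m i)) \<and>
       (\<forall>x\<in>\<Omega>. \<forall>\<xi>. M x \<xi> = (\<Sum>i\<in>UNIV. m i x \<bar>\<xi> $ i\<bar>)) \<and>
       (\<exists>c\<ge>1. \<exists>C\<ge>1. \<forall>p r i. \<forall>t::real. 0 < r \<and> r \<le> 1 \<and> \<bar>t\<bar> \<le> c * r powr (\<gamma> - 1) \<longrightarrow>
          N_plus \<Omega> (m i) (ball p r) \<bar>t\<bar> \<le> N_minus \<Omega> (m i) (ball p r) (C * \<bar>t\<bar>) + 1))"

section \<open>Musielak--Orlicz--Sobolev spaces\<close>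

text \<open>\<open>linear_fun_space V\<close>: closed under the pointwise vector space operations.\<close>

definition linear_fun_space :: "('a \<Rightarrow> 'b::real_vector) set \<Rightarrow> bool" where
  "linear_fun_space V \<longleftrightarrow>
     (\<lambda>x. 0) \<in> V \<and> (\<forall>f\<in>V. \<forall>g\<in>V. (\<lambda>x. f x + g x) \<in> V) \<and> (\<forall>c. \<forall>f\<in>V. (\<lambda>x. c *\<^sub>R f x) \<in> V)"

definition L_M ::
    "'a::euclidean_space set \<Rightarrow> ('a \<Rightarrow> 'b::euclidean_space \<Rightarrow> real) \<Rightarrow> ('a \<Rightarrow> 'b) set" where
  "L_M \<Omega> M = linear_fun_space hull
     {\<xi> \<in> borel_measurable (lebesgue_on \<Omega>).
        (\<integral>\<^sup>+x. ennreal (M x (\<xi> x)) \<partial>lebesgue_on \<Omega>) < \<infinity>}"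

definition V1_L ::
    "'a::euclidean_space set \<Rightarrow> ('a \<Rightarrow> 'a \<Rightarrow> real) \<Rightarrow> ('a \<Rightarrow> real) set" where
  "V1_L \<Omega> M = {f \<in> W11 \<Omega>. weak_gradient \<Omega> f \<in> L_M \<Omega> M}"

definition V1_0_L ::
    "'a::euclidean_space set \<Rightarrow> ('a \<Rightarrow> 'a \<Rightarrow> real) \<Rightarrow> ('a \<Rightarrow> real) set" where
  "V1_0_L \<Omega> M = {f \<in> W11_0 \<Omega>. weak_gradient \<Omega> f \<in> L_M \<Omega> M}"

section \<open>The functional\<close>

text \<open>
  An integral in \<open>[0,\<infinity>]\<close>, for nonnegative integrands \<open>F\<close>; \<open>ennreal\<close> would map negative values of
  \<open>F\<close> to \<open>0\<close>.
\<close>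

definition energy ::
    "'a::euclidean_space set \<Rightarrow> ('a \<Rightarrow> real \<Rightarrow> 'a \<Rightarrow> real) \<Rightarrow> ('a \<Rightarrow> real) \<Rightarrow> ennreal" where
  "energy \<Omega> F u = (\<integral>\<^sup>+x. ennreal (F x (u x) (weak_gradient \<Omega> u x)) \<partial>lebesgue_on \<Omega>)"

definition translate :: "('a \<Rightarrow> real) \<Rightarrow> ('a \<Rightarrow> real) set \<Rightarrow> ('a \<Rightarrow> real) set" where
  "translate u0 V = {(\<lambda>x. u0 x + v x) | v. v \<in> V}"

end

theory Submission
  imports Defs
begin

text \<open>
  Test functions belong to each of the larger classes of competitors, so only one inequality has
  content: every competitor \<open>u0 + v\<close> has energy at least the infimum over \<open>u0
  + C_c^\<infinity>\<close>. By dominated convergence and the upper growth bound on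
  \<open>F\<close>, this holds as soon as test functions \<open>\<phi> k\<close> converge to
  \<open>v\<close> in \<open>W^{1,1}\<close> while the functions \<open>M x (grad (\<phi> k) x /
  lam)\<close> stay below a sequence that converges in \<open>L^1\<close>, for some fixed
  \<open>lam > 0\<close>; the condition \<open>Delta2\<close> removes \<open>lam\<close>. This
  is the notion \<open>modular_approx\<close>, and
  \<open>inf_energy_le_of_modular_approx\<close> is the passage to the limit. There is no
  Lavrentiev gap because competitors, truncated when \<open>\<gamma> = 0\<close>, admit such an
  approximation (\<open>modular_approx_lipschitz_domain\<close>).

  The approximants are mollifications of the extension of \<open>v\<close> by zero, localised by
  a partition of unity. Near a boundary point the kernel is shifted so that the support is
  pushed into the Lipschitz epigraph (\<open>inward_kernel_exists\<close>). The danger is that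
  the smeared gradient at \<open>x\<close>, an average of gradients at points \<open>y\<close>,
  is large for \<open>M x\<close> although the gradients are moderate for \<open>M y\<close>. A
  \<open>\<gamma>\<close>-Hoelder function has mollifications at scale \<open>\<delta>\<close>
  whose gradients are of order \<open>\<delta> powr (\<gamma> - 1)\<close>
  (\<open>grad_conv_holder_bound\<close>), and this is the range in which the conditions
  \<open>B_iso\<close> and \<open>B_ort\<close> compare \<open>M x\<close> with \<open>M
  y\<close>. What makes the comparison compatible with averaging is
  \<open>jensen_condition\<close>: for \<open>\<xi>\<close> in that range, one affine function
  has the value \<open>M x \<xi>\<close> at \<open>\<xi>\<close> and lies below
  \<open>\<lambda>\<eta>. M y (C *\<^sub>R \<eta>) + N\<close> for all \<open>y\<close> near
  \<open>x\<close> at once; integrating it against the kernel replaces Jensen's inequality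
  (\<open>mollified_modular_bound\<close>). For isotropic \<open>M\<close> the affine function
  is explicit (\<open>radial_affine_minorant\<close>), for orthotropic \<open>M\<close> it is
  built one coordinate at a time, and for \<open>\<gamma> = 1\<close> a constant one does, since
  \<open>M\<close> is bounded on bounded sets.

  Two points remain. For \<open>\<gamma> > 0\<close> the extension by zero has to be Hoelder
  continuous across the boundary, so a Hoelder function in \<open>W^{1,1}_0\<close> must tend to
  zero there. If it did not, a truncation of it or of its negative would be a positive constant
  inside the domain near a boundary point, zero outside, and would still be a limit of test
  functions with zero gradient near that point (\<open>test_limit_no_jump\<close>). For
  \<open>\<gamma> = 0\<close> nothing is known about the competitor, but \<open>j * sin (v /
  j)\<close> is bounded, which is Hoelder continuity with exponent \<open>0\<close>, and the
  energy of its sum with \<open>u0\<close> tends to that of \<open>u0 + v\<close> as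
  \<open>j\<close> grows (\<open>inf_energy_le_unrestricted\<close>).
\<close>

section \<open>Smooth functions\<close>

lemma partial_derivativeI:
  "(f has_derivative f') (at x) \<Longrightarrow> partial_derivative i f x = f' i"
  using frechet_derivative_at by metis

lemma C_k_Suc_weaken: "C_k (Suc k) f \<Longrightarrow> C_k k f"
proof (induction k arbitrary: f)
  case 0
  then show ?case
    by (auto simp: continuous_on_eq_continuous_at intro: differentiable_imp_continuous_within)
next
  case (Suc k)
  then show ?case by auto
qed

lemma C_k_const: "C_k k (\<lambda>x::'a::euclidean_space. c)"
proof (induction k arbitrary: c)
  case (Suc k)
  then show ?case by (simp add: partial_derivativeI[OF has_derivative_const])
qed simp

lemma C_k_add: "C_k k f \<Longrightarrow> C_k k g \<Longrightarrow> C_k k (\<lambda>x. f x + g x)"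
proof (induction k arbitrary: f g)
  case 0
  then show ?case by (auto intro: continuous_intros)
next
  case (Suc k)
  have d: "f differentiable (at x)" "g differentiable (at x)" for x
    using Suc.prems by auto
  have "partial_derivative i (\<lambda>x. f x + g x) = (\<lambda>x. partial_derivative i f x + partial_derivative i g x)" for i
    using has_derivative_add[OF d(1)[unfolded frechet_derivative_works] d(2)[unfolded frechet_derivative_works]]
    by (intro ext partial_derivativeI)
  with Suc d show ?case by (auto intro: derivative_intros)
qed

text \<open>
  The product rule expresses a partial derivative of a product by products of \<open>C_k\<close>
  functions, so the induction on the order has to range over both factors.
\<close>

lemma C_k_mult: "C_k k f \<Longrightarrow> C_k k g \<Longrightarrow> C_k k (\<lambda>x. f x * g x)"
proof (induction k arbitrary: f g)
  case 0
  then show ?case by (auto intro: continuous_intros)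
next
  case (Suc k)
  have d: "f differentiable (at x)" "g differentiable (at x)" for x
    using Suc.prems by auto
  have "partial_derivative i (\<lambda>x. f x * g x)
      = (\<lambda>x. f x * partial_derivative i g x + partial_derivative i f x * g x)" for i
    using has_derivative_mult[OF d(1)[unfolded frechet_derivative_works] d(2)[unfolded frechet_derivative_works]]
    by (intro ext partial_derivativeI)
  moreover have "C_k k f" "C_k k g"
    using Suc.prems C_k_Suc_weaken by blast+
  ultimately show ?case
    using Suc d by (auto intro!: derivative_intros C_k_add)
qed

lemma C_k_compose:
  fixes T :: "real \<Rightarrow> real"
  shows "C_k k T \<Longrightarrow> C_k k f \<Longrightarrow> C_k k (\<lambda>x. T (f x))"
proof (induction k arbitrary: f T)
  case 0
  then show ?case by (auto intro: continuous_on_compose2)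
next
  case (Suc k)
  have d: "f differentiable (at x)" "T differentiable (at t)" for x t
    using Suc.prems by auto
  have T: "(T has_derivative (\<lambda>h. h * partial_derivative 1 T t)) (at t)" for t
    using d(2)[of t] unfolding frechet_derivative_works
    by (metis (no_types, lifting) linear_frechet_derivative[OF d(2)[of t], THEN linear_scale]
        ext mult.right_neutral real_scaleR_def)
  have D: "((\<lambda>x. T (f x)) has_derivative (\<lambda>h. frechet_derivative f (at x) h * partial_derivative 1 T (f x))) (at x)" for x
    using has_derivative_compose[OF d(1)[of x, unfolded frechet_derivative_works] T] .
  then have "partial_derivative i (\<lambda>x. T (f x))
      = (\<lambda>x. partial_derivative i f x * partial_derivative 1 T (f x))" for i
    by (auto intro!: ext partial_derivativeI)
  moreover have "C_k k f" "C_k k (partial_derivative 1 T)"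
    using Suc.prems C_k_Suc_weaken[of k f] by auto
  ultimately show ?case
    using Suc Derivative.differentiableI[OF D] by (auto intro!: C_k_mult simp del: split_paired_All)
qed

definition smooth :: "('a::euclidean_space \<Rightarrow> real) \<Rightarrow> bool" where
  "smooth f \<longleftrightarrow> (\<forall>k. C_k k f)"

definition grad :: "('a::euclidean_space \<Rightarrow> real) \<Rightarrow> 'a \<Rightarrow> 'a" where
  "grad f x = (\<Sum>i\<in>Basis. partial_derivative i f x *\<^sub>R i)"

lemma smooth_const [simp]: "smooth (\<lambda>x. c)"
  and smooth_add: "smooth f \<Longrightarrow> smooth g \<Longrightarrow> smooth (\<lambda>x. f x + g x)"
  and smooth_mult: "smooth f \<Longrightarrow> smooth g \<Longrightarrow> smooth (\<lambda>x. f x * g x)"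
  and smooth_compose: "smooth T \<Longrightarrow> smooth f \<Longrightarrow> smooth (\<lambda>x. T (f x))"
  unfolding smooth_def by (simp_all add: C_k_const C_k_add C_k_mult C_k_compose)

lemma smooth_diff: "smooth f \<Longrightarrow> smooth g \<Longrightarrow> smooth (\<lambda>x. f x - g x)"
  using smooth_add[of f "\<lambda>x. - 1 * g x"] smooth_mult[of "\<lambda>x. - 1" g] by auto

lemma smooth_sum: "(\<And>i. i \<in> I \<Longrightarrow> smooth (f i)) \<Longrightarrow> smooth (\<lambda>x. \<Sum>i\<in>I. f i x)"
  by (induction I rule: infinite_finite_induct) (simp_all add: smooth_add)

lemma smoothI:
  assumes "\<And>x. f differentiable (at x)" "\<And>i. i \<in> Basis \<Longrightarrow> smooth (partial_derivative i f)"
  shows "smooth f"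
  unfolding smooth_def
proof
  fix k show "C_k k f"
    by (rule C_k_Suc_weaken) (use assms in \<open>auto simp: smooth_def\<close>)
qed

lemma smooth_differentiable: "smooth f \<Longrightarrow> f differentiable (at x)"
  unfolding smooth_def by (metis C_k.simps(2))

lemma smooth_partial_derivative: "smooth f \<Longrightarrow> i \<in> Basis \<Longrightarrow> smooth (partial_derivative i f)"
  unfolding smooth_def by (metis C_k.simps(2))

lemma smooth_continuous: "smooth f \<Longrightarrow> continuous_on UNIV f"
  unfolding smooth_def by (metis C_k.simps(1))

lemma grad_inner_Basis [simp]: "i \<in> Basis \<Longrightarrow> grad f x \<bullet> i = partial_derivative i f x"
  by (simp add: grad_def)

lemma has_derivative_grad:
  assumes "f differentiable (at x)"
  shows "(f has_derivative (\<lambda>h. grad f x \<bullet> h)) (at x)"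
proof -
  have l: "linear (frechet_derivative f (at x))" by (rule linear_frechet_derivative[OF assms])
  have "frechet_derivative f (at x) h = grad f x \<bullet> h" for h
  proof -
    have "frechet_derivative f (at x) h = frechet_derivative f (at x) (\<Sum>i\<in>Basis. (h \<bullet> i) *\<^sub>R i)"
      by (simp add: euclidean_representation)
    also have "\<dots> = (\<Sum>i\<in>Basis. (h \<bullet> i) * partial_derivative i f x)"
      by (simp add: linear_sum[OF l] linear_scale[OF l])
    also have "\<dots> = grad f x \<bullet> h"
      by (simp add: grad_def inner_sum_right inner_commute[of _ h] mult.commute)
    finally show ?thesis .
  qed
  then show ?thesis using assms by (metis (no_types, lifting) ext frechet_derivative_works)
qed

lemma grad_unique:
  assumes "(f has_derivative f') (at x)" "\<And>h. f' h = v \<bullet> h"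
  shows "grad f x = v"
  using partial_derivativeI[OF assms(1)] by (simp add: grad_def assms(2) euclidean_representation)

lemma continuous_grad: "smooth f \<Longrightarrow> continuous_on UNIV (grad f)"
  unfolding grad_def[abs_def]
  by (intro continuous_on_sum continuous_on_scaleR continuous_on_const smooth_continuous smooth_partial_derivative)

lemma smooth_inner_left: "smooth (\<lambda>x. x \<bullet> a)"
proof (rule smoothI)
  have D: "((\<lambda>x. x \<bullet> a) has_derivative (\<lambda>h. h \<bullet> a)) (at x)" for x
    by (rule bounded_linear_imp_has_derivative[OF bounded_linear_inner_left])
  show "(\<lambda>x. x \<bullet> a) differentiable (at x)" for x using D by (auto simp: differentiable_def)
  show "smooth (partial_derivative i (\<lambda>x. x \<bullet> a))" for i
  proof -
    have "partial_derivative i (\<lambda>x. x \<bullet> a) = (\<lambda>x. i \<bullet> a)"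
      by (rule ext) (rule partial_derivativeI[OF D])
    then show ?thesis by (simp only: smooth_const)
  qed
qed

lemma has_derivative_affine:
  "((\<lambda>x. a + c *\<^sub>R x) has_derivative (\<lambda>h. c *\<^sub>R h)) (at x)"
  using has_derivative_add[OF has_derivative_const has_derivative_scaleR_right[OF has_derivative_ident]]
  by simp

lemma C_k_affine:
  fixes a :: "'a::euclidean_space"
  shows "C_k k f \<Longrightarrow> C_k k (\<lambda>x. f (a + c *\<^sub>R x))"
proof (induction k arbitrary: f)
  case 0
  then have "continuous_on UNIV f" by simp
  moreover have "continuous_on UNIV (\<lambda>x. a + c *\<^sub>R x)" by (intro continuous_intros)
  ultimately have "continuous_on UNIV (\<lambda>x. f (a + c *\<^sub>R x))"
    by (rule continuous_on_compose2[OF _ _ subset_UNIV])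
  then show ?case by simp
next
  case (Suc k)
  have d: "f differentiable (at x)" for x
    using Suc.prems by auto
  have D: "((\<lambda>x. f (a + c *\<^sub>R x)) has_derivative (\<lambda>h. frechet_derivative f (at (a + c *\<^sub>R x)) (c *\<^sub>R h))) (at x)" for x
    by (rule has_derivative_compose[OF has_derivative_affine d[unfolded frechet_derivative_works]])
  have P: "partial_derivative i (\<lambda>x. f (a + c *\<^sub>R x)) = (\<lambda>x. c * partial_derivative i f (a + c *\<^sub>R x))" for i
    by (rule ext) (simp only: partial_derivativeI[OF D] linear_scale[OF linear_frechet_derivative[OF d]] real_scaleR_def)
  have "C_k k (\<lambda>x. partial_derivative i f (a + c *\<^sub>R x))" if "i \<in> Basis" for i
    by (rule Suc.IH[of "partial_derivative i f"]) (use that Suc.prems in \<open>simp only: C_k.simps\<close>)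
  then have "C_k k (partial_derivative i (\<lambda>x. f (a + c *\<^sub>R x)))" if "i \<in> Basis" for i
    unfolding P using that by (intro C_k_mult C_k_const) simp
  moreover have "(\<lambda>x. f (a + c *\<^sub>R x)) differentiable (at x)" for x
    using D by (rule Derivative.differentiableI)
  ultimately show ?case
    by (intro C_k.simps(2)[THEN iffD2] conjI allI ballI)
qed

lemma smooth_affine: "smooth f \<Longrightarrow> smooth (\<lambda>x. f (a + c *\<^sub>R x))"
  unfolding smooth_def using C_k_affine by blast

lemma grad_affine:
  assumes "smooth f"
  shows "grad (\<lambda>x. f (a + c *\<^sub>R x)) x = c *\<^sub>R grad f (a + c *\<^sub>R x)"
proof (rule grad_unique)
  show "((\<lambda>x. f (a + c *\<^sub>R x)) has_derivative (\<lambda>h. grad f (a + c *\<^sub>R x) \<bullet> (c *\<^sub>R h))) (at x)"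
    by (rule has_derivative_compose[OF has_derivative_affine has_derivative_grad[OF smooth_differentiable[OF assms]]])
qed simp

lemma grad_add: "smooth f \<Longrightarrow> smooth g \<Longrightarrow> grad (\<lambda>x. f x + g x) x = grad f x + grad g x"
  by (rule grad_unique[OF has_derivative_add[OF has_derivative_grad has_derivative_grad]])
    (simp_all add: smooth_differentiable inner_add_left)

lemma grad_sum: "(\<And>i. i \<in> I \<Longrightarrow> smooth (f i)) \<Longrightarrow> grad (\<lambda>x. \<Sum>i\<in>I. f i x) x = (\<Sum>i\<in>I. grad (f i) x)"
proof (induction I rule: infinite_finite_induct)
  case (insert i I)
  then show ?case by (simp add: grad_add smooth_sum)
qed (auto intro!: grad_unique[OF has_derivative_const])

lemma grad_mult: "smooth f \<Longrightarrow> smooth g \<Longrightarrow> grad (\<lambda>x. f x * g x) x = f x *\<^sub>R grad g x + g x *\<^sub>R grad f x"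
  by (rule grad_unique[OF has_derivative_mult[OF has_derivative_grad has_derivative_grad]])
    (simp_all add: smooth_differentiable inner_add_left)

lemma grad_compose:
  assumes "smooth f" "(T has_real_derivative T') (at (f x))"
  shows "grad (\<lambda>x. T (f x)) x = T' *\<^sub>R grad f x"
proof (rule grad_unique)
  show "((\<lambda>x. T (f x)) has_derivative (\<lambda>h. T' * (grad f x \<bullet> h))) (at x)"
    using has_derivative_compose[OF has_derivative_grad[OF smooth_differentiable[OF assms(1)]]]
      assms(2)[unfolded has_field_derivative_def] by blast
qed simp

text \<open>
  Sine and cosine are treated together because differentiation interchanges them.
\<close>

lemma C_k_sin_cos: "C_k k (\<lambda>t::real. a * sin (b * t)) \<and> C_k k (\<lambda>t::real. a * cos (b * t))"
proof (induction k arbitrary: a)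
  case 0
  show ?case by (auto intro!: continuous_intros)
next
  case (Suc k)
  have D: "((\<lambda>t. a * sin (b * t)) has_derivative (\<lambda>h. h * (a * b * cos (b * t)))) (at t)"
    "((\<lambda>t. a * cos (b * t)) has_derivative (\<lambda>h. h * ((- a * b) * sin (b * t)))) (at t)" for t :: real
    by (auto intro!: derivative_eq_intros)
  have P: "partial_derivative 1 (\<lambda>t. a * sin (b * t)) = (\<lambda>t. (a * b) * cos (b * t))"
    "partial_derivative 1 (\<lambda>t. a * cos (b * t)) = (\<lambda>t. (- a * b) * sin (b * t))"
    by (rule ext, simp only: partial_derivativeI[OF D(1)] partial_derivativeI[OF D(2)] mult_1_left)+
  show ?case
    using Suc[of "a * b"] Suc[of "- a * b"] Derivative.differentiableI[OF D(1)] Derivative.differentiableI[OF D(2)]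
    unfolding C_k.simps(2) Basis_real_def by (auto simp only: P empty_iff insert_iff)
qed

lemma smooth_sin: "smooth (\<lambda>t::real. a * sin (b * t))"
  unfolding smooth_def using C_k_sin_cos by blast

subsection \<open>Bump functions\<close>

text \<open>
  The case \<open>j = 0\<close> is the standard smooth function \<open>e^{-1/t}\<close> that
  vanishes for \<open>t \<le> 0\<close>. The family with the extra factor \<open>t^{-j}\<close>
  is closed, up to linear combinations, under differentiation, which turns smoothness into an
  induction.
\<close>

definition flat_exp :: "nat \<Rightarrow> real \<Rightarrow> real" where
  "flat_exp j t = (if t > 0 then (1 / t) ^ j / exp (1 / t) else 0)"

text \<open>
  The exponential decay of \<open>e^{-1/t}\<close> beats every power of \<open>1/t\<close>; this
  is what glues the two branches, for the functions themselves and for their difference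
  quotients at \<open>0\<close>.
\<close>

lemma flat_exp_tendsto: "(flat_exp j \<longlongrightarrow> 0) (at 0)"
proof -
  have "((\<lambda>t::real. (1 / t) ^ j / exp (1 / t)) \<longlongrightarrow> 0) (at_right 0)"
    using filterlim_compose[OF tendsto_power_div_exp_0 filterlim_inverse_at_top_right]
    by (simp add: inverse_eq_divide)
  then have "(flat_exp j \<longlongrightarrow> 0) (at_right 0)"
    by (rule Lim_transform_eventually)
      (auto simp: flat_exp_def eventually_at_right_field intro: exI[of _ 1])
  moreover have "(flat_exp j \<longlongrightarrow> 0) (at_left 0)"
    by (rule Lim_transform_eventually[OF tendsto_const])
      (auto simp: flat_exp_def eventually_at_left_field intro: exI[of _ "-1"])
  ultimately show ?thesis by (simp add: filterlim_split_at)
qed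

lemma flat_exp_DERIV:
  "(flat_exp j has_real_derivative flat_exp (j + 2) t - real j * flat_exp (Suc j) t) (at t)"
proof -
  consider "t > 0" | "t < 0" | "t = 0" by linarith
  then show ?thesis
  proof cases
    case 1
    define s where "s = 1 / t"
    have F: "flat_exp i u = (1 / u) ^ i * exp (- (1 / u))" if "u > 0" for i u
      using that by (simp add: flat_exp_def exp_minus divide_inverse)
    have "((\<lambda>t. (1 / t) ^ j * exp (- (1 / t))) has_real_derivative
        s ^ j * (exp (- s) * (1 / (t * t))) + (real j * s ^ (j - 1) * (- 1 / (t * t))) * exp (- s)) (at t)"
      using 1 by (auto intro!: derivative_eq_intros simp: s_def)
    also have "1 / (t * t) = s * s"
      by (simp add: s_def)
    also have "- 1 / (t * t) = - (s * s)"
      by (simp add: s_def)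
    also have "s ^ j * (exp (- s) * (s * s)) + (real j * s ^ (j - 1) * - (s * s)) * exp (- s)
        = flat_exp (j + 2) t - real j * flat_exp (Suc j) t"
      unfolding F[OF 1] s_def[symmetric] by (cases j) (simp_all add: algebra_simps)
    finally show ?thesis
      by (rule has_field_derivative_transform_within_open[of _ _ _ "{0<..}"]) (use 1 F in auto)
  next
    case 2
    have "((\<lambda>_. 0) has_real_derivative 0) (at t)" by simp
    then have "(flat_exp j has_real_derivative 0) (at t)"
      by (rule has_field_derivative_transform_within_open[of _ _ _ "{..<0}"])
        (use 2 in \<open>auto simp: flat_exp_def\<close>)
    then show ?thesis using 2 by (simp add: flat_exp_def)
  next
    case 3
    \<comment> \<open>At \<open>0\<close> the difference quotient of \<open>flat_exp j\<close>
      is \<open>flat_exp (Suc j)\<close>.\<close>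
    have "((\<lambda>h. flat_exp (Suc j) h) \<longlongrightarrow> 0) (at 0)" by (rule flat_exp_tendsto)
    then have "((\<lambda>h. (flat_exp j (0 + h) - flat_exp j 0) / h) \<longlongrightarrow> 0) (at 0)"
      by (rule Lim_transform_eventually) (auto simp: eventually_at flat_exp_def field_simps intro: exI[of _ 1])
    then show ?thesis using 3 by (simp add: DERIV_def flat_exp_def)
  qed
qed

lemma C_k_flat_exp: "C_k k (flat_exp j)"
proof (induction k arbitrary: j)
  case 0
  show ?case
    using DERIV_isCont[OF flat_exp_DERIV] by (simp add: continuous_on_eq_continuous_at)
next
  case (Suc k)
  have "partial_derivative 1 (flat_exp j) = (\<lambda>t. flat_exp (j + 2) t + (- real j) * flat_exp (Suc j) t)"
    using partial_derivativeI[OF flat_exp_DERIV[unfolded has_field_derivative_def]] by auto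
  moreover have "C_k k \<dots>"
    by (intro C_k_add C_k_mult C_k_const Suc)
  moreover have "flat_exp j differentiable at t" for t
    using flat_exp_DERIV unfolding has_field_derivative_def differentiable_def by blast
  ultimately show ?case by simp
qed

lemma smooth_flat_exp: "smooth (flat_exp j)"
  unfolding smooth_def using C_k_flat_exp by blast

definition bump :: "'a::euclidean_space \<Rightarrow> real \<Rightarrow> 'a \<Rightarrow> real" where
  "bump z r x = flat_exp 0 (r\<^sup>2 - (x - z) \<bullet> (x - z))"

lemma smooth_bump: "smooth (bump z r)"
proof -
  \<comment> \<open>Expanding the square reduces smoothness to that of coordinates.\<close>
  have "(\<lambda>x::'a. r\<^sup>2 - (x - z) \<bullet> (x - z))
      = (\<lambda>x. (r\<^sup>2 - z \<bullet> z) + 2 * (x \<bullet> z) - (\<Sum>i\<in>Basis. (x \<bullet> i) * (x \<bullet> i)))"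
    by (subst euclidean_inner[symmetric]) (auto simp: inner_diff_left inner_diff_right inner_commute)
  moreover have "smooth \<dots>"
    by (intro smooth_diff smooth_add smooth_mult smooth_sum smooth_const smooth_inner_left)
  ultimately show ?thesis
    unfolding bump_def[abs_def] using smooth_compose[OF smooth_flat_exp] by metis
qed

lemma bump_nonneg: "0 \<le> bump z r x"
  by (simp add: bump_def flat_exp_def)

lemma bump_pos_iff:
  assumes "r > 0"
  shows "0 < bump z r x \<longleftrightarrow> x \<in> ball z r"
proof -
  have "0 < bump z r x \<longleftrightarrow> \<not> r\<^sup>2 \<le> (norm (x - z))\<^sup>2"
    by (simp add: bump_def flat_exp_def power2_norm_eq_inner)
  also have "\<dots> \<longleftrightarrow> x \<in> ball z r"
    using assms by (simp add: power_mono_iff dist_norm norm_minus_commute not_le)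
  finally show ?thesis .
qed

section \<open>Test functions\<close>

lemma test_functions_smooth: "\<phi> \<in> test_functions \<Omega> \<Longrightarrow> smooth \<phi>"
  by (simp add: test_functions_def smooth_def)

lemma test_functionsI:
  assumes "smooth \<phi>" "compact K" "K \<subseteq> \<Omega>" "\<And>x. x \<notin> K \<Longrightarrow> \<phi> x = 0"
  shows "\<phi> \<in> test_functions \<Omega>"
proof -
  have "closure {x. \<phi> x \<noteq> 0} \<subseteq> K"
    using assms(2,4) by (intro closure_minimal) (auto dest: compact_imp_closed)
  then show ?thesis
    using assms(1,2,3) compact_Int_closed[of K "closure {x. \<phi> x \<noteq> 0}"]
    by (auto simp: test_functions_def smooth_def Int_absorb1)
qed

lemma test_functionsE:
  assumes "\<phi> \<in> test_functions \<Omega>"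
  obtains K where "compact K" "K \<subseteq> \<Omega>" "\<And>x. x \<notin> K \<Longrightarrow> \<phi> x = 0" "\<And>x. x \<notin> K \<Longrightarrow> grad \<phi> x = 0"
proof
  let ?K = "closure {x. \<phi> x \<noteq> 0}"
  show "compact ?K" "?K \<subseteq> \<Omega>"
    using assms by (auto simp: test_functions_def)
  show *: "\<phi> x = 0" if "x \<notin> ?K" for x
  proof -
    have "x \<notin> {x. \<phi> x \<noteq> 0}" using that closure_subset[of "{x. \<phi> x \<noteq> 0}"] by (rule contra_subsetD[rotated])
    then show ?thesis by simp
  qed
  show "grad \<phi> x = 0" if "x \<notin> ?K" for x
  proof (rule grad_unique)
    have "open (- ?K)" by (intro open_Compl closed_closure)
    moreover have "x \<in> - ?K" using that by (simp only: Compl_iff simp_thms)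
    moreover have "0 = \<phi> y" if "y \<in> - ?K" for y
      using *[OF ComplD[OF that]] by (rule sym)
    ultimately show "(\<phi> has_derivative (\<lambda>_. 0)) (at x)"
      by (rule has_derivative_transform_within_open[OF has_derivative_const])
  qed simp
qed

lemma test_functions_mono: "\<phi> \<in> test_functions \<Omega> \<Longrightarrow> \<Omega> \<subseteq> \<Omega>' \<Longrightarrow> \<phi> \<in> test_functions \<Omega>'"
  by (auto simp: test_functions_def)

lemma test_functions_0: "(\<lambda>x. 0) \<in> test_functions \<Omega>"
  by (rule test_functionsI[of _ "{}"]) auto

lemma test_functions_mult:
  assumes "smooth \<psi>" "\<phi> \<in> test_functions \<Omega>"
  shows "(\<lambda>x. \<psi> x * \<phi> x) \<in> test_functions \<Omega>"
proof (rule test_functionsE[OF assms(2)])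
  fix K assume "compact K" "K \<subseteq> \<Omega>" "\<And>x. x \<notin> K \<Longrightarrow> \<phi> x = 0"
  then show ?thesis
    by (intro test_functionsI[of _ K] smooth_mult assms(1) test_functions_smooth[OF assms(2)]) auto
qed

lemma test_functions_add:
  assumes "\<phi> \<in> test_functions \<Omega>" "\<psi> \<in> test_functions \<Omega>"
  shows "(\<lambda>x. \<phi> x + \<psi> x) \<in> test_functions \<Omega>"
proof -
  obtain K where K: "compact K" "K \<subseteq> \<Omega>" "\<And>x. x \<notin> K \<Longrightarrow> \<phi> x = 0" by (rule test_functionsE[OF assms(1)]) blast
  obtain K' where K': "compact K'" "K' \<subseteq> \<Omega>" "\<And>x. x \<notin> K' \<Longrightarrow> \<psi> x = 0" by (rule test_functionsE[OF assms(2)]) blast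
  show ?thesis
    by (rule test_functionsI[of _ "K \<union> K'"])
      (use K K' in \<open>auto intro: smooth_add test_functions_smooth assms\<close>)
qed

lemma test_functions_compose:
  assumes "smooth T" "T 0 = 0" "\<phi> \<in> test_functions \<Omega>"
  shows "(\<lambda>x. T (\<phi> x)) \<in> test_functions \<Omega>"
proof (rule test_functionsE[OF assms(3)])
  fix K assume "compact K" "K \<subseteq> \<Omega>" "\<And>x. x \<notin> K \<Longrightarrow> \<phi> x = 0"
  then show ?thesis
    using assms(2)
    by (intro test_functionsI[OF smooth_compose[OF assms(1) test_functions_smooth[OF assms(3)]], of K]) auto
qed

lemma test_functions_partial_derivative:
  assumes "\<phi> \<in> test_functions \<Omega>" "i \<in> Basis"
  shows "partial_derivative i \<phi> \<in> test_functions \<Omega>"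
proof (rule test_functionsE[OF assms(1)])
  fix K assume "compact K" "K \<subseteq> \<Omega>" "\<And>x. x \<notin> K \<Longrightarrow> grad \<phi> x = 0"
  then show ?thesis
    using grad_inner_Basis[OF assms(2), of \<phi>]
    by (intro test_functionsI[of _ K] smooth_partial_derivative test_functions_smooth[OF assms(1)] assms(2))
      (auto simp flip: grad_inner_Basis[OF assms(2)])
qed

lemma compact_support_bounded:
  fixes f :: "'a::euclidean_space \<Rightarrow> 'b::real_normed_vector"
  assumes "continuous_on UNIV f" "compact K" "\<And>x. x \<notin> K \<Longrightarrow> f x = 0"
  obtains B where "B > 0" "\<And>x. norm (f x) \<le> B"
proof -
  have "bounded (f ` K)"
    using assms(1,2) by (intro compact_imp_bounded compact_continuous_image) (auto intro: continuous_on_subset)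
  then obtain B where B: "B > 0" "\<And>x. x \<in> K \<Longrightarrow> norm (f x) \<le> B"
    unfolding bounded_pos by blast
  show ?thesis
  proof (rule that)
    show "norm (f x) \<le> B" for x
      using B assms(3)[of x] by (cases "x \<in> K") auto
  qed fact
qed

lemma compact_support_integrable:
  fixes f :: "'a::euclidean_space \<Rightarrow> 'b::euclidean_space"
  assumes "continuous_on UNIV f" "compact K" "\<And>x. x \<notin> K \<Longrightarrow> f x = 0"
  shows "integrable lborel f"
proof -
  have "integrable lborel (\<lambda>x. indicator K x *\<^sub>R f x)"
    using assms(1,2) by (intro borel_integrable_compact) (auto intro: continuous_on_subset)
  also have "(\<lambda>x. indicator K x *\<^sub>R f x) = f"
    using assms(3) by (auto simp: fun_eq_iff indicator_def)
  finally show ?thesis .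
qed

lemma test_functions_continuous: "\<phi> \<in> test_functions \<Omega> \<Longrightarrow> continuous_on UNIV \<phi>"
  and test_functions_continuous_grad: "\<phi> \<in> test_functions \<Omega> \<Longrightarrow> continuous_on UNIV (grad \<phi>)"
  using test_functions_smooth smooth_continuous continuous_grad by blast+

lemma test_functions_borel [measurable_dest]: "\<phi> \<in> test_functions \<Omega> \<Longrightarrow> \<phi> \<in> borel_measurable borel"
  and test_functions_borel_grad: "\<phi> \<in> test_functions \<Omega> \<Longrightarrow> grad \<phi> \<in> borel_measurable borel"
  by (simp_all add: borel_measurable_continuous_onI test_functions_continuous test_functions_continuous_grad)

lemma test_functions_integrable:
  assumes "\<phi> \<in> test_functions \<Omega>"
  shows "integrable lborel \<phi>" "integrable lborel (grad \<phi>)"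
proof -
  obtain K where K: "compact K" "\<And>x. x \<notin> K \<Longrightarrow> \<phi> x = 0" "\<And>x. x \<notin> K \<Longrightarrow> grad \<phi> x = 0"
    by (rule test_functionsE[OF assms]) blast
  show "integrable lborel \<phi>"
    by (rule compact_support_integrable[OF test_functions_continuous[OF assms] K(1,2)])
  show "integrable lborel (grad \<phi>)"
    by (rule compact_support_integrable[OF test_functions_continuous_grad[OF assms] K(1,3)])
qed

lemma test_functions_bounded:
  assumes "\<phi> \<in> test_functions \<Omega>"
  obtains B where "B > 0" "\<And>x. \<bar>\<phi> x\<bar> \<le> B" "\<And>x. norm (grad \<phi> x) \<le> B"
proof -
  obtain K where K: "compact K" "\<And>x. x \<notin> K \<Longrightarrow> \<phi> x = 0" "\<And>x. x \<notin> K \<Longrightarrow> grad \<phi> x = 0"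
    by (rule test_functionsE[OF assms]) blast
  obtain B1 where "B1 > 0" "\<And>x. norm (\<phi> x) \<le> B1"
    using compact_support_bounded[OF test_functions_continuous[OF assms] K(1,2)] by blast
  moreover obtain B2 where "B2 > 0" "\<And>x. norm (grad \<phi> x) \<le> B2"
    using compact_support_bounded[OF test_functions_continuous_grad[OF assms] K(1,3)] by blast
  ultimately show ?thesis
    by (intro that[of "max B1 B2"]) (auto simp: le_max_iff_disj)
qed

text \<open>
  The mean value inequality in the form used below: for truncations, for kernels and for
  multipliers.
\<close>

lemma grad_bound_imp_lipschitz:
  assumes "\<And>x. f differentiable (at x)" "\<And>x. norm (grad f x) \<le> B"
  shows "\<bar>f x - f y\<bar> \<le> B * norm (x - y)"
proof -
  have "norm (f x - f y) \<le> B * norm (x - y)"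
  proof (rule differentiable_bound[of UNIV f "\<lambda>x h. grad f x \<bullet> h" B x y])
    show "onorm (\<lambda>h. grad f x \<bullet> h) \<le> B" for x
    proof (rule onorm_bound)
      show "0 \<le> B" using assms(2) norm_ge_zero order_trans by blast
      show "norm (grad f x \<bullet> h) \<le> B * norm h" for h
        using Cauchy_Schwarz_ineq2[of "grad f x" h] mult_right_mono[OF assms(2)[of x] norm_ge_zero[of h]] by simp
    qed
  qed (use assms(1) has_derivative_grad in auto)
  then show ?thesis by simp
qed

section \<open>Integrals over the whole space\<close>

lemma nn_integral_lborel_affine:
  fixes t :: "'a::euclidean_space"
  assumes [measurable]: "f \<in> borel_measurable borel" and c: "c \<noteq> 0"
  shows "(\<integral>\<^sup>+x. f x \<partial>lborel) = ennreal (\<bar>c\<bar> ^ DIM('a)) * (\<integral>\<^sup>+x. f (t + c *\<^sub>R x) \<partial>lborel)"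
  by (subst lborel_affine[OF c, of t])
    (simp add: nn_integral_density nn_integral_distr nn_integral_cmult)

lemma integrable_lborel_affine:
  fixes f :: "'a::euclidean_space \<Rightarrow> 'b :: {banach, second_countable_topology}"
  assumes f: "integrable lborel f" and c: "c \<noteq> 0"
  shows "integrable lborel (\<lambda>x. f (t + c *\<^sub>R x))"
proof -
  have [measurable]: "f \<in> borel_measurable borel" using f by (simp add: borel_measurable_integrable)
  have "(\<integral>\<^sup>+x. norm (f x) \<partial>lborel) < \<infinity>" using f by (simp add: integrable_iff_bounded)
  then have "(\<integral>\<^sup>+x. norm (f (t + c *\<^sub>R x)) \<partial>lborel) < \<infinity>"
    using c by (subst (asm) nn_integral_lborel_affine[where c=c and t=t]) (auto simp: ennreal_mult_less_top)
  then show ?thesis by (simp add: integrable_iff_bounded)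
qed

lemma integral_lborel_affine:
  fixes f :: "'a::euclidean_space \<Rightarrow> 'b :: {banach, second_countable_topology}"
  assumes c: "c \<noteq> 0" and f: "integrable lborel f"
  shows "(\<integral>x. f x \<partial>lborel) = (\<bar>c\<bar> ^ DIM('a)) *\<^sub>R (\<integral>x. f (t + c *\<^sub>R x) \<partial>lborel)"
proof -
  have [measurable]: "f \<in> borel_measurable borel" using f by (simp add: borel_measurable_integrable)
  show ?thesis
    using integrable_lborel_affine[OF f c, of t]
    by (subst lborel_affine[OF c, of t]) (simp add: integral_density integral_distr)
qed

lemma integral_lborel_shift:
  fixes f :: "'a::euclidean_space \<Rightarrow> 'b :: {banach, second_countable_topology}"
  assumes "integrable lborel f"
  shows "(\<integral>x. f (x + h) \<partial>lborel) = (\<integral>x. f x \<partial>lborel)" "integrable lborel (\<lambda>x. f (x + h))"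
  using integral_lborel_affine[OF _ assms, of 1 h] integrable_lborel_affine[OF assms, of 1 h]
  by (simp_all add: add.commute)

lemma integral_lborel_reflect:
  fixes f :: "'a::euclidean_space \<Rightarrow> 'b :: {banach, second_countable_topology}"
  assumes "integrable lborel f"
  shows "(\<integral>x. f (z - x) \<partial>lborel) = (\<integral>x. f x \<partial>lborel)" "integrable lborel (\<lambda>x. f (z - x))"
  using integral_lborel_affine[OF _ assms, of "-1" z] integrable_lborel_affine[OF assms, of "-1" z]
  by simp_all

text \<open>
  The difference quotients integrate to zero by translation invariance of Lebesgue measure, and
  they converge boundedly with supports in one fixed ball. Integration by parts follows without
  Fubini or boundary terms.
\<close>

lemma integral_partial_derivative:
  assumes "\<phi> \<in> test_functions UNIV" "i \<in> Basis"
  shows "(\<integral>x. partial_derivative i \<phi> x \<partial>lborel) = 0"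
proof -
  obtain B where B: "B > 0" "\<And>x. norm (grad \<phi> x) \<le> B"
    using test_functions_bounded[OF assms(1)] by metis
  obtain K where K: "compact K" "\<And>x. x \<notin> K \<Longrightarrow> \<phi> x = 0"
    by (rule test_functionsE[OF assms(1)]) blast
  obtain R where R: "\<And>x. x \<in> K \<Longrightarrow> norm x \<le> R"
    using compact_imp_bounded[OF K(1)] unfolding bounded_iff by blast
  have d: "\<phi> differentiable (at x)" for x
    using assms(1) test_functions_smooth smooth_differentiable by blast
  define h where "h n = 1 / real (Suc n)" for n
  define q where "q n x = (\<phi> (x + h n *\<^sub>R i) - \<phi> x) / h n" for n x
  have h: "0 < h n" "h n \<le> 1" for n by (auto simp: h_def)
  have h0: "h \<longlonglongrightarrow> 0" using LIMSEQ_inverse_real_of_nat by (simp add: h_def[abs_def] inverse_eq_divide)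
  have [measurable]: "\<phi> \<in> borel_measurable borel" using assms(1) by measurable
  have "(\<lambda>n. \<integral>x. q n x \<partial>lborel) \<longlonglongrightarrow> (\<integral>x. partial_derivative i \<phi> x \<partial>lborel)"
  proof (rule integral_dominated_convergence[where w="\<lambda>x. B * indicator (cball 0 (R + 1)) x"])
    show "partial_derivative i \<phi> \<in> borel_measurable lborel"
      using test_functions_borel[OF test_functions_partial_derivative[OF assms]] by simp
    show "q n \<in> borel_measurable lborel" for n by (simp add: q_def[abs_def])
    show "integrable lborel (\<lambda>x. B * indicator (cball 0 (R + 1)) x)"
      by (intro integrable_mult_right integrable_real_indicator) (simp_all add: emeasure_lborel_cball_finite[unfolded infinity_ennreal_def])
    show "AE x in lborel. (\<lambda>n. q n x) \<longlonglongrightarrow> partial_derivative i \<phi> x"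
    proof (rule AE_I2)
      fix x
      have "((\<lambda>t. \<phi> (x + t *\<^sub>R i)) has_derivative (\<lambda>t. grad \<phi> (x + 0 *\<^sub>R i) \<bullet> (t *\<^sub>R i))) (at 0)"
        by (rule has_derivative_compose[OF _ has_derivative_grad[OF d], where f="\<lambda>t. x + t *\<^sub>R i"])
          (use has_derivative_add[OF has_derivative_const has_derivative_scaleR_left[OF has_derivative_ident]] in simp)
      then have "((\<lambda>t. \<phi> (x + t *\<^sub>R i)) has_real_derivative partial_derivative i \<phi> x) (at 0)"
        unfolding has_field_derivative_def by (simp add: assms(2) mult_commute_abs)
      then have "((\<lambda>t. (\<phi> (x + t *\<^sub>R i) - \<phi> x) / t) \<longlongrightarrow> partial_derivative i \<phi> x) (at 0)"
        by (simp add: DERIV_def)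
      moreover have "filterlim h (at 0) sequentially"
        using h0 h by (intro filterlim_atI) (auto simp: less_imp_neq[symmetric] intro: always_eventually)
      ultimately show "(\<lambda>n. q n x) \<longlonglongrightarrow> partial_derivative i \<phi> x"
        unfolding q_def by (rule filterlim_compose)
    qed
    \<comment> \<open>The radius \<open>R + 1\<close> covers the shifted supports because the
      steps \<open>h n\<close> are at most \<open>1\<close>.\<close>
    show "AE x in lborel. norm (q n x) \<le> B * indicator (cball 0 (R + 1)) x" for n
    proof (rule AE_I2)
      fix x
      have 1: "\<bar>\<phi> (x + h n *\<^sub>R i) - \<phi> x\<bar> \<le> B * h n"
        using grad_bound_imp_lipschitz[OF d B(2), of "x + h n *\<^sub>R i" x] assms(2) h[of n] by simp
      show "norm (q n x) \<le> B * indicator (cball 0 (R + 1)) x"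
      proof (cases "norm x \<le> R + 1")
        case True
        then show ?thesis using 1 h[of n] by (simp add: q_def field_simps)
      next
        case False
        have "norm x \<le> norm (x + h n *\<^sub>R i) + norm (h n *\<^sub>R i)"
          by (metis add_diff_cancel_right' norm_triangle_ineq4)
        then have "\<not> norm (x + h n *\<^sub>R i) \<le> R" "\<not> norm x \<le> R"
          using False h[of n] assms(2) by auto
        then have "\<phi> (x + h n *\<^sub>R i) = 0" "\<phi> x = 0" using K(2) R by blast+
        then show ?thesis using B(1) by (simp add: q_def)
      qed
    qed
  qed
  moreover have "(\<integral>x. q n x \<partial>lborel) = 0" for n
    using integral_lborel_shift[OF test_functions_integrable(1)[OF assms(1)], of "h n *\<^sub>R i"]
      test_functions_integrable(1)[OF assms(1)]
    by (simp add: q_def)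
  ultimately show ?thesis by (simp add: LIMSEQ_const_iff)
qed

lemma integration_by_parts:
  assumes "\<phi> \<in> test_functions UNIV" "smooth \<psi>" "i \<in> Basis"
  shows "(\<integral>x. \<phi> x * partial_derivative i \<psi> x \<partial>lborel) = - (\<integral>x. partial_derivative i \<phi> x * \<psi> x \<partial>lborel)"
proof -
  have s: "smooth \<phi>" using assms(1) by (rule test_functions_smooth)
  have "partial_derivative i (\<lambda>x. \<psi> x * \<phi> x) x = partial_derivative i \<psi> x * \<phi> x + \<psi> x * partial_derivative i \<phi> x" for x
    using arg_cong[OF grad_mult[OF assms(2) s, of x], of "\<lambda>v. v \<bullet> i"] assms(3)
    by (simp add: inner_add_left mult.commute add.commute)
  moreover have "integrable lborel (\<lambda>x. partial_derivative i \<psi> x * \<phi> x)" "integrable lborel (\<lambda>x. \<psi> x * partial_derivative i \<phi> x)"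
    using assms test_functions_integrable(1) test_functions_mult smooth_partial_derivative test_functions_partial_derivative by blast+
  ultimately show ?thesis
    using integral_partial_derivative[OF test_functions_mult[OF assms(2,1)] assms(3)]
    by (simp add: mult.commute)
qed

section \<open>Mollification\<close>

subsection \<open>Continuity of translations in the mean\<close>

definition L1_translation_continuous :: "('a::euclidean_space \<Rightarrow> 'b::euclidean_space) \<Rightarrow> bool" where
  "L1_translation_continuous f \<longleftrightarrow>
     (\<forall>e>0. \<exists>d>0. \<forall>h. norm h < d \<longrightarrow> (\<integral>x. norm (f (x + h) - f x) \<partial>lborel) < e)"

lemma L1_translation_continuous_approx:
  fixes f :: "'a::euclidean_space \<Rightarrow> 'b::euclidean_space"
  assumes f: "integrable lborel f"
    and approx: "\<And>e. e > 0 \<Longrightarrow> \<exists>g. integrable lborel g \<and> L1_translation_continuous g \<and> (\<integral>x. norm (f x - g x) \<partial>lborel) < e"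
  shows "L1_translation_continuous f"
  unfolding L1_translation_continuous_def
proof (intro allI impI)
  fix e :: real assume "e > 0"
  then obtain g where g: "integrable lborel g" "L1_translation_continuous g"
    and fg: "(\<integral>x. norm (f x - g x) \<partial>lborel) < e / 3"
    using approx[of "e / 3"] by auto
  have "e / 3 > 0" using \<open>e > 0\<close> by simp
  then obtain d where d: "d > 0" "\<And>h. norm h < d \<Longrightarrow> (\<integral>x. norm (g (x + h) - g x) \<partial>lborel) < e / 3"
    using g(2) unfolding L1_translation_continuous_def by blast
  show "\<exists>d>0. \<forall>h. norm h < d \<longrightarrow> (\<integral>x. norm (f (x + h) - f x) \<partial>lborel) < e"
  proof (intro exI[of _ d] conjI allI impI d(1))
    fix h :: 'a assume h: "norm h < d"
    have i1: "integrable lborel (\<lambda>x. norm (f x - g x))"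
      using f g(1) by simp
    note i2 = integral_lborel_shift[OF i1, of h]
    have i3: "integrable lborel (\<lambda>x. norm (g (x + h) - g x))" "integrable lborel (\<lambda>x. norm (f (x + h) - f x))"
      using integral_lborel_shift(2)[OF g(1), of h] integral_lborel_shift(2)[OF f, of h] f g(1) by simp_all
    have "(\<integral>x. norm (f (x + h) - f x) \<partial>lborel)
        \<le> (\<integral>x. norm (f (x + h) - g (x + h)) + norm (g (x + h) - g x) + norm (f x - g x) \<partial>lborel)"
    proof (rule integral_mono)
      show "norm (f (x + h) - f x) \<le> norm (f (x + h) - g (x + h)) + norm (g (x + h) - g x) + norm (f x - g x)" for x
        using norm_triangle_ineq[of "(f (x + h) - g (x + h)) + (g (x + h) - g x)" "g x - f x"]
          norm_triangle_ineq[of "f (x + h) - g (x + h)" "g (x + h) - g x"]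
        by (simp add: norm_minus_commute[of "f x"])
    qed (use i1 i2 i3 in auto)
    also have "\<dots> = (\<integral>x. norm (f x - g x) \<partial>lborel) + (\<integral>x. norm (g (x + h) - g x) \<partial>lborel) + (\<integral>x. norm (f x - g x) \<partial>lborel)"
      using i1 i2 i3 by simp
    also have "\<dots> < e" using fg d(2)[OF h] by simp
    finally show "(\<integral>x. norm (f (x + h) - f x) \<partial>lborel) < e" .
  qed
qed

text \<open>
  For an open set of finite measure, translates contain a given point of the set eventually, so
  the part of the set that is lost tends to zero by dominated convergence. Translation preserves
  the measure, hence as much is gained as is lost and the whole difference is twice the lost
  part.
\<close>

lemma L1_translation_continuous_open:
  fixes c :: "'b::euclidean_space" and U :: "'a::euclidean_space set"
  assumes U: "open U" "emeasure lborel U < \<infinity>"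
  shows "L1_translation_continuous (\<lambda>x. indicator U x *\<^sub>R c)"
proof (rule ccontr)
  assume "\<not> ?thesis"
  then obtain e where e: "e > 0"
    "\<And>d. d > 0 \<Longrightarrow> \<exists>h. norm h < d \<and> \<not> (\<integral>x. norm (indicator U (x + h) *\<^sub>R c - indicator U x *\<^sub>R c) \<partial>lborel) < e"
    unfolding L1_translation_continuous_def by blast
  have "\<forall>n. \<exists>h. norm h < 1 / real (Suc n) \<and> \<not> (\<integral>x. norm (indicator U (x + h) *\<^sub>R c - indicator U x *\<^sub>R c) \<partial>lborel) < e"
    by (intro allI e(2)) simp
  then obtain h where h: "\<And>n. norm (h n) < 1 / real (Suc n)"
    "\<And>n. \<not> (\<integral>x. norm (indicator U (x + h n) *\<^sub>R c - indicator U x *\<^sub>R c) \<partial>lborel) < e"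
    by metis
  have h0: "h \<longlonglongrightarrow> 0"
    by (rule Lim_null_comparison[OF always_eventually LIMSEQ_inverse_real_of_nat])
      (use h(1) in \<open>auto simp: inverse_eq_divide less_imp_le\<close>)
  have [measurable]: "U \<in> sets borel" using U(1) by simp
  let ?I = "indicator U :: 'a \<Rightarrow> real"
  have iU: "integrable lborel ?I" using U by (intro integrable_real_indicator) auto
  note iUh = integral_lborel_shift[OF iU]
  have "(\<lambda>n. \<integral>x. max 0 (?I x - ?I (x + h n)) \<partial>lborel) \<longlonglongrightarrow> (\<integral>x. 0 \<partial>(lborel :: 'a measure))"
  proof (rule integral_dominated_convergence[where w="?I"])
    show "AE x in lborel. (\<lambda>n. max 0 (?I x - ?I (x + h n))) \<longlonglongrightarrow> 0"
    proof (rule AE_I2)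
      fix x
      show "(\<lambda>n. max 0 (?I x - ?I (x + h n))) \<longlonglongrightarrow> 0"
      proof (cases "x \<in> U")
        case True
        have "(\<lambda>n. x + h n) \<longlonglongrightarrow> x" using tendsto_add[OF tendsto_const h0, of x] by simp
        then have "eventually (\<lambda>n. x + h n \<in> U) sequentially"
          using U(1) True by (rule topological_tendstoD)
        then show ?thesis
          by (intro tendsto_eventually) (auto elim!: eventually_mono simp: True)
      next
        case False
        then show ?thesis by (simp add: indicator_def)
      qed
    qed
  qed (use iU in \<open>auto simp: indicator_def\<close>)
  then have "(\<lambda>n. norm c * (2 * (\<integral>x. max 0 (?I x - ?I (x + h n)) \<partial>lborel))) \<longlonglongrightarrow> norm c * (2 * 0)"
    by (intro tendsto_mult tendsto_const) simp
  then have "eventually (\<lambda>n. norm c * (2 * (\<integral>x. max 0 (?I x - ?I (x + h n)) \<partial>lborel)) < e) sequentially"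
    using e(1) by (intro order_tendstoD) auto
  then obtain n where n: "norm c * (2 * (\<integral>x. max 0 (?I x - ?I (x + h n)) \<partial>lborel)) < e"
    by (auto simp: eventually_sequentially)
  have im: "integrable lborel (\<lambda>x. max 0 (?I x - ?I (x + h n)))"
    using iU iUh by (intro integrable_max) auto
  \<comment> \<open>Uses \<open>\<bar>a\<bar> = 2 * max 0 (- a) + a\<close>, where the integral
    of the last term vanishes.\<close>
  have "(\<integral>x. norm (?I (x + h n) *\<^sub>R c - ?I x *\<^sub>R c) \<partial>lborel)
      = (\<integral>x. norm c * (2 * max 0 (?I x - ?I (x + h n)) - (?I x - ?I (x + h n))) \<partial>lborel)"
    by (intro Bochner_Integration.integral_cong) (auto simp: indicator_def)
  also have "\<dots> = norm c * (2 * (\<integral>x. max 0 (?I x - ?I (x + h n)) \<partial>lborel))"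
    using im iU iUh[of "h n"] by simp
  finally show False using n h(2)[of n] by simp
qed

text \<open>
  From open sets to measurable sets by outer regularity, then to simple functions by linearity,
  then to all integrable functions by density; the property is stable under \<open>L^1\<close>
  limits by \<open>L1_translation_continuous_approx\<close>.
\<close>

lemma integrable_imp_L1_translation_continuous:
  fixes f :: "'a::euclidean_space \<Rightarrow> 'b::euclidean_space"
  assumes "integrable lborel f"
  shows "L1_translation_continuous f"
  using assms
proof (induction rule: integrable_induct)
  case (base A c)
  then have [measurable]: "A \<in> sets borel" by simp
  show ?case
  proof (rule L1_translation_continuous_approx)
    show "integrable lborel (\<lambda>x. indicator A x *\<^sub>R c)" using base by simp
    fix e :: real assume "e > 0"
    define e' where "e' = e / (norm c + 1)"
    have "e' > 0" using \<open>e > 0\<close> by (simp add: e'_def add_nonneg_pos)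
    then obtain U where U: "open U" "A \<subseteq> U" "emeasure lborel (U - A) < e'"
      using outer_regular_lborel[of A e'] by auto
    have [measurable]: "U \<in> sets borel" using U(1) by simp
    have "emeasure lborel U = emeasure lborel A + emeasure lborel (U - A)"
      using U(2) by (subst plus_emeasure) (auto simp: Un_absorb1)
    then have Ufin: "emeasure lborel U < \<infinity>" using base(2) U(3) less_trans[OF U(3) ennreal_less_top] by (simp add: ennreal_add_eq_top less_top)
    have fin: "emeasure lborel (U - A) < \<infinity>" using less_trans[OF U(3) ennreal_less_top] by simp
    have m: "measure lborel (U - A) < e'"
      using U(3) fin \<open>e' > 0\<close> by (simp add: measure_def enn2real_less_iff)
    show "\<exists>g. integrable lborel g \<and> L1_translation_continuous g \<and> (\<integral>x. norm (indicator A x *\<^sub>R c - g x) \<partial>lborel) < e"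
    proof (intro exI[of _ "\<lambda>x. indicator U x *\<^sub>R c"] conjI L1_translation_continuous_open U(1) Ufin)
      show "integrable lborel (\<lambda>x. indicator U x *\<^sub>R c)" using Ufin by simp
      have "(\<integral>x. norm (indicator A x *\<^sub>R c - indicator U x *\<^sub>R c) \<partial>lborel) = (\<integral>x. indicator (U - A) x * norm c \<partial>lborel)"
        using U(2) by (intro Bochner_Integration.integral_cong) (auto simp: indicator_def)
      also have "\<dots> = measure lborel (U - A) * norm c" by simp
      also have "\<dots> \<le> e' * norm c" using m by (intro mult_right_mono) auto
      also have "\<dots> < e" using \<open>e > 0\<close> norm_ge_zero[of c] by (simp add: e'_def divide_less_eq add_nonneg_pos)
      finally show "(\<integral>x. norm (indicator A x *\<^sub>R c - indicator U x *\<^sub>R c) \<partial>lborel) < e" .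
    qed
  qed
next
  case (add f g)
  show ?case
    unfolding L1_translation_continuous_def
  proof (intro allI impI)
    fix e :: real assume "e > 0"
    then have e2: "e / 2 > 0" by simp
    obtain d1 where d1: "d1 > 0" "\<And>h. norm h < d1 \<Longrightarrow> (\<integral>x. norm (f (x + h) - f x) \<partial>lborel) < e / 2"
      using add(3) e2 unfolding L1_translation_continuous_def by blast
    obtain d2 where d2: "d2 > 0" "\<And>h. norm h < d2 \<Longrightarrow> (\<integral>x. norm (g (x + h) - g x) \<partial>lborel) < e / 2"
      using add(4) e2 unfolding L1_translation_continuous_def by blast
    have "(\<integral>x. norm (f (x + h) + g (x + h) - (f x + g x)) \<partial>lborel) < e" if h: "norm h < min d1 d2" for h
    proof -
      note i = integral_lborel_shift(2)[OF add(1), of h] integral_lborel_shift(2)[OF add(2), of h] add(1,2)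
      have "(\<integral>x. norm (f (x + h) + g (x + h) - (f x + g x)) \<partial>lborel)
          \<le> (\<integral>x. norm (f (x + h) - f x) + norm (g (x + h) - g x) \<partial>lborel)"
        using i by (intro integral_mono) (auto simp: add_diff_add norm_triangle_ineq)
      also have "\<dots> = (\<integral>x. norm (f (x + h) - f x) \<partial>lborel) + (\<integral>x. norm (g (x + h) - g x) \<partial>lborel)"
        using i by simp
      also have "\<dots> < e" using d1(2)[of h] d2(2)[of h] h by simp
      finally show ?thesis .
    qed
    then show "\<exists>d>0. \<forall>h. norm h < d \<longrightarrow> (\<integral>x. norm (f (x + h) + g (x + h) - (f x + g x)) \<partial>lborel) < e"
      using d1(1) d2(1) by (intro exI[of _ "min d1 d2"]) auto
  qed
next
  case (lim f s)
  show ?case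
  proof (rule L1_translation_continuous_approx)
    fix e :: real assume "e > 0"
    have "(\<lambda>i. \<integral>x. norm (f x - s i x) \<partial>lborel) \<longlonglongrightarrow> (\<integral>x. 0 \<partial>(lborel :: 'a measure))"
    proof (rule integral_dominated_convergence[where w="\<lambda>x. 3 * norm (f x)"])
      show "AE x in lborel. (\<lambda>i. norm (f x - s i x)) \<longlonglongrightarrow> 0"
      proof (rule AE_I2)
        fix x
        have "(\<lambda>i. norm (f x - s i x)) \<longlonglongrightarrow> norm (f x - f x)"
          by (intro tendsto_norm tendsto_diff tendsto_const lim.hyps(2)) simp
        then show "(\<lambda>i. norm (f x - s i x)) \<longlonglongrightarrow> 0" by simp
      qed
      show "AE x in lborel. norm (norm (f x - s i x)) \<le> 3 * norm (f x)" for i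
      proof (rule AE_I2)
        fix x
        show "norm (norm (f x - s i x)) \<le> 3 * norm (f x)"
          using norm_triangle_ineq4[of "f x" "s i x"] lim.hyps(3)[of x i] by simp
      qed
    qed (use lim.hyps(1,4) in \<open>auto dest!: borel_measurable_integrable\<close>)
    then have "eventually (\<lambda>i. (\<integral>x. norm (f x - s i x) \<partial>lborel) < e) sequentially"
      using \<open>e > 0\<close> by (intro order_tendstoD) auto
    then obtain i where "(\<integral>x. norm (f x - s i x) \<partial>lborel) < e" by (auto simp: eventually_sequentially)
    then show "\<exists>g. integrable lborel g \<and> L1_translation_continuous g \<and> (\<integral>x. norm (f x - g x) \<partial>lborel) < e"
      using lim.hyps(1) lim.IH by blast
  qed (rule lim.hyps(4))
qed

subsection \<open>Convolution with a test function\<close>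

definition conv :: "('a::euclidean_space \<Rightarrow> real) \<Rightarrow> ('a \<Rightarrow> 'b::euclidean_space) \<Rightarrow> 'a \<Rightarrow> 'b" where
  "conv k f x = (\<integral>y. k (x - y) *\<^sub>R f y \<partial>lborel)"

lemma integrable_bounded_scaleR:
  fixes f :: "'a \<Rightarrow> 'b::{banach, second_countable_topology}"
  assumes "integrable M f" "a \<in> borel_measurable M" "\<And>x. \<bar>a x\<bar> \<le> B"
  shows "integrable M (\<lambda>x. a x *\<^sub>R f x)"
proof (rule Bochner_Integration.integrable_bound)
  show "integrable M (\<lambda>x. B *\<^sub>R f x)" using assms(1) by simp
  show "(\<lambda>x. a x *\<^sub>R f x) \<in> borel_measurable M"
    using borel_measurable_integrable[OF assms(1)] assms(2) by (intro borel_measurable_scaleR)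
  have "B \<ge> 0" using assms(3)[of undefined] by linarith
  then show "AE x in M. norm (a x *\<^sub>R f x) \<le> norm (B *\<^sub>R f x)"
    using assms(3) by (intro AE_I2) (simp add: mult_right_mono)
qed

lemma conv_integrable:
  fixes f :: "'a::euclidean_space \<Rightarrow> 'b::euclidean_space"
  assumes "k \<in> test_functions UNIV" "integrable lborel f"
  shows "integrable lborel (\<lambda>y. k (x - y) *\<^sub>R f y)"
    and "integrable lborel (\<lambda>z. k z *\<^sub>R f (x - z))"
proof -
  obtain B where B: "\<And>x. \<bar>k x\<bar> \<le> B" using test_functions_bounded[OF assms(1)] by metis
  have [measurable]: "k \<in> borel_measurable borel" using assms(1) by measurable
  show "integrable lborel (\<lambda>y. k (x - y) *\<^sub>R f y)"
    using integrable_bounded_scaleR[OF assms(2), of "\<lambda>y. k (x - y)" B] B by simp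
  show "integrable lborel (\<lambda>z. k z *\<^sub>R f (x - z))"
    using integrable_bounded_scaleR[OF integral_lborel_reflect(2)[OF assms(2), of x], of k B] B by simp
qed

lemma conv_commute:
  fixes f :: "'a::euclidean_space \<Rightarrow> 'b::euclidean_space"
  assumes "k \<in> test_functions UNIV" "integrable lborel f"
  shows "conv k f x = (\<integral>z. k z *\<^sub>R f (x - z) \<partial>lborel)"
  using integral_lborel_reflect(1)[OF conv_integrable(2)[OF assms, of x], of x]
  by (simp add: conv_def)

lemma conv_eq_0:
  assumes "\<And>y. k (x - y) = 0 \<or> f y = 0"
  shows "conv k f x = 0"
proof -
  have "(\<lambda>y. k (x - y) *\<^sub>R f y) = (\<lambda>y. 0)" using assms by (simp add: fun_eq_iff)
  then show ?thesis by (simp add: conv_def)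
qed

lemma integrable_grad_kernel:
  fixes f :: "'a::euclidean_space \<Rightarrow> real"
  assumes k: "k \<in> test_functions UNIV" and f: "integrable lborel f"
  shows "integrable lborel (\<lambda>y. f y *\<^sub>R grad k (x - y))"
proof -
  obtain B where B: "B > 0" "\<And>x. norm (grad k x) \<le> B" using test_functions_bounded[OF k] by metis
  have [measurable]: "grad k \<in> borel_measurable borel" using test_functions_borel_grad[OF k] by simp
  have [measurable]: "f \<in> borel_measurable borel" using f by (simp add: borel_measurable_integrable)
  show ?thesis
  proof (rule Bochner_Integration.integrable_bound)
    show "integrable lborel (\<lambda>y. B * f y)" using f by simp
    show "AE y in lborel. norm (f y *\<^sub>R grad k (x - y)) \<le> norm (B * f y)"
    proof (rule AE_I2)
      fix y
      have "norm (grad k (x - y)) * \<bar>f y\<bar> \<le> B * \<bar>f y\<bar>" using B(2) by (rule mult_right_mono) simp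
      then show "norm (f y *\<^sub>R grad k (x - y)) \<le> norm (B * f y)"
        using B(1) by (simp add: abs_mult mult.commute)
    qed
  qed simp
qed

text \<open>
  Differentiation under the integral sign: the normalised remainders of \<open>k\<close> are
  bounded by twice the bound on its gradient and tend to zero pointwise, so dominated
  convergence applies for any integrable \<open>f\<close>.
\<close>

lemma conv_has_derivative:
  fixes f :: "'a::euclidean_space \<Rightarrow> real"
  assumes k: "k \<in> test_functions UNIV" and f: "integrable lborel f"
  shows "(conv k f has_derivative (\<lambda>h. (\<integral>y. f y *\<^sub>R grad k (x - y) \<partial>lborel) \<bullet> h)) (at x)"
proof -
  obtain B where B: "B > 0" "\<And>x. norm (grad k x) \<le> B" using test_functions_bounded[OF k] by metis
  have d: "k differentiable (at x)" for x using k test_functions_smooth smooth_differentiable by blast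
  have [measurable]: "k \<in> borel_measurable borel" "grad k \<in> borel_measurable borel"
    using test_functions_borel[OF k] test_functions_borel_grad[OF k] by simp_all
  have [measurable]: "f \<in> borel_measurable borel" using f by (simp add: borel_measurable_integrable)
  let ?V = "\<integral>y. f y *\<^sub>R grad k (x - y) \<partial>lborel"
  have iV: "integrable lborel (\<lambda>y. f y *\<^sub>R grad k (x - y))"
    by (rule integrable_grad_kernel[OF k f])
  define q where "q h y = (k (x + h - y) - k (x - y) - grad k (x - y) \<bullet> h) / norm h" for h y
  have [measurable]: "q h \<in> borel_measurable borel" for h by (simp add: q_def[abs_def])
  have qb: "\<bar>q h y\<bar> \<le> 2 * B" for h y
  proof (cases "h = 0")
    case False
    have "\<bar>k (x + h - y) - k (x - y)\<bar> \<le> B * norm h"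
      using grad_bound_imp_lipschitz[OF d B(2), of "x + h - y" "x - y"] by simp
    moreover have "\<bar>grad k (x - y) \<bullet> h\<bar> \<le> B * norm h"
      using Cauchy_Schwarz_ineq2[of "grad k (x - y)" h] mult_right_mono[OF B(2) norm_ge_zero, of "x - y" h] by linarith
    ultimately show ?thesis using False by (simp add: q_def divide_le_eq)
  qed (use B in \<open>simp add: q_def\<close>)
  have qi: "integrable lborel (\<lambda>y. q h y * f y)" for h
    using integrable_bounded_scaleR[OF f, of "q h" "2 * B"] qb by simp
  have eq: "norm (conv k f (x + h) - conv k f x - ?V \<bullet> h) / norm h = \<bar>\<integral>y. q h y * f y \<partial>lborel\<bar>" if "h \<noteq> 0" for h
  proof -
    have i: "integrable lborel (\<lambda>y. (f y *\<^sub>R grad k (x - y)) \<bullet> h)"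
      by (rule integrable_inner_left) (rule iV)
    have V: "?V \<bullet> h = (\<integral>y. (f y *\<^sub>R grad k (x - y)) \<bullet> h \<partial>lborel)"
      by (rule integral_inner_left[symmetric]) (rule iV)
    have "conv k f (x + h) - conv k f x - ?V \<bullet> h
        = (\<integral>y. k (x + h - y) *\<^sub>R f y - k (x - y) *\<^sub>R f y - (f y *\<^sub>R grad k (x - y)) \<bullet> h \<partial>lborel)"
      unfolding V conv_def
      using conv_integrable(1)[OF k f, of x] conv_integrable(1)[OF k f, of "x + h"] i
      by (subst Bochner_Integration.integral_diff, simp, simp, subst Bochner_Integration.integral_diff) simp_all
    also have "\<dots> = (\<integral>y. norm h * (q h y * f y) \<partial>lborel)"
    proof (rule Bochner_Integration.integral_cong)
      fix y
      have *: "norm h * q h y = k (x + h - y) - k (x - y) - grad k (x - y) \<bullet> h"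
        using that by (simp add: q_def)
      show "k (x + h - y) *\<^sub>R f y - k (x - y) *\<^sub>R f y - (f y *\<^sub>R grad k (x - y)) \<bullet> h = norm h * (q h y * f y)"
        unfolding mult.assoc[symmetric] * by (simp add: algebra_simps)
    qed simp
    also have "\<dots> = norm h * (\<integral>y. q h y * f y \<partial>lborel)" using qi by simp
    finally show ?thesis using that by (simp add: abs_mult)
  qed
  have "(\<lambda>h. norm (conv k f (x + h) - conv k f x - ?V \<bullet> h) / norm h) \<midarrow>0\<rightarrow> 0"
    unfolding tendsto_at_iff_sequentially
  proof (intro allI impI)
    fix X :: "nat \<Rightarrow> 'a" assume X: "\<forall>i. X i \<in> UNIV - {0}" "X \<longlonglongrightarrow> 0"
    have "(\<lambda>n. \<integral>y. q (X n) y * f y \<partial>lborel) \<longlonglongrightarrow> (\<integral>y. 0 \<partial>(lborel :: 'a measure))"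
    proof (rule integral_dominated_convergence[where w="\<lambda>y. 2 * B * \<bar>f y\<bar>"])
      show "AE y in lborel. (\<lambda>n. q (X n) y * f y) \<longlonglongrightarrow> 0"
      proof (rule AE_I2)
        fix y
        have "(\<lambda>h. norm (k ((x - y) + h) - k (x - y) - grad k (x - y) \<bullet> h) / norm h) \<midarrow>0\<rightarrow> 0"
          using has_derivative_grad[OF d[of "x - y"]] unfolding has_derivative_at by blast
        then have "(\<lambda>n. norm (k ((x - y) + X n) - k (x - y) - grad k (x - y) \<bullet> X n) / norm (X n)) \<longlonglongrightarrow> 0"
          using X unfolding tendsto_at_iff_sequentially comp_def by blast
        then have "(\<lambda>n. \<bar>q (X n) y\<bar>) \<longlonglongrightarrow> 0"
          by (simp add: q_def algebra_simps)
        then have "(\<lambda>n. q (X n) y) \<longlonglongrightarrow> 0" by (rule tendsto_rabs_zero_cancel)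
        then show "(\<lambda>n. q (X n) y * f y) \<longlonglongrightarrow> 0" by (rule tendsto_mult_left_zero)
      qed
      show "AE y in lborel. norm (q (X n) y * f y) \<le> 2 * B * \<bar>f y\<bar>" for n
        using qb by (auto simp: abs_mult intro!: mult_right_mono)
    qed (use f in auto)
    then have "(\<lambda>n. \<bar>\<integral>y. q (X n) y * f y \<partial>lborel\<bar>) \<longlonglongrightarrow> 0"
      by (intro tendsto_rabs_zero) simp
    moreover have "(\<lambda>h. norm (conv k f (x + h) - conv k f x - ?V \<bullet> h) / norm h) \<circ> X
        = (\<lambda>n. \<bar>\<integral>y. q (X n) y * f y \<partial>lborel\<bar>)"
    proof
      fix n
      have "X n \<noteq> 0" using X(1) by auto
      from eq[OF this]
      show "((\<lambda>h. norm (conv k f (x + h) - conv k f x - ?V \<bullet> h) / norm h) \<circ> X) n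
          = \<bar>\<integral>y. q (X n) y * f y \<partial>lborel\<bar>" by (simp only: comp_def)
    qed
    ultimately show "((\<lambda>h. norm (conv k f (x + h) - conv k f x - ?V \<bullet> h) / norm h) \<circ> X) \<longlonglongrightarrow> 0"
      by simp
  qed
  then show ?thesis
    unfolding has_derivative_at using bounded_linear_inner_right by blast
qed

lemma grad_conv:
  fixes f :: "'a::euclidean_space \<Rightarrow> real"
  assumes "k \<in> test_functions UNIV" "integrable lborel f"
  shows "grad (conv k f) x = (\<integral>y. f y *\<^sub>R grad k (x - y) \<partial>lborel)"
  by (rule grad_unique[OF conv_has_derivative[OF assms]]) simp

lemma partial_derivative_conv:
  fixes f :: "'a::euclidean_space \<Rightarrow> real"
  assumes "k \<in> test_functions UNIV" "integrable lborel f" "i \<in> Basis"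
  shows "partial_derivative i (conv k f) = conv (partial_derivative i k) f"
proof
  fix x
  have "partial_derivative i (conv k f) x = (\<integral>y. f y *\<^sub>R grad k (x - y) \<partial>lborel) \<bullet> i"
    using grad_inner_Basis[OF assms(3), of "conv k f" x] by (simp add: grad_conv[OF assms(1,2)])
  also have "\<dots> = (\<integral>y. (f y *\<^sub>R grad k (x - y)) \<bullet> i \<partial>lborel)"
    by (rule integral_inner_left[symmetric]) (rule integrable_grad_kernel[OF assms(1,2)])
  also have "\<dots> = conv (partial_derivative i k) f x"
    by (simp add: conv_def assms(3) mult.commute)
  finally show "partial_derivative i (conv k f) x = conv (partial_derivative i k) f x" .
qed

lemma smooth_conv:
  fixes f :: "'a::euclidean_space \<Rightarrow> real"
  assumes "k \<in> test_functions UNIV" "integrable lborel f"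
  shows "smooth (conv k f)"
proof -
  have "C_k n (conv k f)" if "k \<in> test_functions UNIV" for n k
    using that
  proof (induction n arbitrary: k)
    case 0
    have "isCont (conv k f) x" for x
      using conv_has_derivative[OF 0 assms(2)] has_derivative_continuous by blast
    then show ?case by (simp add: continuous_on_eq_continuous_at)
  next
    case (Suc n)
    have "C_k n (partial_derivative i (conv k f))" if "i \<in> Basis" for i
      unfolding partial_derivative_conv[OF Suc.prems assms(2) that]
      by (rule Suc.IH[OF test_functions_partial_derivative[OF Suc.prems that]])
    moreover have "conv k f differentiable (at x)" for x
      using conv_has_derivative[OF Suc.prems assms(2)] by (rule Derivative.differentiableI)
    ultimately show ?case by (intro C_k.simps(2)[THEN iffD2] conjI allI ballI)
  qed
  with assms(1) show ?thesis by (simp add: smooth_def)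
qed

text \<open>
  A kernel may be concentrated away from the origin; then it translates while it smooths.
\<close>

definition mollifier :: "real \<Rightarrow> ('a::euclidean_space \<Rightarrow> real) \<Rightarrow> bool" where
  "mollifier \<delta> k \<longleftrightarrow> k \<in> test_functions UNIV \<and> (\<forall>x. 0 \<le> k x) \<and> (\<integral>x. k x \<partial>lborel) = 1 \<and>
     (\<forall>x. \<delta> \<le> norm x \<longrightarrow> k x = 0)"

lemma mollifierD:
  assumes "mollifier \<delta> k"
  shows "k \<in> test_functions UNIV" "0 \<le> k x" "(\<integral>x. k x \<partial>lborel) = 1" "\<delta> \<le> norm x \<Longrightarrow> k x = 0"
    "integrable lborel k"
  using assms test_functions_integrable(1)[of k UNIV] by (auto simp: mollifier_def)

text \<open>
  A normalised bump; the centre \<open>z\<close> of its support is free for the later use near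
  the boundary.
\<close>

lemma mollifier_exists:
  fixes z :: "'a::euclidean_space"
  assumes "s > 0"
  obtains k where "mollifier (norm z + s) k" "\<And>x. x \<notin> ball z s \<Longrightarrow> k x = 0"
proof -
  have out: "bump z s x = 0" if "x \<notin> ball z s" for x
    using bump_pos_iff[OF assms, of z x] bump_nonneg[of z s x] that by linarith
  have t: "bump z s \<in> test_functions UNIV"
    by (rule test_functionsI[OF smooth_bump, of "cball z s"]) (simp_all add: out)
  define I where "I = (\<integral>x. bump z s x \<partial>lborel)"
  \<comment> \<open>Otherwise the bump would vanish almost everywhere, hence on the ball where
    it is positive.\<close>
  have "I \<noteq> 0"
  proof
    assume "I = 0"
    then have "AE x in lborel. bump z s x = 0"
      using integral_nonneg_eq_0_iff_AE[OF test_functions_integrable(1)[OF t]] bump_nonneg[of z s] by (simp add: I_def)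
    then have "AE x in lborel. x \<notin> ball z s"
      by (rule AE_mp) (use bump_pos_iff[OF assms, of z] in \<open>auto intro!: AE_I2 simp: less_le\<close>)
    then have "AE x in lebesgue. x \<in> - ball z s"
      using AE_completion by fastforce
    then have "z \<in> - ball z s"
      by (intro mem_closed_if_AE_lebesgue) auto
    then show False using assms by simp
  qed
  moreover have "0 \<le> I" unfolding I_def by (intro integral_nonneg_AE) (simp add: bump_nonneg)
  ultimately have I: "I > 0" by simp
  define k where "k = (\<lambda>x. (1 / I) * bump z s x)"
  have "k \<in> test_functions UNIV"
    unfolding k_def by (rule test_functions_mult[OF smooth_const t])
  moreover have "(\<integral>x. k x \<partial>lborel) = 1"
    using I by (simp add: k_def I_def)
  moreover have "k x = 0" if "norm z + s \<le> norm x" for x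
  proof -
    have "s \<le> dist z x" using that norm_triangle_ineq2[of x z] by (simp add: dist_norm norm_minus_commute)
    then show ?thesis using out[of x] by (simp add: k_def)
  qed
  ultimately have "mollifier (norm z + s) k"
    using I bump_nonneg[of z s] by (simp add: mollifier_def k_def)
  then show ?thesis by (rule that) (simp add: k_def out)
qed

text \<open>
  Minkowski's integral inequality: \<open>conv k f - f\<close> is an average of the differences
  \<open>f (x - z) - f x\<close> with weights \<open>k z\<close>, and exchanging the integrals
  leaves an average of numbers bounded by \<open>e\<close>.
\<close>

lemma conv_L1_close:
  fixes f :: "'a::euclidean_space \<Rightarrow> 'b::euclidean_space"
  assumes k: "mollifier \<delta> k" and f: "integrable lborel f"
    and close: "\<And>h. norm h < \<delta> \<Longrightarrow> (\<integral>x. norm (f (x + h) - f x) \<partial>lborel) \<le> e"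
  shows "integrable lborel (conv k f)" "(\<integral>x. norm (conv k f x - f x) \<partial>lborel) \<le> e"
proof -
  note kD = mollifierD[OF k]
  have [measurable]: "k \<in> borel_measurable borel" using test_functions_borel[OF kD(1)] .
  have [measurable]: "f \<in> borel_measurable borel" using f by (simp add: borel_measurable_integrable)
  have [measurable]: "conv k f \<in> borel_measurable borel"
    unfolding conv_def[abs_def] by measurable
  have "\<delta> > 0"
  proof (rule ccontr)
    assume "\<not> \<delta> > 0"
    then have "k x = 0" for x by (intro kD(4)) (use norm_ge_zero[of x] in linarith)
    then show False using kD(3) by simp
  qed
  then have e0: "e \<ge> 0" using close[of 0] by simp
  have pw: "ennreal (norm (conv k f x - f x)) \<le> (\<integral>\<^sup>+z. ennreal (k z * norm (f (x - z) - f x)) \<partial>lborel)" for x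
  proof -
    have i: "integrable lborel (\<lambda>z. k z *\<^sub>R f (x - z))" "integrable lborel (\<lambda>z. k z *\<^sub>R f x)"
      using conv_integrable(2)[OF kD(1) f] kD(5) by simp_all
    have "(\<integral>z. k z *\<^sub>R (f (x - z) - f x) \<partial>lborel) = conv k f x - f x"
      using i kD(3) integral_scaleR_left[of "f x" lborel k] kD(5)
      by (simp add: scaleR_diff_right conv_commute[OF kD(1) f])
    moreover have "integrable lborel (\<lambda>z. k z *\<^sub>R (f (x - z) - f x))"
      using i by (simp add: scaleR_diff_right)
    ultimately have "ennreal (norm (conv k f x - f x)) \<le> (\<integral>\<^sup>+z. norm (k z *\<^sub>R (f (x - z) - f x)) \<partial>lborel)"
      using integral_norm_bound_ennreal by metis
    then show ?thesis using kD(2) by simp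
  qed
  have "(\<integral>\<^sup>+x. norm (conv k f x - f x) \<partial>lborel)
      \<le> (\<integral>\<^sup>+x. (\<integral>\<^sup>+z. ennreal (k z * norm (f (x - z) - f x)) \<partial>lborel) \<partial>lborel)"
    using pw by (intro nn_integral_mono) simp
  also have "\<dots> = (\<integral>\<^sup>+z. (\<integral>\<^sup>+x. ennreal (k z * norm (f (x - z) - f x)) \<partial>lborel) \<partial>lborel)"
    by (rule lborel_pair.Fubini') measurable
  also have "\<dots> \<le> (\<integral>\<^sup>+z. ennreal (k z) * ennreal e \<partial>lborel)"
  proof (intro nn_integral_mono)
    fix z
    have i: "integrable lborel (\<lambda>x. norm (f (x - z) - f x))"
      using integral_lborel_shift(2)[OF f, of "-z"] f by simp
    have "(\<integral>\<^sup>+x. ennreal (k z * norm (f (x - z) - f x)) \<partial>lborel) = ennreal (k z) * (\<integral>\<^sup>+x. ennreal (norm (f (x - z) - f x)) \<partial>lborel)"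
      using kD(2) by (simp add: ennreal_mult' nn_integral_cmult)
    also have "\<dots> = ennreal (k z) * ennreal (\<integral>x. norm (f (x - z) - f x) \<partial>lborel)"
      using i by (simp add: nn_integral_eq_integral)
    also have "\<dots> \<le> ennreal (k z) * ennreal e"
    proof (cases "norm z < \<delta>")
      case True
      then show ?thesis using close[of "-z"] by (intro mult_left_mono ennreal_leI) auto
    next
      case False
      then show ?thesis using kD(4)[of z] by simp
    qed
    finally show "(\<integral>\<^sup>+x. ennreal (k z * norm (f (x - z) - f x)) \<partial>lborel) \<le> ennreal (k z) * ennreal e" .
  qed
  also have "\<dots> = ennreal e"
    using kD by (simp add: nn_integral_multc nn_integral_eq_integral)
  finally have *: "(\<integral>\<^sup>+x. norm (conv k f x - f x) \<partial>lborel) \<le> ennreal e" .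
  then have i: "integrable lborel (\<lambda>x. conv k f x - f x)"
    by (auto simp: integrable_iff_bounded intro: le_less_trans)
  then show "integrable lborel (conv k f)"
    using Bochner_Integration.integrable_add[OF i f] by simp
  show "(\<integral>x. norm (conv k f x - f x) \<partial>lborel) \<le> e"
    using * i e0 by (simp add: nn_integral_eq_integral)
qed

lemma conv_L1_tendsto:
  fixes f :: "'a::euclidean_space \<Rightarrow> 'b::euclidean_space"
  assumes k: "\<And>n. mollifier (\<delta> n) (k n)" and d: "\<delta> \<longlonglongrightarrow> 0" and f: "integrable lborel f"
  shows "integrable lborel (conv (k n) f)" "(\<lambda>n. \<integral>x. norm (conv (k n) f x - f x) \<partial>lborel) \<longlonglongrightarrow> 0"
proof -
  have "(\<integral>x. norm (f (x + h) - f x) \<partial>lborel) \<le> 2 * (\<integral>x. norm (f x) \<partial>lborel)" for h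
  proof -
    note i = integral_lborel_shift[OF integrable_norm[OF f], of h] integral_lborel_shift(2)[OF f, of h]
    have "(\<integral>x. norm (f (x + h) - f x) \<partial>lborel) \<le> (\<integral>x. norm (f (x + h)) + norm (f x) \<partial>lborel)"
      using i f by (intro integral_mono norm_triangle_ineq4) auto
    also have "\<dots> = 2 * (\<integral>x. norm (f x) \<partial>lborel)" using i f by simp
    finally show ?thesis .
  qed
  then show "integrable lborel (conv (k n) f)"
    using conv_L1_close(1)[OF k f] by blast
  show "(\<lambda>n. \<integral>x. norm (conv (k n) f x - f x) \<partial>lborel) \<longlonglongrightarrow> 0"
  proof (rule LIMSEQ_I)
    fix e :: real assume "e > 0"
    then have "e / 2 > 0" by simp
    then obtain d where d': "d > 0" "\<And>h. norm h < d \<Longrightarrow> (\<integral>x. norm (f (x + h) - f x) \<partial>lborel) < e / 2"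
      using integrable_imp_L1_translation_continuous[OF f] unfolding L1_translation_continuous_def by blast
    obtain N where N: "\<And>n. n \<ge> N \<Longrightarrow> \<delta> n < d"
      using order_tendstoD(2)[OF d d'(1)] by (auto simp: eventually_sequentially)
    have "norm ((\<integral>x. norm (conv (k n) f x - f x) \<partial>lborel) - 0) < e" if "n \<ge> N" for n
    proof -
      have "(\<integral>x. norm (conv (k n) f x - f x) \<partial>lborel) \<le> e / 2"
        by (rule conv_L1_close(2)[OF k f]) (use d'(2) N[OF that] in \<open>auto intro!: less_imp_le\<close>)
      moreover have "0 \<le> (\<integral>x. norm (conv (k n) f x - f x) \<partial>lborel)" by (intro integral_nonneg_AE) simp
      ultimately show ?thesis using \<open>e > 0\<close> by simp
    qed
    then show "\<exists>N. \<forall>n\<ge>N. norm ((\<integral>x. norm (conv (k n) f x - f x) \<partial>lborel) - 0) < e" by blast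
  qed
qed

definition dilate :: "real \<Rightarrow> ('a::euclidean_space \<Rightarrow> real) \<Rightarrow> 'a \<Rightarrow> real" where
  "dilate \<delta> k x = (1 / \<delta> ^ DIM('a)) * k (x /\<^sub>R \<delta>)"

lemma mollifier_dilate:
  fixes k :: "'a::euclidean_space \<Rightarrow> real"
  assumes k: "mollifier r k" and d: "\<delta> > 0"
  shows "mollifier (\<delta> * r) (dilate \<delta> k)"
    and "grad (dilate \<delta> k) x = (1 / \<delta> ^ (DIM('a) + 1)) *\<^sub>R grad k (x /\<^sub>R \<delta>)"
    and "(\<integral>x. norm (grad (dilate \<delta> k) x) \<partial>lborel) = (\<integral>x. norm (grad k x) \<partial>lborel) / \<delta>"
proof -
  note kD = mollifierD[OF k]
  have s: "smooth k" using kD(1) test_functions_smooth by blast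
  have sd: "smooth (\<lambda>x. k (x /\<^sub>R \<delta>))" using smooth_affine[OF s, of 0 "inverse \<delta>"] by simp
  obtain K where K: "compact K" "\<And>x. x \<notin> K \<Longrightarrow> k x = 0" by (rule test_functionsE[OF kD(1)]) blast
  have "dilate \<delta> k \<in> test_functions UNIV"
  proof (rule test_functionsI)
    show "smooth (dilate \<delta> k)" unfolding dilate_def[abs_def] by (rule smooth_mult[OF smooth_const sd])
    show "compact ((\<lambda>x. \<delta> *\<^sub>R x) ` K)" by (rule compact_scaling[OF K(1)])
    show "dilate \<delta> k x = 0" if "x \<notin> (\<lambda>x. \<delta> *\<^sub>R x) ` K" for x
    proof -
      have "x /\<^sub>R \<delta> \<notin> K"
      proof
        assume "x /\<^sub>R \<delta> \<in> K"
        then have "\<delta> *\<^sub>R (x /\<^sub>R \<delta>) \<in> (\<lambda>x. \<delta> *\<^sub>R x) ` K" by (rule imageI)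
        then show False using that d by simp
      qed
      then show ?thesis using K(2) by (simp add: dilate_def)
    qed
  qed simp
  moreover have "(\<integral>x. dilate \<delta> k x \<partial>lborel) = 1"
    using integral_lborel_affine[OF _ kD(5), of "inverse \<delta>" 0] kD(3) d
    by (simp add: dilate_def power_inverse divide_inverse)
  moreover have "dilate \<delta> k x = 0" if "\<delta> * r \<le> norm x" for x
    using kD(4)[of "x /\<^sub>R \<delta>"] that d by (simp add: dilate_def field_simps)
  ultimately show "mollifier (\<delta> * r) (dilate \<delta> k)"
    using d kD(2) by (auto simp: mollifier_def dilate_def)
  show g: "grad (dilate \<delta> k) x = (1 / \<delta> ^ (DIM('a) + 1)) *\<^sub>R grad k (x /\<^sub>R \<delta>)" for x
    using grad_mult[OF smooth_const sd, of "1 / \<delta> ^ DIM('a)" x] grad_affine[OF s, of 0 "inverse \<delta>" x]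
      grad_unique[OF has_derivative_const, of 0 "1 / \<delta> ^ DIM('a)" x] d
    by (simp add: dilate_def[abs_def] divide_inverse mult.commute)
  have i: "integrable lborel (\<lambda>x. norm (grad k x))"
    using test_functions_integrable(2)[OF kD(1)] by simp
  show "(\<integral>x. norm (grad (dilate \<delta> k) x) \<partial>lborel) = (\<integral>x. norm (grad k x) \<partial>lborel) / \<delta>"
    using integral_lborel_affine[OF _ i, of "inverse \<delta>" 0] d
    by (simp add: g power_inverse divide_inverse mult.assoc)
qed

section \<open>Weak gradients\<close>

subsection \<open>Functions on an open set and their Borel versions\<close>

text \<open>
  Translates integrals over \<open>\<Omega>\<close> with the completed measure into integrals of
  Borel functions over the whole space, where Fubini, translations and convolutions are
  available.
\<close>

lemma integral_lebesgue_on_open: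
  fixes f :: "'a::euclidean_space \<Rightarrow> 'b::euclidean_space"
  assumes "open \<Omega>" "F \<in> borel_measurable borel" "\<And>x. x \<notin> \<Omega> \<Longrightarrow> F x = 0"
    "AE x in lebesgue_on \<Omega>. f x = F x"
  shows "integral\<^sup>L (lebesgue_on \<Omega>) f = integral\<^sup>L lborel F"
    and "integrable (lebesgue_on \<Omega>) f \<longleftrightarrow> integrable lborel F"
    and "f \<in> borel_measurable (lebesgue_on \<Omega>)"
proof -
  have O: "\<Omega> \<in> sets lebesgue" "\<Omega> \<inter> space lebesgue \<in> sets lebesgue" using assms(1) by auto
  have F: "(\<lambda>x. indicator \<Omega> x *\<^sub>R F x) = F" using assms(3) by (auto simp: fun_eq_iff indicator_def)
  have [measurable]: "F \<in> borel_measurable lborel" using assms(2) by simp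
  have F': "F \<in> borel_measurable lebesgue" using assms(2) by (simp add: measurable_completion)
  have ae: "AE x in lebesgue. F x = indicator \<Omega> x *\<^sub>R f x"
    using assms(4) by (subst (asm) AE_restrict_space_iff[OF O(2)])
      (auto elim!: eventually_mono simp: assms(3) indicator_def)
  have f': "(\<lambda>x. indicator \<Omega> x *\<^sub>R f x) \<in> borel_measurable lebesgue"
    by (rule borel_measurable_AE[OF F' ae])
  show "integral\<^sup>L (lebesgue_on \<Omega>) f = integral\<^sup>L lborel F"
  proof -
    have "integral\<^sup>L (lebesgue_on \<Omega>) f = (\<integral>x. indicator \<Omega> x *\<^sub>R f x \<partial>lebesgue)"
      by (rule integral_restrict_space[OF O(2)])
    also have "\<dots> = integral\<^sup>L lebesgue F"
      by (rule integral_cong_AE[OF f' F']) (use ae in \<open>auto elim: eventually_mono\<close>)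
    also have "\<dots> = integral\<^sup>L lborel F" by (rule integral_completion) simp
    finally show ?thesis .
  qed
  show "integrable (lebesgue_on \<Omega>) f \<longleftrightarrow> integrable lborel F"
  proof -
    have "integrable (lebesgue_on \<Omega>) f \<longleftrightarrow> integrable lebesgue (\<lambda>x. indicator \<Omega> x *\<^sub>R f x)"
      by (rule integrable_restrict_space[OF O(2)])
    also have "\<dots> \<longleftrightarrow> integrable lebesgue F"
      by (rule integrable_cong_AE[OF f' F']) (use ae in \<open>auto elim: eventually_mono\<close>)
    also have "\<dots> \<longleftrightarrow> integrable lborel F" by (rule integrable_completion) simp
    finally show ?thesis .
  qed
  show "f \<in> borel_measurable (lebesgue_on \<Omega>)"
    using f' borel_measurable_restrict_space_iff[OF O(2), of f] by simp
qed

lemma lebesgue_measurable_borel_version: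
  fixes f :: "'a::euclidean_space \<Rightarrow> 'b::euclidean_space"
  assumes f: "f \<in> borel_measurable (lebesgue_on \<Omega>)" and O: "\<Omega> \<in> sets borel"
  obtains F where "F \<in> borel_measurable borel" "\<And>x. x \<notin> \<Omega> \<Longrightarrow> F x = 0" "AE x in lebesgue_on \<Omega>. f x = F x"
proof -
  have O': "\<Omega> \<inter> space lebesgue \<in> sets lebesgue" using O by auto
  have f': "(\<lambda>x. indicator \<Omega> x *\<^sub>R f x) \<in> borel_measurable lebesgue"
    using f borel_measurable_restrict_space_iff[OF O', of f] by simp
  have "\<exists>h\<in>borel_measurable lborel. AE x in lborel. (indicator \<Omega> x *\<^sub>R f x) \<bullet> i = (h x :: real)" for i
    by (rule completion_ex_borel_measurable_real, rule borel_measurable_inner[OF f']) simp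
  then obtain h where h: "\<And>i. h i \<in> borel_measurable lborel" "\<And>i. AE x in lborel. (indicator \<Omega> x *\<^sub>R f x) \<bullet> i = (h i x :: real)"
    by metis
  define F where "F x = indicator \<Omega> x *\<^sub>R (\<Sum>i\<in>Basis. h i x *\<^sub>R i)" for x
  show ?thesis
  proof (rule that[of F])
    have [measurable]: "h i \<in> borel_measurable borel" for i using h(1)[of i] by simp
    show "F \<in> borel_measurable borel" unfolding F_def[abs_def] using O by measurable
    show "F x = 0" if "x \<notin> \<Omega>" for x using that by (simp add: F_def)
    have "AE x in lborel. \<forall>i\<in>Basis. (indicator \<Omega> x *\<^sub>R f x) \<bullet> i = h i x"
      by (rule AE_finite_allI) (use h(2) in auto)
    then have "AE x in lebesgue. \<forall>i\<in>Basis. (indicator \<Omega> x *\<^sub>R f x) \<bullet> i = h i x"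
      by (rule AE_completion)
    then have "AE x in lebesgue. x \<in> \<Omega> \<longrightarrow> f x = F x"
    proof (rule eventually_mono)
      fix x assume *: "\<forall>i\<in>Basis. (indicator \<Omega> x *\<^sub>R f x) \<bullet> i = h i x"
      show "x \<in> \<Omega> \<longrightarrow> f x = F x"
      proof
        assume "x \<in> \<Omega>"
        with * have "(\<Sum>i\<in>Basis. h i x *\<^sub>R i) = (\<Sum>i\<in>Basis. (f x \<bullet> i) *\<^sub>R i)"
          by (intro sum.cong) auto
        with \<open>x \<in> \<Omega>\<close> show "f x = F x" by (simp add: F_def euclidean_representation)
      qed
    qed
    then show "AE x in lebesgue_on \<Omega>. f x = F x"
      by (subst AE_restrict_space_iff[OF O'])
  qed
qed

text \<open>
  An open set is a countable union of compact sets, on each of which the function is measurable.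
\<close>

lemma locally_integrable_measurable:
  fixes f :: "'a::euclidean_space \<Rightarrow> 'b::euclidean_space"
  assumes "open \<Omega>" "locally_integrable \<Omega> f"
  shows "f \<in> borel_measurable (lebesgue_on \<Omega>)"
proof -
  obtain C :: "nat \<Rightarrow> 'a set" where C: "\<And>n. compact (C n)" "\<And>n. C n \<subseteq> \<Omega>" "(\<Union>n. C n) = \<Omega>"
    using open_Union_compact_subsets[OF assms(1)] by metis
  have O: "\<Omega> \<inter> space lebesgue \<in> sets lebesgue" using assms(1) by auto
  have "(\<lambda>x. indicator \<Omega> x *\<^sub>R f x) \<in> borel_measurable lebesgue"
  proof (rule measurable_piecewise_restrict[of "insert (- \<Omega>) (range C)"])
    show "countable (insert (- \<Omega>) (range C))" by simp
    show "A \<inter> space lebesgue \<in> sets lebesgue" if "A \<in> insert (- \<Omega>) (range C)" for A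
      using that C(1) assms(1) by (auto intro: fmeasurableD lmeasurable_compact)
    show "space lebesgue \<subseteq> \<Union> (insert (- \<Omega>) (range C))" using C(3) by auto
    fix A assume A: "A \<in> insert (- \<Omega>) (range C)"
    show "(\<lambda>x. indicator \<Omega> x *\<^sub>R f x) \<in> lebesgue_on A \<rightarrow>\<^sub>M borel"
    proof (cases "A = - \<Omega>")
      case True
      have "(\<lambda>x. 0) \<in> lebesgue_on A \<rightarrow>\<^sub>M borel" by simp
      then show ?thesis
        by (subst measurable_cong[where g="\<lambda>x. 0"]) (auto simp: True space_restrict_space)
    next
      case False
      then obtain n where n: "A = C n" using A by auto
      have "f \<in> lebesgue_on A \<rightarrow>\<^sub>M borel"
        using assms(2) C(1,2) unfolding locally_integrable_def n by (blast intro: borel_measurable_integrable)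
      then show ?thesis
        by (subst measurable_cong[where g=f]) (use C(2)[of n] in \<open>auto simp: n space_restrict_space\<close>)
    qed
  qed
  then show ?thesis using borel_measurable_restrict_space_iff[OF O, of f] by simp
qed

lemma integrable_imp_locally_integrable:
  fixes f :: "'a::euclidean_space \<Rightarrow> 'b::euclidean_space"
  assumes "open \<Omega>" "integrable (lebesgue_on \<Omega>) f"
  shows "locally_integrable \<Omega> f"
  unfolding locally_integrable_def
proof (intro allI impI)
  fix K assume K: "compact K \<and> K \<subseteq> \<Omega>"
  have O: "\<Omega> \<inter> space lebesgue \<in> sets lebesgue" using assms(1) by auto
  have K': "K \<inter> space lebesgue \<in> sets lebesgue" "K \<in> sets lebesgue" using K by (auto intro: fmeasurableD lmeasurable_compact)
  have "integrable lebesgue (\<lambda>x. indicator \<Omega> x *\<^sub>R f x)"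
    using assms(2) integrable_restrict_space[OF O] by blast
  then have "integrable lebesgue (\<lambda>x. indicator K x *\<^sub>R (indicator \<Omega> x *\<^sub>R f x))"
    by (rule integrable_mult_indicator[OF K'(2)])
  also have "(\<lambda>x. indicator K x *\<^sub>R (indicator \<Omega> x *\<^sub>R f x)) = (\<lambda>x. indicator K x *\<^sub>R f x)"
    using K by (auto simp: fun_eq_iff indicator_def)
  finally show "integrable (lebesgue_on K) f"
    using integrable_restrict_space[OF K'(1)] by blast
qed

lemma locally_integrable_mult_compact:
  fixes f \<phi> :: "'a::euclidean_space \<Rightarrow> real"
  assumes "open \<Omega>" "locally_integrable \<Omega> f" "continuous_on UNIV \<phi>" "compact K" "K \<subseteq> \<Omega>" "\<And>x. x \<notin> K \<Longrightarrow> \<phi> x = 0"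
  shows "integrable (lebesgue_on \<Omega>) (\<lambda>x. f x * \<phi> x)"
proof -
  have O: "\<Omega> \<inter> space lebesgue \<in> sets lebesgue" using assms(1) by auto
  have K': "K \<inter> space lebesgue \<in> sets lebesgue" using assms(4) by (auto intro: fmeasurableD lmeasurable_compact)
  obtain B where B: "\<And>x. norm (\<phi> x) \<le> B" using compact_support_bounded[OF assms(3,4,6)] by blast
  have i: "integrable lebesgue (\<lambda>x. indicator K x *\<^sub>R f x)"
    using assms(2,4,5) integrable_restrict_space[OF K'] unfolding locally_integrable_def by blast
  have "\<phi> \<in> borel_measurable lebesgue"
    using assms(3) by (intro measurable_completion) (simp add: borel_measurable_continuous_onI)
  then have "integrable lebesgue (\<lambda>x. \<phi> x *\<^sub>R (indicator K x *\<^sub>R f x))"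
    using integrable_bounded_scaleR[OF i, of \<phi> B] B by simp
  also have "(\<lambda>x. \<phi> x *\<^sub>R (indicator K x *\<^sub>R f x)) = (\<lambda>x. indicator \<Omega> x *\<^sub>R (f x * \<phi> x))"
    using assms(5,6) by (auto simp: fun_eq_iff indicator_def)
  finally show ?thesis using integrable_restrict_space[OF O] by blast
qed

subsection \<open>Uniqueness\<close>

text \<open>
  The translated kernels \<open>y \<mapsto> k (x - y)\<close> are test functions, so
  mollifications of \<open>g\<close> vanish wherever the kernel fits into
  \<open>\<Omega>\<close>; they also converge to \<open>g\<close> in \<open>L^1\<close>. This is
  carried out on balls, on which \<open>g\<close> is integrable.
\<close>

lemma fundamental_lemma:
  fixes g :: "'a::euclidean_space \<Rightarrow> real"
  assumes O: "open \<Omega>" and g: "locally_integrable \<Omega> g"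
    and zero: "\<And>\<phi>. \<phi> \<in> test_functions \<Omega> \<Longrightarrow> (\<integral>x. g x * \<phi> x \<partial>lebesgue_on \<Omega>) = 0"
  shows "AE x in lebesgue_on \<Omega>. g x = 0"
proof -
  have O': "\<Omega> \<inter> space lebesgue \<in> sets lebesgue" using O by auto
  have neg: "negligible {x \<in> ball p r. g x \<noteq> 0}" if "cball p (2 * r) \<subseteq> \<Omega>" "r > 0" for p r
  proof -
    let ?S = "cball p (2 * r)"
    have S: "?S \<inter> space lebesgue \<in> sets lebesgue" by auto
    have i: "integrable (lebesgue_on ?S) g"
      using g that(1) unfolding locally_integrable_def by auto
    \<comment> \<open>A Borel function on the whole space that agrees with \<open>g\<close> on
      the double ball and vanishes off it; its mollifications are compared with the hypothesis at
      points of the smaller ball.\<close>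
    obtain f where f: "f \<in> borel_measurable borel" "\<And>x. x \<notin> ?S \<Longrightarrow> f x = 0" "AE x in lebesgue_on ?S. g x = f x"
      by (rule lebesgue_measurable_borel_version[OF borel_measurable_integrable[OF i]]) auto
    have ae: "AE x in lebesgue. x \<in> ?S \<longrightarrow> g x = f x"
      using f(3) by (simp add: AE_restrict_space_iff[OF S])
    have "integrable lebesgue (\<lambda>x. indicator ?S x *\<^sub>R g x)"
      using i integrable_restrict_space[OF S] by blast
    then have "integrable lebesgue f"
    proof (rule integrable_cong_AE_imp)
      show "f \<in> borel_measurable lebesgue" using f(1) by (simp add: measurable_completion)
      show "AE x in lebesgue. indicator ?S x *\<^sub>R g x = f x"
        using ae by (rule eventually_mono) (auto simp: indicator_def f(2))
    qed
    then have fi: "integrable lborel f" using f(1) by (simp add: integrable_completion)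
    define d where "d n = r / real (Suc n)" for n
    have d: "0 < d n" "d n \<le> r" for n
      using that(2) by (auto simp: d_def divide_le_eq mult_le_cancel_left1)
    have d0: "d \<longlonglongrightarrow> 0"
      using tendsto_mult_right_zero[OF LIMSEQ_inverse_real_of_nat, of r] by (simp add: d_def[abs_def] divide_inverse)
    have "\<exists>k. mollifier (d n) k" for n
      by (rule mollifier_exists[of "d n" 0]) (use d in auto)
    then obtain k where k: "\<And>n. mollifier (d n) (k n :: 'a \<Rightarrow> real)" by metis
    have conv0: "conv (k n) f x = 0" if x: "x \<in> ball p r" for x n
    proof -
      note kD = mollifierD[OF k[of n]]
      let ?\<phi> = "\<lambda>y. k n (x - y)"
      have in_S: "cball x (d n) \<subseteq> ?S"
      proof
        fix y assume "y \<in> cball x (d n)"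
        then show "y \<in> ?S" using x d(2)[of n] dist_triangle[of p y x] by simp
      qed
      have supp: "?\<phi> y = 0" if "y \<notin> cball x (d n)" for y
        using that by (intro kD(4)) (simp add: dist_norm)
      have sm: "smooth ?\<phi>" using smooth_affine[OF test_functions_smooth[OF kD(1)], of x "-1"] by simp
      have t: "?\<phi> \<in> test_functions \<Omega>"
        by (rule test_functionsI[OF sm compact_cball[of x "d n"] subset_trans[OF in_S \<open>?S \<subseteq> \<Omega>\<close>] supp])
      have [measurable]: "k n \<in> borel_measurable borel" "f \<in> borel_measurable borel"
        using test_functions_borel[OF kD(1)] f(1) by auto
      have "(\<integral>y. g y * ?\<phi> y \<partial>lebesgue_on \<Omega>) = (\<integral>y. k n (x - y) *\<^sub>R f y \<partial>lborel)"
      proof (rule integral_lebesgue_on_open(1)[OF O])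
        show "k n (x - y) *\<^sub>R f y = 0" if "y \<notin> \<Omega>" for y
        proof -
          have "y \<notin> ?S" using that \<open>?S \<subseteq> \<Omega>\<close> by blast
          then show ?thesis using f(2) by simp
        qed
        have "AE y in lebesgue. y \<in> \<Omega> \<longrightarrow> g y * ?\<phi> y = k n (x - y) *\<^sub>R f y"
          using ae
        proof (rule eventually_mono)
          fix y assume "y \<in> ?S \<longrightarrow> g y = f y"
          then show "y \<in> \<Omega> \<longrightarrow> g y * ?\<phi> y = k n (x - y) *\<^sub>R f y"
          proof (cases "y \<in> ?S")
            case False
            then have "y \<notin> cball x (d n)" using in_S by blast
            then show ?thesis using supp by simp
          qed simp
        qed
        then show "AE y in lebesgue_on \<Omega>. g y * ?\<phi> y = k n (x - y) *\<^sub>R f y"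
          by (simp add: AE_restrict_space_iff[OF O'])
      qed simp
      then show ?thesis using zero[OF t] by (simp add: conv_def)
    qed
    have "(\<integral>x. indicator (ball p r) x * \<bar>f x\<bar> \<partial>lborel) \<le> (\<integral>x. norm (conv (k n) f x - f x) \<partial>lborel)" for n
    proof (rule integral_mono)
      show "integrable lborel (\<lambda>x. indicator (ball p r) x * \<bar>f x\<bar>)"
        using integrable_mult_indicator[OF _ integrable_abs[OF fi], of "ball p r"] by simp
      show "integrable lborel (\<lambda>x. norm (conv (k n) f x - f x))"
        using conv_L1_tendsto(1)[OF k d0 fi, of n] fi by simp
      show "indicator (ball p r) x * \<bar>f x\<bar> \<le> norm (conv (k n) f x - f x)" for x
        by (cases "x \<in> ball p r") (simp_all add: conv0)
    qed
    then have "(\<integral>x. indicator (ball p r) x * \<bar>f x\<bar> \<partial>lborel) \<le> 0"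
      by (intro LIMSEQ_le_const[OF conv_L1_tendsto(2)[OF k d0 fi]]) auto
    moreover have nn: "integrable lborel (\<lambda>x. indicator (ball p r) x * \<bar>f x\<bar>)"
      using integrable_mult_indicator[OF _ integrable_abs[OF fi], of "ball p r"] by simp
    ultimately have "AE x in lborel. indicator (ball p r) x * \<bar>f x\<bar> = 0"
      by (subst integral_nonneg_eq_0_iff_AE[OF nn, symmetric]) (auto intro!: antisym integral_nonneg_AE)
    then have "AE x in lebesgue. indicator (ball p r) x * \<bar>f x\<bar> = 0" by (rule AE_completion)
    with ae have "AE x in lebesgue. x \<notin> {x \<in> ball p r. g x \<noteq> 0}"
    proof eventually_elim
      case (elim x)
      have "x \<in> ball p r \<Longrightarrow> x \<in> ?S" using that(2) by auto
      then show ?case using elim by (auto simp: indicator_def split: if_splits)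
    qed
    then show ?thesis
      by (simp add: negligible_iff_null_sets completion.AE_iff_null_sets)
  qed
  have "negligible {x \<in> \<Omega>. g x \<noteq> 0}"
  proof (rule locally_negligible_alt[THEN iffD2], rule ballI)
    fix p assume p: "p \<in> {x \<in> \<Omega>. g x \<noteq> 0}"
    then obtain e where e: "e > 0" "cball p e \<subseteq> \<Omega>" using O unfolding open_contains_cball by blast
    show "\<exists>U. openin (top_of_set {x \<in> \<Omega>. g x \<noteq> 0}) U \<and> p \<in> U \<and> negligible U"
    proof (intro exI conjI)
      show "openin (top_of_set {x \<in> \<Omega>. g x \<noteq> 0}) ({x \<in> \<Omega>. g x \<noteq> 0} \<inter> ball p (e / 2))"
        by (simp add: openin_open_Int)
      show "p \<in> {x \<in> \<Omega>. g x \<noteq> 0} \<inter> ball p (e / 2)" using p e(1) by simp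
      show "negligible ({x \<in> \<Omega>. g x \<noteq> 0} \<inter> ball p (e / 2))"
        by (rule negligible_subset[OF neg[of p "e / 2"]]) (use e in auto)
    qed
  qed
  moreover have "{x. x \<in> \<Omega> \<and> g x \<noteq> 0} = {x \<in> \<Omega>. g x \<noteq> 0}" by blast
  ultimately show ?thesis
    by (simp add: AE_restrict_space_iff[OF O'] completion.AE_iff_null_sets negligible_iff_null_sets)
qed

lemma locally_integrable_inner: "locally_integrable \<Omega> g \<Longrightarrow> locally_integrable \<Omega> (\<lambda>x. g x \<bullet> i)"
  unfolding locally_integrable_def by (intro allI impI integrable_inner_left) blast

lemma locally_integrable_add:
  "locally_integrable \<Omega> f \<Longrightarrow> locally_integrable \<Omega> g \<Longrightarrow> locally_integrable \<Omega> (\<lambda>x. f x + g x)"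
  unfolding locally_integrable_def by (intro allI impI Bochner_Integration.integrable_add) blast+

lemma locally_integrable_diff:
  "locally_integrable \<Omega> f \<Longrightarrow> locally_integrable \<Omega> g \<Longrightarrow> locally_integrable \<Omega> (\<lambda>x. f x - g x)"
  unfolding locally_integrable_def by (intro allI impI Bochner_Integration.integrable_diff) blast+

text \<open>
  Because of this, the choice made in \<open>weak_gradient\<close> affects neither energies nor
  modulars.
\<close>

lemma has_weak_gradient_unique:
  assumes O: "open \<Omega>" and g: "has_weak_gradient \<Omega> u g" "has_weak_gradient \<Omega> u g'"
  shows "AE x in lebesgue_on \<Omega>. g x = g' x"
proof -
  have l: "locally_integrable \<Omega> g" "locally_integrable \<Omega> g'"
    using g unfolding has_weak_gradient_def by blast+
  have li: "locally_integrable \<Omega> (\<lambda>x. g x \<bullet> i)" "locally_integrable \<Omega> (\<lambda>x. g' x \<bullet> i)" for i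
    by (rule locally_integrable_inner, rule l)+
  have "AE x in lebesgue_on \<Omega>. g x \<bullet> i - g' x \<bullet> i = 0" if i: "i \<in> Basis" for i
  proof (rule fundamental_lemma[OF O])
    show "locally_integrable \<Omega> (\<lambda>x. g x \<bullet> i - g' x \<bullet> i)"
      by (rule locally_integrable_diff) (rule li)+
    fix \<phi> assume t: "\<phi> \<in> test_functions \<Omega>"
    obtain K where K: "compact K" "K \<subseteq> \<Omega>" "\<And>x. x \<notin> K \<Longrightarrow> \<phi> x = 0" by (rule test_functionsE[OF t]) blast
    note int = locally_integrable_mult_compact[OF O _ test_functions_continuous[OF t] K]
    have "(\<integral>x. (g x \<bullet> i) * \<phi> x \<partial>lebesgue_on \<Omega>) = (\<integral>x. (g' x \<bullet> i) * \<phi> x \<partial>lebesgue_on \<Omega>)"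
    proof -
      have "(\<integral>x. u x * partial_derivative i \<phi> x \<partial>lebesgue_on \<Omega>) = - (\<integral>x. (g x \<bullet> i) * \<phi> x \<partial>lebesgue_on \<Omega>)"
        "(\<integral>x. u x * partial_derivative i \<phi> x \<partial>lebesgue_on \<Omega>) = - (\<integral>x. (g' x \<bullet> i) * \<phi> x \<partial>lebesgue_on \<Omega>)"
        using g t i unfolding has_weak_gradient_def by blast+
      then show ?thesis by linarith
    qed
    then show "(\<integral>x. (g x \<bullet> i - g' x \<bullet> i) * \<phi> x \<partial>lebesgue_on \<Omega>) = 0"
      using int[OF li(1)[of i]] int[OF li(2)[of i]] by (simp add: left_diff_distrib)
  qed
  then have "AE x in lebesgue_on \<Omega>. \<forall>i\<in>Basis. g x \<bullet> i - g' x \<bullet> i = 0"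
    by (intro AE_finite_allI) auto
  then show ?thesis
    by (rule eventually_mono) (auto intro: euclidean_eqI)
qed

lemma has_weak_gradient_weak_gradient:
  "has_weak_gradient \<Omega> u g \<Longrightarrow> has_weak_gradient \<Omega> u (weak_gradient \<Omega> u)"
  unfolding weak_gradient_def by (rule someI[of "has_weak_gradient \<Omega> u"])

lemma weak_gradient_AE:
  assumes "open \<Omega>" "has_weak_gradient \<Omega> u g"
  shows "AE x in lebesgue_on \<Omega>. weak_gradient \<Omega> u x = g x"
  by (rule has_weak_gradient_unique[OF assms(1) has_weak_gradient_weak_gradient[OF assms(2)] assms(2)])

lemma integrable_lborel_imp_lebesgue_on:
  fixes f :: "'a::euclidean_space \<Rightarrow> 'b::euclidean_space"
  assumes "open \<Omega>" "integrable lborel f"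
  shows "integrable (lebesgue_on \<Omega>) f"
proof -
  have "\<Omega> \<in> sets borel" using assms(1) by simp
  then have i: "integrable lborel (\<lambda>x. indicator \<Omega> x *\<^sub>R f x)"
    using integrable_mult_indicator[OF _ assms(2), of \<Omega>] by simp
  show ?thesis
    by (subst integral_lebesgue_on_open(2)[OF assms(1), of "\<lambda>x. indicator \<Omega> x *\<^sub>R f x"])
      (use i in \<open>auto intro!: AE_I2 simp: borel_measurable_integrable space_restrict_space dest: borel_measurable_integrable\<close>)
qed

lemma has_weak_gradient_test:
  assumes O: "open \<Omega>" and t: "\<phi> \<in> test_functions UNIV"
  shows "has_weak_gradient \<Omega> \<phi> (grad \<phi>)"
  unfolding has_weak_gradient_def
proof (intro conjI ballI)
  show "locally_integrable \<Omega> \<phi>" "locally_integrable \<Omega> (grad \<phi>)"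
    using test_functions_integrable[OF t]
    by (auto intro!: integrable_imp_locally_integrable integrable_lborel_imp_lebesgue_on O)
  fix \<psi> and i :: 'a assume p: "\<psi> \<in> test_functions \<Omega>" and i: "i \<in> Basis"
  obtain K where K: "K \<subseteq> \<Omega>" "\<And>x. x \<notin> K \<Longrightarrow> \<psi> x = 0" "\<And>x. x \<notin> K \<Longrightarrow> grad \<psi> x = 0"
    by (rule test_functionsE[OF p]) blast
  have [measurable]: "\<phi> \<in> borel_measurable borel" "grad \<phi> \<in> borel_measurable borel"
    "\<psi> \<in> borel_measurable borel" "partial_derivative i \<psi> \<in> borel_measurable borel"
    using test_functions_borel[OF t] test_functions_borel_grad[OF t] test_functions_borel[OF p]
      test_functions_borel[OF test_functions_partial_derivative[OF p i]] by simp_all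
  have d0: "partial_derivative i \<psi> x = 0" if "x \<notin> \<Omega>" for x
  proof -
    have "x \<notin> K" using K(1) that by blast
    then show ?thesis using K(3)[of x] grad_inner_Basis[OF i, of \<psi> x] by simp
  qed
  have "(\<integral>x. \<phi> x * partial_derivative i \<psi> x \<partial>lebesgue_on \<Omega>) = (\<integral>x. \<phi> x * partial_derivative i \<psi> x \<partial>lborel)"
    by (rule integral_lebesgue_on_open(1)[OF O]) (simp_all add: d0)
  also have "\<dots> = - (\<integral>x. partial_derivative i \<phi> x * \<psi> x \<partial>lborel)"
    by (rule integration_by_parts[OF t test_functions_smooth[OF p] i])
  also have "(\<integral>x. partial_derivative i \<phi> x * \<psi> x \<partial>lborel) = (\<integral>x. (grad \<phi> x \<bullet> i) * \<psi> x \<partial>lborel)"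
    using i by simp
  also have "\<dots> = (\<integral>x. (grad \<phi> x \<bullet> i) * \<psi> x \<partial>lebesgue_on \<Omega>)"
    by (rule integral_lebesgue_on_open(1)[OF O, symmetric]) (use K(1,2) in auto)
  finally show "(\<integral>x. \<phi> x * partial_derivative i \<psi> x \<partial>lebesgue_on \<Omega>) = - (\<integral>x. (grad \<phi> x \<bullet> i) * \<psi> x \<partial>lebesgue_on \<Omega>)" .
qed

lemma has_weak_gradient_add:
  assumes O: "open \<Omega>" and u: "has_weak_gradient \<Omega> u g" and v: "has_weak_gradient \<Omega> v h"
  shows "has_weak_gradient \<Omega> (\<lambda>x. u x + v x) (\<lambda>x. g x + h x)"
proof -
  have l: "locally_integrable \<Omega> u" "locally_integrable \<Omega> v" "locally_integrable \<Omega> g" "locally_integrable \<Omega> h"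
    using u v unfolding has_weak_gradient_def by blast+
  have l': "locally_integrable \<Omega> (\<lambda>x. g x \<bullet> i)" "locally_integrable \<Omega> (\<lambda>x. h x \<bullet> i)" for i
    by (rule locally_integrable_inner, rule l)+
  show ?thesis
    unfolding has_weak_gradient_def
  proof (intro conjI ballI)
    show "locally_integrable \<Omega> (\<lambda>x. u x + v x)" "locally_integrable \<Omega> (\<lambda>x. g x + h x)"
      by (rule locally_integrable_add, rule l, rule l)+
    fix \<phi> and i :: 'a assume t: "\<phi> \<in> test_functions \<Omega>" and i: "i \<in> Basis"
    note t' = test_functions_partial_derivative[OF t i]
    obtain K where K: "compact K" "K \<subseteq> \<Omega>" "\<And>x. x \<notin> K \<Longrightarrow> \<phi> x = 0" by (rule test_functionsE[OF t]) blast
    obtain K' where K': "compact K'" "K' \<subseteq> \<Omega>" "\<And>x. x \<notin> K' \<Longrightarrow> partial_derivative i \<phi> x = 0" by (rule test_functionsE[OF t']) blast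
    note int = locally_integrable_mult_compact[OF O _ test_functions_continuous[OF t] K]
    note int' = locally_integrable_mult_compact[OF O _ test_functions_continuous[OF t'] K']
    have e: "(\<integral>x. u x * partial_derivative i \<phi> x \<partial>lebesgue_on \<Omega>) = - (\<integral>x. (g x \<bullet> i) * \<phi> x \<partial>lebesgue_on \<Omega>)"
      "(\<integral>x. v x * partial_derivative i \<phi> x \<partial>lebesgue_on \<Omega>) = - (\<integral>x. (h x \<bullet> i) * \<phi> x \<partial>lebesgue_on \<Omega>)"
      using u v t i unfolding has_weak_gradient_def by blast+
    show "(\<integral>x. (u x + v x) * partial_derivative i \<phi> x \<partial>lebesgue_on \<Omega>) = - (\<integral>x. ((g x + h x) \<bullet> i) * \<phi> x \<partial>lebesgue_on \<Omega>)"
      using int'[OF l(1)] int'[OF l(2)] int[OF l'(1)[of i]] int[OF l'(2)[of i]] e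
      by (simp add: distrib_right inner_add_left)
  qed
qed

lemma grad_uminus_test: "\<phi> \<in> test_functions \<Omega> \<Longrightarrow> grad (\<lambda>x. - \<phi> x) x = - grad \<phi> x"
  by (rule grad_unique[OF has_derivative_minus[OF has_derivative_grad]])
    (simp_all add: smooth_differentiable test_functions_smooth)

lemma has_weak_gradient_diff_test:
  assumes O: "open \<Omega>" and u: "has_weak_gradient \<Omega> u g" and t: "\<phi> \<in> test_functions UNIV"
  shows "has_weak_gradient \<Omega> (\<lambda>x. u x - \<phi> x) (\<lambda>x. g x - grad \<phi> x)"
proof -
  have "(\<lambda>x. - \<phi> x) \<in> test_functions UNIV"
    using test_functions_mult[OF smooth_const[of "-1"] t] by simp
  from has_weak_gradient_add[OF O u has_weak_gradient_test[OF O this]]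
  show ?thesis by (simp add: grad_uminus_test[OF t])
qed

lemma test_functions_W11:
  assumes O: "open \<Omega>" and t: "\<phi> \<in> test_functions UNIV"
  shows "\<phi> \<in> W11 \<Omega>"
  unfolding W11_def using has_weak_gradient_test[OF assms] test_functions_integrable[OF t]
  by (auto intro!: integrable_lborel_imp_lebesgue_on[OF O])

lemma test_functions_W11_0:
  assumes O: "open \<Omega>" and t: "\<phi> \<in> test_functions \<Omega>"
  shows "\<phi> \<in> W11_0 \<Omega>"
proof -
  have t': "\<phi> \<in> test_functions UNIV" using t test_functions_mono by blast
  have "has_weak_gradient \<Omega> (\<lambda>x. 0) (\<lambda>x. 0)"
    by (simp add: has_weak_gradient_def locally_integrable_def)
  then have "AE x in lebesgue_on \<Omega>. weak_gradient \<Omega> (\<lambda>x. 0) x = 0"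
    by (rule weak_gradient_AE[OF O])
  then have "AE x in lebesgue_on \<Omega>. norm (weak_gradient \<Omega> (\<lambda>x. 0) x) = 0"
    by (rule eventually_mono) simp
  then have "(\<integral>x. norm (weak_gradient \<Omega> (\<lambda>x. 0) x) \<partial>lebesgue_on \<Omega>) = 0"
    by (rule integral_eq_zero_AE)
  then have "W11_norm \<Omega> (\<lambda>x. \<phi> x - \<phi> x) = 0" by (simp add: W11_norm_def)
  then show ?thesis
    unfolding W11_0_def using t test_functions_W11[OF O t']
    by (auto intro!: exI[of _ "\<lambda>_. \<phi>"])
qed

subsection \<open>Limits of test functions on the whole space\<close>

text \<open>
  The whole-space form of membership in \<open>W^{1,1}_0\<close>: \<open>w\<close> plays the
  extension by zero of the function and \<open>G\<close> that of its gradient. Keeping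
  \<open>G\<close> explicit avoids any choice of a weak gradient and makes sense of products and
  compositions directly.
\<close>

definition test_limit :: "('a::euclidean_space \<Rightarrow> real) \<Rightarrow> ('a \<Rightarrow> 'a) \<Rightarrow> bool" where
  "test_limit w G \<longleftrightarrow> integrable lborel w \<and> integrable lborel G \<and>
     (\<exists>f. (\<forall>k::nat. f k \<in> test_functions UNIV) \<and> (\<lambda>k. \<integral>x. \<bar>w x - f k x\<bar> \<partial>lborel) \<longlonglongrightarrow> 0 \<and>
          (\<lambda>k. \<integral>x. norm (G x - grad (f k) x) \<partial>lborel) \<longlonglongrightarrow> 0)"

text \<open>
  Extension by zero. A test function of \<open>\<Omega>\<close> is one of the whole space, and
  the two \<open>L^1\<close> distances in the \<open>W^{1,1}\<close> norm are unchanged by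
  extension.
\<close>

lemma W11_0_extension:
  assumes O: "open \<Omega>" and v: "v \<in> W11_0 \<Omega>"
    and w: "w \<in> borel_measurable borel" "\<And>x. x \<notin> \<Omega> \<Longrightarrow> w x = 0" "AE x in lebesgue_on \<Omega>. v x = w x"
    and G: "G \<in> borel_measurable borel" "\<And>x. x \<notin> \<Omega> \<Longrightarrow> G x = 0" "AE x in lebesgue_on \<Omega>. weak_gradient \<Omega> v x = G x"
  shows "test_limit w G"
proof -
  obtain f where f: "\<And>k. f k \<in> test_functions \<Omega>" "(\<lambda>k. W11_norm \<Omega> (\<lambda>x. v x - f k x)) \<longlonglongrightarrow> 0"
    and vW: "v \<in> W11 \<Omega>"
    using v unfolding W11_0_def by blast
  have fU: "f k \<in> test_functions UNIV" for k using f(1) test_functions_mono by blast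
  obtain g where g: "has_weak_gradient \<Omega> v g" "integrable (lebesgue_on \<Omega>) g" and vi: "integrable (lebesgue_on \<Omega>) v"
    using vW unfolding W11_def by blast
  have wi: "integrable lborel w"
    using integral_lebesgue_on_open(2)[OF O w] vi by blast
  have "AE x in lebesgue_on \<Omega>. g x = G x"
    using weak_gradient_AE[OF O g(1)] G(3) by eventually_elim simp
  then have Gi: "integrable lborel G"
    using integral_lebesgue_on_open(2)[OF O G(1,2)] g(2) by blast
  have z: "f k x = 0" "grad (f k) x = 0" if "x \<notin> \<Omega>" for k x
  proof -
    obtain K where K: "K \<subseteq> \<Omega>" "\<And>x. x \<notin> K \<Longrightarrow> f k x = 0" "\<And>x. x \<notin> K \<Longrightarrow> grad (f k) x = 0"
      by (rule test_functionsE[OF f(1)[of k]]) blast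
    have "x \<notin> K" using K(1) that by blast
    then show "f k x = 0" "grad (f k) x = 0" using K(2,3) by simp_all
  qed
  have bm [measurable]: "f k \<in> borel_measurable borel" "grad (f k) \<in> borel_measurable borel" for k
    using test_functions_borel[OF fU] test_functions_borel_grad[OF fU] by auto
  have [measurable]: "w \<in> borel_measurable borel" "G \<in> borel_measurable borel" using w(1) G(1) by auto
  have 1: "(\<integral>x. \<bar>v x - f k x\<bar> \<partial>lebesgue_on \<Omega>) = (\<integral>x. \<bar>w x - f k x\<bar> \<partial>lborel)" for k
    by (rule integral_lebesgue_on_open(1)[OF O]) (use w(2,3) in \<open>auto simp: z elim: eventually_mono\<close>)
  have 2: "(\<integral>x. norm (weak_gradient \<Omega> (\<lambda>x. v x - f k x) x) \<partial>lebesgue_on \<Omega>) = (\<integral>x. norm (G x - grad (f k) x) \<partial>lborel)" for k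
  proof (rule integral_lebesgue_on_open(1)[OF O])
    show "AE x in lebesgue_on \<Omega>. norm (weak_gradient \<Omega> (\<lambda>x. v x - f k x) x) = norm (G x - grad (f k) x)"
      using weak_gradient_AE[OF O has_weak_gradient_diff_test[OF O has_weak_gradient_weak_gradient[OF g(1)] fU[of k]]] G(3)
      by eventually_elim simp
  qed (use G(2) in \<open>simp_all add: z\<close>)
  have nn: "0 \<le> (\<integral>x. \<bar>w x - f k x\<bar> \<partial>lborel)" "0 \<le> (\<integral>x. norm (G x - grad (f k) x) \<partial>lborel)" for k
    by (intro integral_nonneg_AE; simp)+
  have lim: "(\<lambda>k. (\<integral>x. \<bar>w x - f k x\<bar> \<partial>lborel) + (\<integral>x. norm (G x - grad (f k) x) \<partial>lborel)) \<longlonglongrightarrow> 0"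
    using f(2) by (simp add: W11_norm_def 1 2)
  have "(\<lambda>k. \<integral>x. \<bar>w x - f k x\<bar> \<partial>lborel) \<longlonglongrightarrow> 0"
    by (rule tendsto_sandwich[OF _ _ tendsto_const lim]) (use nn in auto)
  moreover have "(\<lambda>k. \<integral>x. norm (G x - grad (f k) x) \<partial>lborel) \<longlonglongrightarrow> 0"
    by (rule tendsto_sandwich[OF _ _ tendsto_const lim]) (use nn in auto)
  ultimately show ?thesis
    unfolding test_limit_def using wi Gi fU by blast
qed

text \<open>
  Product rule: multiplication by \<open>\<psi>\<close> is continuous for the
  \<open>W^{1,1}\<close> norm when \<open>\<psi>\<close> and its gradient are bounded, and it
  preserves test functions.
\<close>

lemma test_limit_mult:
  assumes W: "test_limit w G" and s: "smooth \<psi>" and b: "\<And>x. \<bar>\<psi> x\<bar> \<le> B" "\<And>x. norm (grad \<psi> x) \<le> B"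
  shows "test_limit (\<lambda>x. \<psi> x * w x) (\<lambda>x. \<psi> x *\<^sub>R G x + w x *\<^sub>R grad \<psi> x)"
proof -
  obtain f where i: "integrable lborel w" "integrable lborel G" and f: "\<And>k. f k \<in> test_functions UNIV"
    and l1: "(\<lambda>k. \<integral>x. \<bar>w x - f k x\<bar> \<partial>lborel) \<longlonglongrightarrow> 0" and l2: "(\<lambda>k. \<integral>x. norm (G x - grad (f k) x) \<partial>lborel) \<longlonglongrightarrow> 0"
    using W unfolding test_limit_def by blast
  have B0: "B \<ge> 0" using b(1)[of undefined] by linarith
  have [measurable]: "\<psi> \<in> borel_measurable borel" "grad \<psi> \<in> borel_measurable borel"
    using s by (simp_all add: borel_measurable_continuous_onI smooth_continuous continuous_grad)
  have [measurable]: "w \<in> borel_measurable borel" "G \<in> borel_measurable borel"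
    using i by (simp_all add: borel_measurable_integrable)
  note fi = test_functions_integrable[OF f]
  have m1: "integrable lborel (\<lambda>x. \<psi> x * h x)" if "integrable lborel h" for h :: "'a \<Rightarrow> real"
    using integrable_bounded_scaleR[OF that, of \<psi> B] b by simp
  have m2: "integrable lborel (\<lambda>x. \<psi> x *\<^sub>R h x)" if "integrable lborel h" for h :: "'a \<Rightarrow> 'a"
    using integrable_bounded_scaleR[OF that, of \<psi> B] b by simp
  have m3: "integrable lborel (\<lambda>x. h x *\<^sub>R grad \<psi> x)" if h: "integrable lborel h" for h :: "'a \<Rightarrow> real"
  proof (rule Bochner_Integration.integrable_bound)
    have [measurable]: "h \<in> borel_measurable borel" using h by (simp add: borel_measurable_integrable)
    show "(\<lambda>x. h x *\<^sub>R grad \<psi> x) \<in> borel_measurable lborel" by simp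
    show "integrable lborel (\<lambda>x. h x * B)" using h by simp
    show "AE x in lborel. norm (h x *\<^sub>R grad \<psi> x) \<le> norm (h x * B)"
      using b(2) B0 by (intro AE_I2) (simp add: abs_mult mult_left_mono)
  qed
  show ?thesis
    unfolding test_limit_def
  proof (intro conjI exI[of _ "\<lambda>k x. \<psi> x * f k x"] allI)
    show "integrable lborel (\<lambda>x. \<psi> x * w x)" by (rule m1[OF i(1)])
    show "integrable lborel (\<lambda>x. \<psi> x *\<^sub>R G x + w x *\<^sub>R grad \<psi> x)"
      by (intro Bochner_Integration.integrable_add m2 m3 i)
    show "(\<lambda>x. \<psi> x * f k x) \<in> test_functions UNIV" for k
      by (rule test_functions_mult[OF s f])
    have d1: "integrable lborel (\<lambda>x. \<bar>w x - f k x\<bar>)" "integrable lborel (\<lambda>x. norm (G x - grad (f k) x))" for k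
      using i fi[of k] by simp_all
    have nn: "0 \<le> (\<integral>x. norm (h x) \<partial>lborel)" for h :: "'a \<Rightarrow> 'c::euclidean_space" by (intro integral_nonneg_AE) simp
    have le1: "(\<integral>x. \<bar>\<psi> x * w x - \<psi> x * f k x\<bar> \<partial>lborel) \<le> B * (\<integral>x. \<bar>w x - f k x\<bar> \<partial>lborel)" for k
    proof -
      have "(\<integral>x. \<bar>\<psi> x * w x - \<psi> x * f k x\<bar> \<partial>lborel) \<le> (\<integral>x. B * \<bar>w x - f k x\<bar> \<partial>lborel)"
      proof (rule integral_mono)
        show "integrable lborel (\<lambda>x. \<bar>\<psi> x * w x - \<psi> x * f k x\<bar>)"
          using m1[OF i(1)] m1[OF fi(1), of k] by simp
        show "integrable lborel (\<lambda>x. B * \<bar>w x - f k x\<bar>)" using d1(1)[of k] by simp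
        show "\<bar>\<psi> x * w x - \<psi> x * f k x\<bar> \<le> B * \<bar>w x - f k x\<bar>" for x
          using b(1)[of x] by (simp add: right_diff_distrib[symmetric] abs_mult mult_right_mono)
      qed
      then show ?thesis by simp
    qed
    have b1: "(\<lambda>k. B * (\<integral>x. \<bar>w x - f k x\<bar> \<partial>lborel)) \<longlonglongrightarrow> 0"
      using tendsto_mult_right_zero[OF l1] .
    show "(\<lambda>k. \<integral>x. \<bar>\<psi> x * w x - \<psi> x * f k x\<bar> \<partial>lborel) \<longlonglongrightarrow> 0"
      by (rule tendsto_sandwich[OF _ _ tendsto_const b1])
        (use le1 in \<open>auto intro!: always_eventually integral_nonneg_AE\<close>)
    have le2: "(\<integral>x. norm (\<psi> x *\<^sub>R G x + w x *\<^sub>R grad \<psi> x - grad (\<lambda>x. \<psi> x * f k x) x) \<partial>lborel)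
        \<le> B * (\<integral>x. norm (G x - grad (f k) x) \<partial>lborel) + B * (\<integral>x. \<bar>w x - f k x\<bar> \<partial>lborel)" for k
    proof -
      have g: "grad (\<lambda>x. \<psi> x * f k x) x = \<psi> x *\<^sub>R grad (f k) x + f k x *\<^sub>R grad \<psi> x" for x
        by (rule grad_mult[OF s test_functions_smooth[OF f]])
      have "(\<integral>x. norm (\<psi> x *\<^sub>R G x + w x *\<^sub>R grad \<psi> x - grad (\<lambda>x. \<psi> x * f k x) x) \<partial>lborel)
          \<le> (\<integral>x. B * norm (G x - grad (f k) x) + B * \<bar>w x - f k x\<bar> \<partial>lborel)"
      proof (rule integral_mono)
        show "integrable lborel (\<lambda>x. norm (\<psi> x *\<^sub>R G x + w x *\<^sub>R grad \<psi> x - grad (\<lambda>x. \<psi> x * f k x) x))"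
          unfolding g using m2[OF i(2)] m3[OF i(1)] m2[OF fi(2), of k] m3[OF fi(1), of k] by simp
        show "integrable lborel (\<lambda>x. B * norm (G x - grad (f k) x) + B * \<bar>w x - f k x\<bar>)"
          using d1[of k] by simp
        fix x
        have "\<psi> x *\<^sub>R G x + w x *\<^sub>R grad \<psi> x - grad (\<lambda>x. \<psi> x * f k x) x = \<psi> x *\<^sub>R (G x - grad (f k) x) + (w x - f k x) *\<^sub>R grad \<psi> x"
          by (simp add: g algebra_simps)
        then have "norm (\<psi> x *\<^sub>R G x + w x *\<^sub>R grad \<psi> x - grad (\<lambda>x. \<psi> x * f k x) x)
            \<le> \<bar>\<psi> x\<bar> * norm (G x - grad (f k) x) + \<bar>w x - f k x\<bar> * norm (grad \<psi> x)"
          using norm_triangle_ineq[of "\<psi> x *\<^sub>R (G x - grad (f k) x)" "(w x - f k x) *\<^sub>R grad \<psi> x"] by simp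
        also have "\<dots> \<le> B * norm (G x - grad (f k) x) + \<bar>w x - f k x\<bar> * B"
          by (intro add_mono mult_right_mono mult_left_mono b) auto
        finally show "norm (\<psi> x *\<^sub>R G x + w x *\<^sub>R grad \<psi> x - grad (\<lambda>x. \<psi> x * f k x) x)
            \<le> B * norm (G x - grad (f k) x) + B * \<bar>w x - f k x\<bar>" by (simp add: mult.commute)
      qed
      then show ?thesis using d1[of k] by simp
    qed
    have b2: "(\<lambda>k. B * (\<integral>x. norm (G x - grad (f k) x) \<partial>lborel) + B * (\<integral>x. \<bar>w x - f k x\<bar> \<partial>lborel)) \<longlonglongrightarrow> 0"
      using tendsto_add[OF tendsto_mult_right_zero[OF l2, of B] b1] by simp
    show "(\<lambda>k. \<integral>x. norm (\<psi> x *\<^sub>R G x + w x *\<^sub>R grad \<psi> x - grad (\<lambda>x. \<psi> x * f k x) x) \<partial>lborel) \<longlonglongrightarrow> 0"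
      by (rule tendsto_sandwich[OF _ _ tendsto_const b2])
        (use le2 in \<open>auto intro!: always_eventually integral_nonneg_AE\<close>)
  qed
qed

text \<open>
  Both sides are continuous under \<open>L^1\<close> convergence of the pair, and for test
  functions the formula is classical integration by parts. No boundary term appears although
  \<open>\<phi>\<close> need not vanish near the boundary of the original domain; here the zero
  boundary values enter.
\<close>

lemma test_limit_by_parts:
  assumes W: "test_limit w G" and t: "\<phi> \<in> test_functions UNIV" and j: "j \<in> Basis"
  shows "(\<integral>x. w x * partial_derivative j \<phi> x \<partial>lborel) = - (\<integral>x. (G x \<bullet> j) * \<phi> x \<partial>lborel)"
proof -
  obtain f where i: "integrable lborel w" "integrable lborel G" and f: "\<And>k. f k \<in> test_functions UNIV"
    and l1: "(\<lambda>k. \<integral>x. \<bar>w x - f k x\<bar> \<partial>lborel) \<longlonglongrightarrow> 0" and l2: "(\<lambda>k. \<integral>x. norm (G x - grad (f k) x) \<partial>lborel) \<longlonglongrightarrow> 0"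
    using W unfolding test_limit_def by blast
  note fi = test_functions_integrable[OF f]
  have lim: "(\<lambda>k. \<integral>x. h k x * \<psi> x \<partial>lborel) \<longlonglongrightarrow> (\<integral>x. h' x * \<psi> x \<partial>lborel)"
    if p: "\<psi> \<in> test_functions UNIV" and hi: "\<And>k. integrable lborel (h k)" "integrable lborel h'"
      and l: "(\<lambda>k. \<integral>x. \<bar>h' x - h k x\<bar> \<partial>lborel) \<longlonglongrightarrow> 0" for h :: "nat \<Rightarrow> 'a \<Rightarrow> real" and h' \<psi>
  proof -
    obtain B where B: "\<And>x. \<bar>\<psi> x\<bar> \<le> B" using test_functions_bounded[OF p] by metis
    have [measurable]: "\<psi> \<in> borel_measurable borel" by (rule test_functions_borel[OF p])
    have m: "integrable lborel (\<lambda>x. g x * \<psi> x)" if "integrable lborel g" for g :: "'a \<Rightarrow> real"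
      using integrable_bounded_scaleR[OF that, of \<psi> B] B by (simp add: mult.commute)
    have "norm ((\<integral>x. h k x * \<psi> x \<partial>lborel) - (\<integral>x. h' x * \<psi> x \<partial>lborel)) \<le> (\<integral>x. \<bar>h' x - h k x\<bar> \<partial>lborel) * B" for k
    proof -
      have "(\<integral>x. h k x * \<psi> x \<partial>lborel) - (\<integral>x. h' x * \<psi> x \<partial>lborel) = (\<integral>x. (h k x - h' x) * \<psi> x \<partial>lborel)"
        using m[OF hi(1), of k] m[OF hi(2)] by (simp add: left_diff_distrib)
      also have "norm \<dots> \<le> (\<integral>x. \<bar>h' x - h k x\<bar> * B \<partial>lborel)"
      proof (rule Bochner_Integration.integral_norm_bound_integral)
        show "integrable lborel (\<lambda>x. (h k x - h' x) * \<psi> x)" using hi by (intro m) simp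
        show "integrable lborel (\<lambda>x. \<bar>h' x - h k x\<bar> * B)" using hi(1)[of k] hi(2) by simp
        show "norm ((h k x - h' x) * \<psi> x) \<le> \<bar>h' x - h k x\<bar> * B" for x
          using B by (simp add: abs_mult abs_minus_commute mult_left_mono)
      qed
      finally show ?thesis by simp
    qed
    then show ?thesis
      by (intro LIM_zero_cancel[OF Lim_null_comparison[OF always_eventually tendsto_mult_left_zero[OF l, of B]]] allI)
  qed
  have "(\<lambda>k. \<integral>x. \<bar>G x \<bullet> j - grad (f k) x \<bullet> j\<bar> \<partial>lborel) \<longlonglongrightarrow> 0"
  proof (rule tendsto_sandwich[OF _ _ tendsto_const l2])
    have "(\<integral>x. \<bar>G x \<bullet> j - grad (f k) x \<bullet> j\<bar> \<partial>lborel) \<le> (\<integral>x. norm (G x - grad (f k) x) \<partial>lborel)" for k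
    proof (rule integral_mono)
      show "\<bar>G x \<bullet> j - grad (f k) x \<bullet> j\<bar> \<le> norm (G x - grad (f k) x)" for x
        using Basis_le_norm[OF j, of "G x - grad (f k) x"] by (simp add: inner_diff_left)
      show "integrable lborel (\<lambda>x. \<bar>G x \<bullet> j - grad (f k) x \<bullet> j\<bar>)"
        using i(2) fi(2)[of k] by (intro integrable_abs Bochner_Integration.integrable_diff integrable_inner_left)
      show "integrable lborel (\<lambda>x. norm (G x - grad (f k) x))"
        using i(2) fi(2)[of k] by simp
    qed
    then show "\<forall>\<^sub>F k in sequentially. (\<integral>x. \<bar>G x \<bullet> j - grad (f k) x \<bullet> j\<bar> \<partial>lborel) \<le> (\<integral>x. norm (G x - grad (f k) x) \<partial>lborel)"
      by simp
  qed (auto intro!: always_eventually integral_nonneg_AE)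
  from lim[OF t _ _ this]
  have r: "(\<lambda>k. \<integral>x. (grad (f k) x \<bullet> j) * \<phi> x \<partial>lborel) \<longlonglongrightarrow> (\<integral>x. (G x \<bullet> j) * \<phi> x \<partial>lborel)"
    using i(2) fi(2) by (auto intro!: integrable_inner_left)
  have "(\<lambda>k. \<integral>x. f k x * partial_derivative j \<phi> x \<partial>lborel) \<longlonglongrightarrow> (\<integral>x. w x * partial_derivative j \<phi> x \<partial>lborel)"
    by (rule lim[OF test_functions_partial_derivative[OF t j] fi(1) i(1) l1])
  moreover have "(\<integral>x. f k x * partial_derivative j \<phi> x \<partial>lborel) = - (\<integral>x. (grad (f k) x \<bullet> j) * \<phi> x \<partial>lborel)" for k
    using integration_by_parts[OF f test_functions_smooth[OF t] j, of k] j by simp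
  ultimately have "(\<lambda>k. - (\<integral>x. (grad (f k) x \<bullet> j) * \<phi> x \<partial>lborel)) \<longlonglongrightarrow> (\<integral>x. w x * partial_derivative j \<phi> x \<partial>lborel)"
    by simp
  then show ?thesis using tendsto_minus[OF r] LIMSEQ_unique by blast
qed

text \<open>
  Mollification commutes with the gradient across the boundary of the domain, which is what
  allows the gradient of the approximants to be estimated by an average of \<open>G\<close>.
\<close>

lemma test_limit_grad_conv:
  assumes W: "test_limit w G" and k: "k \<in> test_functions UNIV"
  shows "grad (conv k w) x = conv k G x"
proof (rule euclidean_eqI)
  fix j :: 'a assume j: "j \<in> Basis"
  have i: "integrable lborel w" "integrable lborel G" using W by (auto simp: test_limit_def)
  let ?\<phi> = "\<lambda>y. k (x - y)"
  have s: "smooth k" by (rule test_functions_smooth[OF k])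
  obtain K where K: "compact K" "\<And>x. x \<notin> K \<Longrightarrow> k x = 0" by (rule test_functionsE[OF k]) blast
  have t: "?\<phi> \<in> test_functions UNIV"
  proof (rule test_functionsI)
    show "smooth ?\<phi>" using smooth_affine[OF s, of x "-1"] by simp
    show "compact ((\<lambda>y. x - y) ` K)" by (intro compact_continuous_image K continuous_intros)
    show "?\<phi> y = 0" if "y \<notin> (\<lambda>y. x - y) ` K" for y
    proof (rule K(2), rule)
      assume "x - y \<in> K"
      then have "x - (x - y) \<in> (\<lambda>y. x - y) ` K" by (rule imageI)
      then show False using that by simp
    qed
  qed simp
  have g: "partial_derivative j ?\<phi> y = - (grad k (x - y) \<bullet> j)" for y
    using grad_affine[OF s, of x "-1" y] grad_inner_Basis[OF j, of ?\<phi> y] by simp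
  have "grad (conv k w) x \<bullet> j = (\<integral>y. (w y *\<^sub>R grad k (x - y)) \<bullet> j \<partial>lborel)"
    unfolding grad_conv[OF k i(1)]
    by (rule integral_inner_left[symmetric]) (rule integrable_grad_kernel[OF k i(1)])
  also have "\<dots> = - (\<integral>y. w y * partial_derivative j ?\<phi> y \<partial>lborel)"
    unfolding g by simp
  also have "\<dots> = (\<integral>y. (G y \<bullet> j) * k (x - y) \<partial>lborel)"
    using test_limit_by_parts[OF W t j] by simp
  also have "\<dots> = (\<integral>y. (k (x - y) *\<^sub>R G y) \<bullet> j \<partial>lborel)" by (simp add: mult.commute)
  also have "\<dots> = conv k G x \<bullet> j"
    unfolding conv_def by (rule integral_inner_left) (rule conv_integrable(1)[OF k i(2)])
  finally show "grad (conv k w) x \<bullet> j = conv k G x \<bullet> j" .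
qed

text \<open>
  Chain rule. Along a subsequence the test functions converge almost everywhere, so the factors
  \<open>T' (f k x)\<close> converge boundedly while the gradients converge in
  \<open>L^1\<close>. The condition \<open>T 0 = 0\<close> keeps the supports compact.
\<close>

lemma test_limit_compose:
  assumes W: "test_limit w G" and s: "smooth T" "T 0 = 0"
    and D: "\<And>t. (T has_real_derivative T' t) (at t)" "continuous_on UNIV T'" "\<And>t. \<bar>T' t\<bar> \<le> B"
  shows "test_limit (\<lambda>x. T (w x)) (\<lambda>x. T' (w x) *\<^sub>R G x)"
proof -
  obtain f where i: "integrable lborel w" "integrable lborel G" and f: "\<And>k. f k \<in> test_functions UNIV"
    and l1: "(\<lambda>k. \<integral>x. \<bar>w x - f k x\<bar> \<partial>lborel) \<longlonglongrightarrow> 0" and l2: "(\<lambda>k. \<integral>x. norm (G x - grad (f k) x) \<partial>lborel) \<longlonglongrightarrow> 0"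
    using W unfolding test_limit_def by blast
  have B0: "B \<ge> 0" using D(3)[of 0] by linarith
  have lip: "\<bar>T a - T b\<bar> \<le> B * \<bar>a - b\<bar>" for a b
  proof -
    have g: "grad T t = T' t" for t
      using grad_unique[OF D(1)[unfolded has_field_derivative_def]] by simp
    show ?thesis using grad_bound_imp_lipschitz[of T B a b] smooth_differentiable[OF s(1)] D(3) by (simp add: g)
  qed
  have [measurable]: "T \<in> borel_measurable borel" "T' \<in> borel_measurable borel"
    using smooth_continuous[OF s(1)] D(2) by (simp_all add: borel_measurable_continuous_onI)
  have [measurable]: "w \<in> borel_measurable borel" "G \<in> borel_measurable borel"
    using i by (simp_all add: borel_measurable_integrable)
  have fm [measurable]: "f k \<in> borel_measurable borel" "grad (f k) \<in> borel_measurable borel" for k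
    using test_functions_borel[OF f] test_functions_borel_grad[OF f] by auto
  note fi = test_functions_integrable[OF f]
  have Tw: "integrable lborel (\<lambda>x. T (h x))" if h: "integrable lborel h" for h :: "'a \<Rightarrow> real"
  proof (rule Bochner_Integration.integrable_bound)
    have [measurable]: "h \<in> borel_measurable borel" using h by (simp add: borel_measurable_integrable)
    show "integrable lborel (\<lambda>x. B * h x)" using h by simp
    show "(\<lambda>x. T (h x)) \<in> borel_measurable lborel" by simp
    show "AE x in lborel. norm (T (h x)) \<le> norm (B * h x)"
      using lip[of _ 0] s(2) B0 by (intro AE_I2) (simp add: abs_mult)
  qed
  have TG: "integrable lborel (\<lambda>x. T' (h x) *\<^sub>R H x)" if "integrable lborel H" "h \<in> borel_measurable borel" for h :: "'a \<Rightarrow> real" and H :: "'a \<Rightarrow> 'a"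
    using integrable_bounded_scaleR[OF that(1), of "\<lambda>x. T' (h x)" B] D(3) that(2) by simp
  have l1': "(\<lambda>k. \<integral>x. norm (f k x - w x) \<partial>lborel) \<longlonglongrightarrow> 0"
    using l1 by (simp add: abs_minus_commute)
  have "\<exists>r. strict_mono r \<and> (AE x in lborel. (\<lambda>n. f (r n) x) \<longlonglongrightarrow> w x)"
  proof -
    have "integrable lborel (\<lambda>x. f k x - w x)" for k using i(1) fi(1)[of k] by simp
    from tendsto_L1_AE_subseq[OF this l1'] obtain r :: "nat \<Rightarrow> nat"
      where r: "strict_mono r" "AE x in lborel. (\<lambda>n. f (r n) x - w x) \<longlonglongrightarrow> 0" by blast
    have "AE x in lborel. (\<lambda>n. f (r n) x) \<longlonglongrightarrow> w x"
      using r(2) by (rule eventually_mono) (rule LIM_zero_cancel)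
    then show ?thesis using r(1) by blast
  qed
  then obtain r where r: "strict_mono (r :: nat \<Rightarrow> nat)" "AE x in lborel. (\<lambda>n. f (r n) x) \<longlonglongrightarrow> w x" by blast
  have l1r: "(\<lambda>n. \<integral>x. \<bar>w x - f (r n) x\<bar> \<partial>lborel) \<longlonglongrightarrow> 0" and l2r: "(\<lambda>n. \<integral>x. norm (G x - grad (f (r n)) x) \<partial>lborel) \<longlonglongrightarrow> 0"
    using LIMSEQ_subseq_LIMSEQ[OF l1 r(1)] LIMSEQ_subseq_LIMSEQ[OF l2 r(1)] by (simp_all add: comp_def)
  show ?thesis
    unfolding test_limit_def
  proof (intro conjI exI[of _ "\<lambda>k x. T (f (r k) x)"] allI)
    show "integrable lborel (\<lambda>x. T (w x))" by (rule Tw[OF i(1)])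
    show "integrable lborel (\<lambda>x. T' (w x) *\<^sub>R G x)" by (rule TG[OF i(2)]) simp
    show "(\<lambda>x. T (f (r k) x)) \<in> test_functions UNIV" for k
      by (rule test_functions_compose[OF s f])
    have "(\<integral>x. \<bar>T (w x) - T (f (r k) x)\<bar> \<partial>lborel) \<le> B * (\<integral>x. \<bar>w x - f (r k) x\<bar> \<partial>lborel)" for k
    proof -
      have "(\<integral>x. \<bar>T (w x) - T (f (r k) x)\<bar> \<partial>lborel) \<le> (\<integral>x. B * \<bar>w x - f (r k) x\<bar> \<partial>lborel)"
        using Tw[OF i(1)] Tw[OF fi(1), of "r k"] i(1) fi(1)[of "r k"] lip by (intro integral_mono) auto
      then show ?thesis by simp
    qed
    then show "(\<lambda>k. \<integral>x. \<bar>T (w x) - T (f (r k) x)\<bar> \<partial>lborel) \<longlonglongrightarrow> 0"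
      by (intro tendsto_sandwich[OF _ _ tendsto_const tendsto_mult_right_zero[OF l1r, of B]])
        (auto intro!: always_eventually integral_nonneg_AE)
    have g: "grad (\<lambda>x. T (f (r k) x)) x = T' (f (r k) x) *\<^sub>R grad (f (r k)) x" for k x
      by (rule grad_compose[OF test_functions_smooth[OF f] D(1)])
    let ?a = "\<lambda>k x. norm ((T' (w x) - T' (f (r k) x)) *\<^sub>R G x)"
    have ai: "integrable lborel (?a k)" for k
      using TG[OF i(2), of w] TG[OF i(2), of "f (r k)"] by (simp add: scaleR_diff_left)
    have al: "(\<lambda>k. \<integral>x. ?a k x \<partial>lborel) \<longlonglongrightarrow> (\<integral>x. 0 \<partial>(lborel :: 'a measure))"
    proof (rule integral_dominated_convergence[where w="\<lambda>x. 2 * B * norm (G x)"])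
      show "AE x in lborel. (\<lambda>k. ?a k x) \<longlonglongrightarrow> 0"
        using r(2)
      proof eventually_elim
        case (elim x)
        have "(\<lambda>k. T' (f (r k) x)) \<longlonglongrightarrow> T' (w x)"
          using continuous_on_tendsto_compose[OF D(2) elim] by simp
        then have "(\<lambda>k. norm ((T' (w x) - T' (f (r k) x)) *\<^sub>R G x)) \<longlonglongrightarrow> norm ((T' (w x) - T' (w x)) *\<^sub>R G x)"
          by (intro tendsto_intros)
        then show ?case by simp
      qed
      show "AE x in lborel. norm (?a k x) \<le> 2 * B * norm (G x)" for k
      proof (rule AE_I2)
        fix x
        have "\<bar>T' (w x) - T' (f (r k) x)\<bar> \<le> 2 * B" using D(3)[of "w x"] D(3)[of "f (r k) x"] by linarith
        then show "norm (?a k x) \<le> 2 * B * norm (G x)" by (simp add: mult_right_mono)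
      qed
    qed (use i(2) in simp_all)
    have "(\<integral>x. norm (T' (w x) *\<^sub>R G x - grad (\<lambda>x. T (f (r k) x)) x) \<partial>lborel)
        \<le> (\<integral>x. ?a k x \<partial>lborel) + B * (\<integral>x. norm (G x - grad (f (r k)) x) \<partial>lborel)" for k
    proof -
      have d: "integrable lborel (\<lambda>x. norm (G x - grad (f (r k)) x))" using i(2) fi(2)[of "r k"] by simp
      have "(\<integral>x. norm (T' (w x) *\<^sub>R G x - grad (\<lambda>x. T (f (r k) x)) x) \<partial>lborel)
        \<le> (\<integral>x. ?a k x + B * norm (G x - grad (f (r k)) x) \<partial>lborel)"
      proof (rule integral_mono)
        show "integrable lborel (\<lambda>x. norm (T' (w x) *\<^sub>R G x - grad (\<lambda>x. T (f (r k) x)) x))"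
          unfolding g using TG[OF i(2), of w] TG[OF fi(2), of "f (r k)" "r k"] by simp
        show "integrable lborel (\<lambda>x. ?a k x + B * norm (G x - grad (f (r k)) x))"
          using ai[of k] d by simp
        fix x
        have "T' (w x) *\<^sub>R G x - grad (\<lambda>x. T (f (r k) x)) x
            = (T' (w x) - T' (f (r k) x)) *\<^sub>R G x + T' (f (r k) x) *\<^sub>R (G x - grad (f (r k)) x)"
          by (simp add: g algebra_simps)
        then have "norm (T' (w x) *\<^sub>R G x - grad (\<lambda>x. T (f (r k) x)) x)
            \<le> ?a k x + \<bar>T' (f (r k) x)\<bar> * norm (G x - grad (f (r k)) x)"
          using norm_triangle_ineq[of "(T' (w x) - T' (f (r k) x)) *\<^sub>R G x" "T' (f (r k) x) *\<^sub>R (G x - grad (f (r k)) x)"] by simp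
        also have "\<dots> \<le> ?a k x + B * norm (G x - grad (f (r k)) x)"
          by (intro add_left_mono mult_right_mono D(3)) simp
        finally show "norm (T' (w x) *\<^sub>R G x - grad (\<lambda>x. T (f (r k) x)) x) \<le> ?a k x + B * norm (G x - grad (f (r k)) x)" .
      qed
      then show ?thesis using ai[of k] d by simp
    qed
    note le = this
    have lim: "(\<lambda>k. (\<integral>x. ?a k x \<partial>lborel) + B * (\<integral>x. norm (G x - grad (f (r k)) x) \<partial>lborel)) \<longlonglongrightarrow> 0"
      using tendsto_add[OF al tendsto_mult_right_zero[OF l2r, of B]] by simp
    show "(\<lambda>k. \<integral>x. norm (T' (w x) *\<^sub>R G x - grad (\<lambda>x. T (f (r k) x)) x) \<partial>lborel) \<longlonglongrightarrow> 0"
      by (rule tendsto_sandwich[OF _ _ tendsto_const lim])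
        (use le in \<open>auto intro!: always_eventually integral_nonneg_AE\<close>)
  qed
qed

section \<open>The structure of a continuous weak N-function\<close>

subsection \<open>From almost every point to every point\<close>

text \<open>
  The set where the inequality fails is open, so it cannot be a nonempty null set.
\<close>

lemma AE_continuous_le:
  fixes a b :: "'a::euclidean_space \<Rightarrow> real"
  assumes O: "open \<Omega>" and c: "continuous_on \<Omega> a" "continuous_on \<Omega> b"
    and ae: "AE x in lebesgue_on \<Omega>. a x \<le> b x" and x: "x \<in> \<Omega>"
  shows "a x \<le> b x"
proof -
  have O': "\<Omega> \<inter> space lebesgue \<in> sets lebesgue" using O by auto
  let ?S = "\<Omega> \<inter> (\<lambda>x. a x - b x) -` {0<..}"
  have "open ?S"
    by (rule continuous_open_preimage[OF continuous_on_diff[OF c] O]) simp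
  then have "closed (- ?S)" by (rule closed_Compl)
  moreover have "AE x in lebesgue. x \<in> - ?S"
    using ae unfolding AE_restrict_space_iff[OF O'] by (rule eventually_mono) auto
  ultimately have "x \<in> - ?S" by (rule mem_closed_if_AE_lebesgue)
  then show ?thesis using x by simp
qed

text \<open>
  Essential bounds become bounds at every pair of points when the functions have continuous
  representatives. The representatives \<open>a'\<close>, \<open>b'\<close> are separate from
  \<open>a\<close>, \<open>b\<close> because the radial profiles in \<open>B_ort\<close> agree
  with the continuous \<open>M\<close> only almost everywhere.
\<close>

lemma esssup_essinf_pointwise:
  fixes a b :: "'a::euclidean_space \<Rightarrow> real"
  assumes U: "open U" and c: "continuous_on U a'" "continuous_on U b'"
    and ae: "AE x in lebesgue_on U. a x = a' x" "AE x in lebesgue_on U. b x = b' x"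
    and le: "esssup (lebesgue_on U) (\<lambda>x. ereal (a x)) \<le> essinf (lebesgue_on U) (\<lambda>x. ereal (b x)) + 1"
    and x: "x \<in> U" and y: "y \<in> U"
  shows "a' x \<le> b' y + 1"
proof -
  let ?N = "lebesgue_on U" and ?\<beta> = "essinf (lebesgue_on U) (\<lambda>x. ereal (b x))"
  have "AE x in ?N. ereal (a x) \<le> ?\<beta> + 1"
    using esssup_AE[of "\<lambda>x. ereal (a x)" ?N] by (rule eventually_mono) (use le order_trans in blast)
  then have A: "AE x in ?N. ereal (a' x) \<le> ?\<beta> + 1"
    using ae(1) by eventually_elim simp
  have "AE y in ?N. ?\<beta> \<le> ereal (b y)"
    using esssup_AE[of "\<lambda>x. - ereal (b x)" ?N]
    by (rule eventually_mono) (simp add: essinf_def ereal_uminus_le_reorder)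
  then have B: "AE y in ?N. ?\<beta> \<le> ereal (b' y)"
    using ae(2) by eventually_elim simp
  have cb: "continuous_on U (\<lambda>y. b' y + 1)"
    by (intro continuous_on_add c(2) continuous_on_const)
  have "AE x in ?N. \<forall>y\<in>U. a' x \<le> b' y + 1"
    using A
  proof eventually_elim
    case (elim x)
    have "AE y in ?N. a' x \<le> b' y + 1"
      using B
    proof eventually_elim
      case (elim y)
      have "ereal (a' x) \<le> ereal (b' y) + 1"
        using \<open>ereal (a' x) \<le> ?\<beta> + 1\<close> add_right_mono[OF elim, of 1] by (rule order_trans)
      then show ?case by (simp add: one_ereal_def)
    qed
    then have "\<And>y. y \<in> U \<Longrightarrow> a' x \<le> b' y + 1"
      by (rule AE_continuous_le[OF U continuous_on_const cb])
    then show ?case by blast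
  qed
  then have "AE x in ?N. a' x \<le> b' y + 1"
    by (rule eventually_mono) (use y in blast)
  then show ?thesis
    by (rule AE_continuous_le[OF U c(1) continuous_on_const _ x])
qed

text \<open>
  The properties of a weak N-function that are used below, at every point instead of almost
  every point. Boundedness on bounded sets stands for the convex upper bound.
\<close>

definition regular_N :: "'a::euclidean_space set \<Rightarrow> ('a \<Rightarrow> 'b::euclidean_space \<Rightarrow> real) \<Rightarrow> bool" where
  "regular_N \<Omega> M \<longleftrightarrow> continuous_on (\<Omega> \<times> UNIV) (\<lambda>(x, \<xi>). M x \<xi>) \<and>
     (\<forall>x\<in>\<Omega>. M x 0 = 0 \<and> convex_on UNIV (M x) \<and> (\<forall>\<xi>. M x (- \<xi>) = M x \<xi>) \<and> (\<forall>\<xi>. 0 \<le> M x \<xi>)) \<and>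
     (\<forall>R. \<exists>B. \<forall>x\<in>\<Omega>. \<forall>\<xi>. norm \<xi> \<le> R \<longrightarrow> M x \<xi> \<le> B)"

lemma continuous_on_slice:
  assumes "continuous_on (\<Omega> \<times> UNIV) (\<lambda>(x, \<xi>). M x \<xi>)"
  shows "continuous_on \<Omega> (\<lambda>x. M x \<xi>)"
proof -
  have "continuous_on \<Omega> (\<lambda>x. (x, \<xi>))"
    by (intro continuous_on_Pair continuous_on_id continuous_on_const)
  from continuous_on_compose2[OF assms this] show ?thesis by auto
qed

lemma weak_N_function_regular:
  fixes M :: "'a::euclidean_space \<Rightarrow> 'b::euclidean_space \<Rightarrow> real"
  assumes O: "open \<Omega>" and N: "weak_N_function \<Omega> M"
    and c: "continuous_on (\<Omega> \<times> UNIV) (\<lambda>(x, \<xi>). M x \<xi>)"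
  shows "regular_N \<Omega> M"
proof -
  note cs = continuous_on_slice[OF c]
  have nn: "\<And>x \<xi>. x \<in> \<Omega> \<Longrightarrow> 0 \<le> M x \<xi>"
    and ae1: "AE x in lebesgue_on \<Omega>. M x 0 = 0 \<and> convex_on UNIV (M x)"
    and ae2: "AE x in lebesgue_on \<Omega>. \<forall>\<xi>. M x \<xi> = M x (- \<xi>)"
    using N by (auto simp: weak_N_function_def)
  obtain m1 m2 :: "real \<Rightarrow> real" where m2: "convex_on {0..} m2" "\<And>s. s \<ge> 0 \<Longrightarrow> 0 \<le> m2 s"
    and ae3: "AE x in lebesgue_on \<Omega>. \<forall>\<xi>. m1 (norm \<xi>) \<le> M x \<xi> \<and> M x \<xi> \<le> m2 (norm \<xi>)"
    using N unfolding weak_N_function_def by blast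
  have zero: "M x 0 = 0" if "x \<in> \<Omega>" for x
  proof (rule antisym)
    show "M x 0 \<le> 0"
      by (rule AE_continuous_le[OF O cs continuous_on_const _ that])
        (rule eventually_mono[OF ae1], auto)
  qed (rule nn[OF that])
  have even: "M x (- \<xi>) = M x \<xi>" if "x \<in> \<Omega>" for x \<xi>
  proof (rule antisym)
    show "M x (- \<xi>) \<le> M x \<xi>"
      by (rule AE_continuous_le[OF O cs cs _ that]) (rule eventually_mono[OF ae2], auto)
    show "M x \<xi> \<le> M x (- \<xi>)"
      by (rule AE_continuous_le[OF O cs cs _ that]) (rule eventually_mono[OF ae2], auto)
  qed
  have conv: "convex_on UNIV (M x)" if "x \<in> \<Omega>" for x
    unfolding convex_on_def
  proof (intro conjI ballI allI impI)
    fix \<xi> \<eta> :: 'b and u v :: real assume uv: "0 \<le> u" "0 \<le> v" "u + v = 1"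
    show "M x (u *\<^sub>R \<xi> + v *\<^sub>R \<eta>) \<le> u * M x \<xi> + v * M x \<eta>"
    proof (rule AE_continuous_le[OF O cs _ _ that])
      show "continuous_on \<Omega> (\<lambda>x. u * M x \<xi> + v * M x \<eta>)" by (intro continuous_intros cs)
      show "AE x in lebesgue_on \<Omega>. M x (u *\<^sub>R \<xi> + v *\<^sub>R \<eta>) \<le> u * M x \<xi> + v * M x \<eta>"
        using ae1 by (rule eventually_mono) (use uv in \<open>auto simp: convex_on_def\<close>)
    qed
  qed simp
  have bd: "\<exists>B. \<forall>x\<in>\<Omega>. \<forall>\<xi>. norm \<xi> \<le> R \<longrightarrow> M x \<xi> \<le> B" for R
  proof (intro exI[of _ "m2 0 + m2 \<bar>R\<bar>"] ballI allI impI)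
    fix x and \<xi> :: 'b assume x: "x \<in> \<Omega>" and \<xi>: "norm \<xi> \<le> R"
    have 1: "M x \<xi> \<le> m2 (norm \<xi>)"
      by (rule AE_continuous_le[OF O cs continuous_on_const _ x]) (rule eventually_mono[OF ae3], auto)
    have R: "R \<ge> 0" using \<xi> norm_ge_zero order_trans by blast
    \<comment> \<open>The bound \<open>m2\<close> need not be monotone, but convexity bounds it
      by its values at the endpoints.\<close>
    have "m2 (norm \<xi>) \<le> m2 0 + m2 R"
    proof (cases "R = 0")
      case True
      then show ?thesis using \<xi> m2(2)[of 0] by simp
    next
      case False
      define t where "t = norm \<xi> / R"
      have t: "0 \<le> t" "t \<le> 1" "norm \<xi> = t * R" using R False \<xi> by (auto simp: t_def)
      have "m2 ((1 - t) *\<^sub>R 0 + t *\<^sub>R R) \<le> (1 - t) * m2 0 + t * m2 R"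
        using m2(1)[unfolded convex_on_def, THEN conjunct2, rule_format, of 0 R "1 - t" t] t R by simp
      also have "\<dots> \<le> 1 * m2 0 + 1 * m2 R"
        using t m2(2)[of 0] m2(2)[OF R] by (intro add_mono mult_right_mono) auto
      finally show ?thesis by (simp add: t(3))
    qed
    with 1 R show "M x \<xi> \<le> m2 0 + m2 \<bar>R\<bar>" by simp
  qed
  show ?thesis
    unfolding regular_N_def using c zero conv even nn bd by blast
qed

context
  fixes \<Omega> :: "'a::euclidean_space set" and M :: "'a \<Rightarrow> 'b::euclidean_space \<Rightarrow> real"
  assumes reg: "regular_N \<Omega> M"
begin

lemma regular_N_nonneg: "x \<in> \<Omega> \<Longrightarrow> 0 \<le> M x \<xi>"
  and regular_N_zero: "x \<in> \<Omega> \<Longrightarrow> M x 0 = 0"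
  and regular_N_even: "x \<in> \<Omega> \<Longrightarrow> M x (- \<xi>) = M x \<xi>"
  and regular_N_continuous: "continuous_on (\<Omega> \<times> UNIV) (\<lambda>(x, \<xi>). M x \<xi>)"
  using reg by (auto simp: regular_N_def)

lemma regular_N_bounded: "\<exists>B\<ge>0. \<forall>x\<in>\<Omega>. \<forall>\<xi>. norm \<xi> \<le> R \<longrightarrow> M x \<xi> \<le> B"
proof -
  obtain B where "\<forall>x\<in>\<Omega>. \<forall>\<xi>. norm \<xi> \<le> R \<longrightarrow> M x \<xi> \<le> B" using reg unfolding regular_N_def by blast
  then show ?thesis by (intro exI[of _ "max 0 B"]) (auto simp: le_max_iff_disj)
qed

lemma regular_N_convex:
  assumes "x \<in> \<Omega>" "0 \<le> u" "0 \<le> v" "u + v = 1"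
  shows "M x (u *\<^sub>R \<xi> + v *\<^sub>R \<eta>) \<le> u * M x \<xi> + v * M x \<eta>"
  using reg assms by (auto simp: regular_N_def convex_on_def)

lemma regular_N_scale:
  assumes "x \<in> \<Omega>" "\<bar>a\<bar> \<le> 1"
  shows "M x (a *\<^sub>R \<xi>) \<le> \<bar>a\<bar> * M x \<xi>"
proof -
  have pos: "M x (b *\<^sub>R \<xi>) \<le> b * M x \<xi>" if "0 \<le> b" "b \<le> 1" for b
    using regular_N_convex[OF assms(1), of b "1 - b" \<xi> 0] that regular_N_zero[OF assms(1)] by simp
  show ?thesis
  proof (cases "a \<ge> 0")
    case False
    then show ?thesis
      using pos[of "- a"] assms regular_N_even[OF assms(1), of "- a *\<^sub>R \<xi>"] by simp
  qed (use pos[of a] assms in simp)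
qed

lemma regular_N_scale_mono:
  assumes "x \<in> \<Omega>" "\<bar>a\<bar> \<le> \<bar>b\<bar>"
  shows "M x (a *\<^sub>R \<xi>) \<le> M x (b *\<^sub>R \<xi>)"
proof (cases "b = 0")
  case False
  have ab: "\<bar>a / b\<bar> \<le> 1" using assms False by (simp add: divide_le_eq)
  have "M x ((a / b) *\<^sub>R (b *\<^sub>R \<xi>)) \<le> \<bar>a / b\<bar> * M x (b *\<^sub>R \<xi>)"
    by (rule regular_N_scale[OF assms(1) ab])
  also have "\<dots> \<le> 1 * M x (b *\<^sub>R \<xi>)"
    by (rule mult_right_mono[OF ab regular_N_nonneg[OF assms(1)]])
  finally show ?thesis using False by simp
qed (use assms in simp)

lemma regular_N_add:
  assumes "x \<in> \<Omega>"
  shows "M x (\<xi> + \<eta>) \<le> M x (2 *\<^sub>R \<xi>) + M x (2 *\<^sub>R \<eta>)"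
proof -
  have "M x ((1/2) *\<^sub>R (2 *\<^sub>R \<xi>) + (1/2) *\<^sub>R (2 *\<^sub>R \<eta>)) \<le> (1/2) * M x (2 *\<^sub>R \<xi>) + (1/2) * M x (2 *\<^sub>R \<eta>)"
    by (rule regular_N_convex[OF assms]) auto
  then show ?thesis
    using regular_N_nonneg[OF assms, of "2 *\<^sub>R \<xi>"] regular_N_nonneg[OF assms, of "2 *\<^sub>R \<eta>"] by simp
qed

end

lemma integrable_const_bounded:
  assumes "open \<Omega>" "bounded \<Omega>"
  shows "integrable (lebesgue_on \<Omega>) (\<lambda>x::'a::euclidean_space. c :: real)"
proof -
  have "\<Omega> \<in> lmeasurable" by (rule lmeasurable_open[OF assms(2,1)])
  then interpret finite_measure "lebesgue_on \<Omega>" by (rule finite_measure_lebesgue_on)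
  show ?thesis by simp
qed

text \<open>
  Iterating the doubling condition gives any power of \<open>2\<close>, hence any factor
  \<open>A\<close>; small arguments, which \<open>Delta2\<close> leaves out, are covered by a
  constant from the boundedness of \<open>M\<close> on bounded sets.
\<close>

lemma Delta2_scale:
  fixes M :: "'a::euclidean_space \<Rightarrow> 'b::euclidean_space \<Rightarrow> real"
  assumes O: "open \<Omega>" "bounded \<Omega>" and reg: "regular_N \<Omega> M" and D: "Delta2 \<Omega> M"
  shows "\<exists>c h. 0 \<le> c \<and> integrable (lebesgue_on \<Omega>) h \<and> (\<forall>x\<in>\<Omega>. 0 \<le> h x) \<and>
     (AE x in lebesgue_on \<Omega>. \<forall>\<xi>. M x (A *\<^sub>R \<xi>) \<le> c * M x \<xi> + h x)"
proof -
  obtain c C h where c: "c > 0" and h: "integrable (lebesgue_on \<Omega>) h" "\<forall>x\<in>\<Omega>. 0 \<le> h x"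
    and ae: "AE x in lebesgue_on \<Omega>. \<forall>\<xi>. norm \<xi> > C \<longrightarrow> M x (2 *\<^sub>R \<xi>) \<le> c * M x \<xi> + h x"
    using D unfolding Delta2_def by blast
  obtain B where B: "B \<ge> 0" "\<And>x \<xi>. x \<in> \<Omega> \<Longrightarrow> norm \<xi> \<le> 2 * C \<Longrightarrow> M x \<xi> \<le> B"
    using regular_N_bounded[OF reg, of "2 * C"] by blast
  have sp: "AE x in lebesgue_on \<Omega>. x \<in> \<Omega>"
    using AE_space[of "lebesgue_on \<Omega>"] by (simp add: space_restrict_space)
  have two: "AE x in lebesgue_on \<Omega>. \<forall>\<xi>. M x (2 *\<^sub>R \<xi>) \<le> c * M x \<xi> + (h x + B)"
    using ae sp
  proof eventually_elim
    case (elim x)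
    show ?case
    proof
      fix \<xi>
      show "M x (2 *\<^sub>R \<xi>) \<le> c * M x \<xi> + (h x + B)"
      proof (cases "norm \<xi> > C")
        case True
        then have "M x (2 *\<^sub>R \<xi>) \<le> c * M x \<xi> + h x" using elim by blast
        then show ?thesis using B(1) by simp
      next
        case False
        then have "M x (2 *\<^sub>R \<xi>) \<le> B" using elim by (intro B(2)) auto
        moreover have "0 \<le> c * M x \<xi>" "0 \<le> h x" using c h(2) elim regular_N_nonneg[OF reg] by auto
        ultimately show ?thesis by simp
      qed
    qed
  qed
  have pow: "\<exists>c h. 0 \<le> c \<and> integrable (lebesgue_on \<Omega>) h \<and> (\<forall>x\<in>\<Omega>. 0 \<le> h x) \<and>
     (AE x in lebesgue_on \<Omega>. \<forall>\<xi>. M x (2 ^ k *\<^sub>R \<xi>) \<le> c * M x \<xi> + h x)" for k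
  proof (induction k)
    case 0
    show ?case by (intro exI[of _ 1] exI[of _ "\<lambda>_. 0"]) simp
  next
    case (Suc k)
    then obtain c' h' where c': "0 \<le> c'" and h': "integrable (lebesgue_on \<Omega>) h'" "\<forall>x\<in>\<Omega>. 0 \<le> h' x"
      and ae': "AE x in lebesgue_on \<Omega>. \<forall>\<xi>. M x (2 ^ k *\<^sub>R \<xi>) \<le> c' * M x \<xi> + h' x" by blast
    have "AE x in lebesgue_on \<Omega>. \<forall>\<xi>. M x (2 ^ Suc k *\<^sub>R \<xi>) \<le> (c * c') * M x \<xi> + (c * h' x + (h x + B))"
      using two ae'
    proof eventually_elim
      case (elim x)
      show ?case
      proof
        fix \<xi>
        have "M x (2 ^ Suc k *\<^sub>R \<xi>) = M x (2 *\<^sub>R (2 ^ k *\<^sub>R \<xi>))" by simp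
        also have "\<dots> \<le> c * M x (2 ^ k *\<^sub>R \<xi>) + (h x + B)" using elim(1) by blast
        also have "\<dots> \<le> c * (c' * M x \<xi> + h' x) + (h x + B)"
          using elim(2) c by (intro add_right_mono mult_left_mono) auto
        finally show "M x (2 ^ Suc k *\<^sub>R \<xi>) \<le> (c * c') * M x \<xi> + (c * h' x + (h x + B))"
          by (simp add: algebra_simps)
      qed
    qed
    moreover have "integrable (lebesgue_on \<Omega>) (\<lambda>x. c * h' x + (h x + B))"
      using h(1) h'(1) integrable_const_bounded[OF O, of B] by simp
    ultimately show ?case
      using c c' h(2) h'(2) B(1) by (intro exI[of _ "c * c'"] exI[of _ "\<lambda>x. c * h' x + (h x + B)"]) auto
  qed
  obtain k where k: "\<bar>A\<bar> < 2 ^ k" using real_arch_pow[of 2 "\<bar>A\<bar>"] by auto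
  obtain c' h' where c': "0 \<le> c'" and h': "integrable (lebesgue_on \<Omega>) h'" "\<forall>x\<in>\<Omega>. 0 \<le> h' x"
      and ae': "AE x in lebesgue_on \<Omega>. \<forall>\<xi>. M x (2 ^ k *\<^sub>R \<xi>) \<le> c' * M x \<xi> + h' x" using pow[of k] by blast
  have "AE x in lebesgue_on \<Omega>. \<forall>\<xi>. M x (A *\<^sub>R \<xi>) \<le> c' * M x \<xi> + h' x"
    using ae' sp
  proof eventually_elim
    case (elim x)
    have "M x (A *\<^sub>R \<xi>) \<le> M x (2 ^ k *\<^sub>R \<xi>)" for \<xi>
      using k elim(2) by (intro regular_N_scale_mono[OF reg]) auto
    then show ?case using elim(1) order_trans by blast
  qed
  then show ?thesis using c' h' by blast
qed

subsection \<open>Measurability and modular spaces\<close>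

text \<open>
  Holds for simple \<open>p\<close>, which take finitely many values, and passes to limits by
  continuity.
\<close>

lemma caratheodory_measurable:
  fixes H :: "'a \<Rightarrow> 'c::euclidean_space \<Rightarrow> real"
  assumes m: "\<And>c. (\<lambda>x. H x c) \<in> borel_measurable N"
    and c: "\<And>x. x \<in> space N \<Longrightarrow> continuous_on UNIV (H x)"
    and p: "p \<in> borel_measurable N"
  shows "(\<lambda>x. H x (p x)) \<in> borel_measurable N"
proof -
  obtain s where s: "\<And>i. simple_function N (s i)" "\<And>x. x \<in> space N \<Longrightarrow> (\<lambda>i. s i x) \<longlonglongrightarrow> p x"
    using borel_measurable_implies_sequence_metric[OF p, of 0] by blast
  show ?thesis
  proof (rule borel_measurable_LIMSEQ_metric)
    show "(\<lambda>x. H x (s i x)) \<in> borel_measurable N" for i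
    proof (rule measurable_compose_countable'[where f="\<lambda>c x. H x c" and g="s i" and I="s i ` space N"])
      have f: "finite (s i ` space N)" "\<And>c. c \<in> s i ` space N \<Longrightarrow> s i -` {c} \<inter> space N \<in> sets N"
        using s(1)[of i] by (auto simp: simple_function_def)
      then show "s i \<in> measurable N (count_space (s i ` space N))"
        by (subst measurable_count_space_eq_countable) (auto intro: countable_finite)
      show "countable (s i ` space N)" using f(1) by (rule countable_finite)
    qed (rule m)
    show "(\<lambda>i. H x (s i x)) \<longlonglongrightarrow> H x (p x)" if "x \<in> space N" for x
      using continuous_on_tendsto_compose[OF c[OF that] s(2)[OF that]] by simp
  qed
qed

lemma regular_N_measurable:
  assumes O: "open \<Omega>" and reg: "regular_N \<Omega> M" and g: "g \<in> borel_measurable (lebesgue_on \<Omega>)"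
  shows "(\<lambda>x. M x (g x)) \<in> borel_measurable (lebesgue_on \<Omega>)"
proof (rule caratheodory_measurable[OF _ _ g])
  note c = regular_N_continuous[OF reg]
  have "\<Omega> \<in> sets lebesgue" using O by auto
  then show "(\<lambda>x. M x \<xi>) \<in> borel_measurable (lebesgue_on \<Omega>)" for \<xi>
    by (rule continuous_imp_measurable_on_sets_lebesgue[OF continuous_on_slice[OF c]])
  show "continuous_on UNIV (M x)" if "x \<in> space (lebesgue_on \<Omega>)" for x
  proof -
    have "continuous_on UNIV (\<lambda>\<xi>. (x, \<xi>))"
      by (intro continuous_on_Pair continuous_on_id continuous_on_const)
    from continuous_on_compose2[OF c this] that show ?thesis
      by (auto simp: space_restrict_space)
  qed
qed

text \<open>
  Because of \<open>Delta2\<close>, the functions all of whose multiples have finite modular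
  form a linear space that already contains the generators of \<open>L_M\<close>. So membership
  in the linear hull gives integrability with every factor \<open>A\<close>, and the loss of
  constants in convexity estimates is harmless.
\<close>

lemma L_M_modular:
  fixes M :: "'a::euclidean_space \<Rightarrow> 'b::euclidean_space \<Rightarrow> real"
  assumes O: "open \<Omega>" "bounded \<Omega>" and reg: "regular_N \<Omega> M" and D: "Delta2 \<Omega> M" and g: "g \<in> L_M \<Omega> M"
  shows "g \<in> borel_measurable (lebesgue_on \<Omega>)" "integrable (lebesgue_on \<Omega>) (\<lambda>x. M x (A *\<^sub>R g x))"
proof -
  let ?N = "lebesgue_on \<Omega>"
  define V where "V = {g \<in> borel_measurable ?N. \<forall>A. integrable ?N (\<lambda>x. M x (A *\<^sub>R g x))}"
  have sp: "AE x in ?N. x \<in> \<Omega>"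
    using AE_space[of ?N] by (simp add: space_restrict_space)
  have dom: "integrable ?N (\<lambda>x. M x (f x))"
    if "integrable ?N b" "f \<in> borel_measurable ?N" "AE x in ?N. M x (f x) \<le> b x" for f b
  proof (rule Bochner_Integration.integrable_bound[OF that(1)])
    show "(\<lambda>x. M x (f x)) \<in> borel_measurable ?N" by (rule regular_N_measurable[OF O(1) reg that(2)])
    show "AE x in ?N. norm (M x (f x)) \<le> norm (b x)"
      using that(3) sp by eventually_elim (use regular_N_nonneg[OF reg] in force)
  qed
  have sub: "{\<xi> \<in> borel_measurable ?N. (\<integral>\<^sup>+x. ennreal (M x (\<xi> x)) \<partial>?N) < \<infinity>} \<subseteq> V"
  proof
    fix f assume f: "f \<in> {\<xi> \<in> borel_measurable ?N. (\<integral>\<^sup>+x. ennreal (M x (\<xi> x)) \<partial>?N) < \<infinity>}"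
    then have [measurable]: "f \<in> borel_measurable ?N" by simp
    have i: "integrable ?N (\<lambda>x. M x (f x))"
      unfolding integrable_iff_bounded
    proof
      show "(\<lambda>x. M x (f x)) \<in> borel_measurable ?N" by (rule regular_N_measurable[OF O(1) reg]) simp
      have "(\<integral>\<^sup>+x. norm (M x (f x)) \<partial>?N) = (\<integral>\<^sup>+x. ennreal (M x (f x)) \<partial>?N)"
        by (rule nn_integral_cong) (simp add: space_restrict_space regular_N_nonneg[OF reg])
      then show "(\<integral>\<^sup>+x. norm (M x (f x)) \<partial>?N) < \<infinity>" using f by simp
    qed
    have "integrable ?N (\<lambda>x. M x (A *\<^sub>R f x))" for A
    proof -
      obtain c h where "integrable ?N h" "AE x in ?N. \<forall>\<xi>. M x (A *\<^sub>R \<xi>) \<le> c * M x \<xi> + h x"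
        using Delta2_scale[OF O reg D, of A] by blast
      then show ?thesis
        using i by (intro dom[of "\<lambda>x. c * M x (f x) + h x"]) (auto elim!: eventually_mono)
    qed
    then show "f \<in> V" by (simp add: V_def)
  qed
  have lin: "linear_fun_space V"
    unfolding linear_fun_space_def
  proof (intro conjI ballI allI)
    show "(\<lambda>x. 0) \<in> V"
      unfolding V_def
    proof (intro CollectI conjI allI)
      show "integrable ?N (\<lambda>x. M x (A *\<^sub>R 0))" for A
        by (rule dom[of "\<lambda>_. 0"]) (use sp regular_N_zero[OF reg] in \<open>auto elim!: eventually_mono\<close>)
    qed simp
    fix f assume f: "f \<in> V"
    then show "(\<lambda>x. c *\<^sub>R f x) \<in> V" for c
      unfolding V_def by (auto intro: borel_measurable_scaleR[OF borel_measurable_const])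
    fix h assume h: "h \<in> V"
    show "(\<lambda>x. f x + h x) \<in> V"
      unfolding V_def
    proof (intro CollectI conjI allI)
      show "(\<lambda>x. f x + h x) \<in> borel_measurable ?N" using f h unfolding V_def by (auto intro: borel_measurable_add)
      show "integrable ?N (\<lambda>x. M x (A *\<^sub>R (f x + h x)))" for A
      proof (rule dom[of "\<lambda>x. M x ((2 * A) *\<^sub>R f x) + M x ((2 * A) *\<^sub>R h x)"])
        show "integrable ?N (\<lambda>x. M x ((2 * A) *\<^sub>R f x) + M x ((2 * A) *\<^sub>R h x))"
          using f h unfolding V_def by (intro Bochner_Integration.integrable_add) blast+
        show "(\<lambda>x. A *\<^sub>R (f x + h x)) \<in> borel_measurable ?N" using f h unfolding V_def
          by (intro borel_measurable_scaleR[OF borel_measurable_const] borel_measurable_add) auto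
        show "AE x in ?N. M x (A *\<^sub>R (f x + h x)) \<le> M x ((2 * A) *\<^sub>R f x) + M x ((2 * A) *\<^sub>R h x)"
          using sp
        proof eventually_elim
          case (elim x)
          show ?case using regular_N_add[OF reg elim, of "A *\<^sub>R f x" "A *\<^sub>R h x"] by (simp add: scaleR_add_right)
        qed
      qed
    qed
  qed
  have "g \<in> V"
    using hull_minimal[of _ V linear_fun_space, OF sub lin] g unfolding L_M_def by blast
  then show "g \<in> borel_measurable ?N" "integrable ?N (\<lambda>x. M x (A *\<^sub>R g x))"
    by (auto simp: V_def)
qed

lemma test_functions_V1_0_L:
  assumes O: "open \<Omega>" "bounded \<Omega>" and reg: "regular_N \<Omega> M" and t: "\<phi> \<in> test_functions \<Omega>"
  shows "\<phi> \<in> V1_0_L \<Omega> M"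
proof -
  have t': "\<phi> \<in> test_functions UNIV" using t test_functions_mono by blast
  note w = has_weak_gradient_test[OF O(1) t']
  have m: "weak_gradient \<Omega> \<phi> \<in> borel_measurable (lebesgue_on \<Omega>)"
    using has_weak_gradient_weak_gradient[OF w] unfolding has_weak_gradient_def
    by (blast intro: locally_integrable_measurable[OF O(1)])
  obtain R where R: "\<And>x. norm (grad \<phi> x) \<le> R" using test_functions_bounded[OF t] by metis
  obtain B where B: "B \<ge> 0" "\<And>x \<xi>. x \<in> \<Omega> \<Longrightarrow> norm \<xi> \<le> R \<Longrightarrow> M x \<xi> \<le> B"
    using regular_N_bounded[OF reg, of R] by blast
  have sp: "AE x in lebesgue_on \<Omega>. x \<in> \<Omega>"
    using AE_space[of "lebesgue_on \<Omega>"] by (simp add: space_restrict_space)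
  have "(\<integral>\<^sup>+x. ennreal (M x (weak_gradient \<Omega> \<phi> x)) \<partial>lebesgue_on \<Omega>) \<le> (\<integral>\<^sup>+x. ennreal B \<partial>lebesgue_on \<Omega>)"
  proof (rule nn_integral_mono_AE)
    show "AE x in lebesgue_on \<Omega>. ennreal (M x (weak_gradient \<Omega> \<phi> x)) \<le> ennreal B"
      using weak_gradient_AE[OF O(1) w] sp by eventually_elim (simp add: B(2) R ennreal_leI)
  qed
  also have "\<dots> < \<infinity>"
    using integrable_const_bounded[OF O, of B] B(1) unfolding integrable_iff_bounded by simp
  finally have "weak_gradient \<Omega> \<phi> \<in> L_M \<Omega> M"
    unfolding L_M_def using m by (intro hull_inc) simp
  then show ?thesis
    unfolding V1_0_L_def using test_functions_W11_0[OF O(1) t] by simp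
qed

subsection \<open>A Jensen-type condition\<close>

text \<open>
  A substitute for Jensen's inequality in the presence of \<open>x\<close>-dependence. The
  infimum of the functions \<open>M y\<close> over a ball is in general not convex, so Jensen's
  inequality does not apply to it. To bound \<open>M x\<close> at an average of vectors it
  suffices, however, to have one affine function that supports \<open>M x\<close> at that
  average and stays below all \<open>M y\<close> up to the constants \<open>C\<close> and
  \<open>N\<close>. The vector \<open>a\<close> may depend on \<open>x\<close>, \<open>r\<close>
  and \<open>\<xi>\<close> but not on \<open>y\<close> and \<open>\<eta>\<close>.
\<close>

definition jensen_condition :: "real \<Rightarrow> 'a::euclidean_space set \<Rightarrow> ('a \<Rightarrow> 'a \<Rightarrow> real) \<Rightarrow> bool" where
  "jensen_condition \<gamma> \<Omega> M \<longleftrightarrow>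
     (\<exists>c>0. \<exists>C N. \<forall>x\<in>\<Omega>. \<forall>r \<xi>. 0 < r \<and> r \<le> 1 \<and> norm \<xi> \<le> c * r powr (\<gamma> - 1) \<longrightarrow>
        (\<exists>a. \<forall>y\<in>\<Omega> \<inter> ball x r. \<forall>\<eta>. M x \<xi> + a \<bullet> (\<eta> - \<xi>) \<le> M y (C *\<^sub>R \<eta>) + N))"

text \<open>
  For \<open>\<gamma> = 1\<close> only bounded \<open>\<xi>\<close> occur, where \<open>M x
  \<xi>\<close> is below a constant; the slope \<open>0\<close> works.
\<close>

lemma jensen_condition_1:
  fixes M :: "'a::euclidean_space \<Rightarrow> 'a \<Rightarrow> real"
  assumes reg: "regular_N \<Omega> M"
  shows "jensen_condition 1 \<Omega> M"
proof -
  obtain B where B: "\<forall>x\<in>\<Omega>. \<forall>\<xi>. norm \<xi> \<le> 1 \<longrightarrow> M x \<xi> \<le> B"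
    using regular_N_bounded[OF reg, of 1] by blast
  have "\<forall>x\<in>\<Omega>. \<forall>r \<xi>. 0 < r \<and> r \<le> 1 \<and> norm \<xi> \<le> 1 * r powr (1 - 1) \<longrightarrow>
        (\<exists>a. \<forall>y\<in>\<Omega> \<inter> ball x r. \<forall>\<eta>. M x \<xi> + a \<bullet> (\<eta> - \<xi>) \<le> M y (1 *\<^sub>R \<eta>) + B)"
  proof (intro ballI allI impI)
    fix x r and \<xi> :: 'a assume x: "x \<in> \<Omega>" and r: "0 < r \<and> r \<le> 1 \<and> norm \<xi> \<le> 1 * r powr (1 - 1)"
    have "norm \<xi> \<le> 1" using r by (auto split: if_splits)
    then have "M x \<xi> \<le> B" using B x by blast
    then have "M x \<xi> + 0 \<bullet> (\<eta> - \<xi>) \<le> M y (1 *\<^sub>R \<eta>) + B" if "y \<in> \<Omega>" for y \<eta>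
      using regular_N_nonneg[OF reg that, of \<eta>] by simp
    then show "\<exists>a. \<forall>y\<in>\<Omega> \<inter> ball x r. \<forall>\<eta>. M x \<xi> + a \<bullet> (\<eta> - \<xi>) \<le> M y (1 *\<^sub>R \<eta>) + B"
      by (intro exI[of _ "0 :: 'a"]) simp
  qed
  then show ?thesis
    unfolding jensen_condition_def using zero_less_one by blast
qed

text \<open>
  Along a ray \<open>f\<close> grows at least linearly, since \<open>f (t *\<^sub>R \<zeta>)
  \<le> t * f \<zeta>\<close> for \<open>t \<le> 1\<close>. So beyond \<open>C *\<^sub>R
  \<xi>\<close>, where it is at least \<open>v - 1\<close>, the radial function \<open>f\<close>
  lies above a cone. The factor \<open>2\<close> in the slope makes the affine function fall to
  \<open>1\<close> or less for \<open>norm \<eta> \<le> norm \<xi> / 2\<close>, where no lower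
  bound except \<open>0\<close> is available; the same factor reappears in \<open>2 * C\<close>.
\<close>

lemma radial_affine_minorant:
  fixes f :: "'v::real_inner \<Rightarrow> real"
  assumes radial: "\<And>\<zeta> \<zeta>'. norm \<zeta> = norm \<zeta>' \<Longrightarrow> f \<zeta> = f \<zeta>'" and nn: "\<And>\<zeta>. 0 \<le> f \<zeta>"
    and scale: "\<And>t \<zeta>. 0 \<le> t \<Longrightarrow> t \<le> 1 \<Longrightarrow> f (t *\<^sub>R \<zeta>) \<le> t * f \<zeta>"
    and v: "v \<le> f (C *\<^sub>R \<xi>) + 1" "\<xi> = 0 \<Longrightarrow> v \<le> 1" and C: "C \<ge> 0"
  shows "v + (if v \<le> 1 then 0 else (2 * (v - 1) / (norm \<xi>)\<^sup>2) *\<^sub>R \<xi>) \<bullet> (\<eta> - \<xi>) \<le> f ((2 * C) *\<^sub>R \<eta>) + 1"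
proof (cases "v \<le> 1")
  case True
  then show ?thesis using nn[of "(2 * C) *\<^sub>R \<eta>"] by simp
next
  case False
  then have x0: "\<xi> \<noteq> 0" using v(2) by auto
  then have n: "norm \<xi> > 0" by simp
  \<comment> \<open>The vectors \<open>s *\<^sub>R C *\<^sub>R \<xi>\<close> and \<open>(2 * C)
    *\<^sub>R \<eta>\<close> have the same norm.\<close>
  define s where "s = 2 * norm \<eta> / norm \<xi>"
  have "\<xi> \<bullet> \<eta> \<le> norm \<xi> * norm \<eta>" by (rule norm_cauchy_schwarz)
  then have "2 * (\<xi> \<bullet> \<eta>) / (norm \<xi>)\<^sup>2 \<le> 2 * (norm \<xi> * norm \<eta>) / (norm \<xi>)\<^sup>2"
    by (intro divide_right_mono) auto
  also have "\<dots> = s" using n by (simp add: s_def power2_eq_square)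
  finally have s1: "2 * (\<xi> \<bullet> \<eta>) / (norm \<xi>)\<^sup>2 \<le> s" .
  have "((2 * (v - 1) / (norm \<xi>)\<^sup>2) *\<^sub>R \<xi>) \<bullet> (\<eta> - \<xi>) = (v - 1) * (2 * (\<xi> \<bullet> \<eta>) / (norm \<xi>)\<^sup>2 - 2)"
  proof -
    have K: "(norm \<xi>)\<^sup>2 \<noteq> 0" using n by simp
    have alg: "(2 * (v - 1) / K) * (p - K) = (v - 1) * (2 * p / K - 2)" if "K \<noteq> 0" for K p :: real
      using that by (simp add: field_simps)
    have "((2 * (v - 1) / (norm \<xi>)\<^sup>2) *\<^sub>R \<xi>) \<bullet> (\<eta> - \<xi>) = (2 * (v - 1) / (norm \<xi>)\<^sup>2) * (\<xi> \<bullet> \<eta> - (norm \<xi>)\<^sup>2)"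
      by (simp only: inner_scaleR_left inner_diff_right power2_norm_eq_inner right_diff_distrib)
    also have "\<dots> = (v - 1) * (2 * (\<xi> \<bullet> \<eta>) / (norm \<xi>)\<^sup>2 - 2)"
      using alg[OF K] .
    finally show ?thesis .
  qed
  also have "\<dots> \<le> (v - 1) * (s - 2)"
    using s1 False by (intro mult_left_mono) auto
  finally have lhs: "v + ((2 * (v - 1) / (norm \<xi>)\<^sup>2) *\<^sub>R \<xi>) \<bullet> (\<eta> - \<xi>) \<le> 1 + (v - 1) * (s - 1)"
    by (simp add: algebra_simps)
  have "(v - 1) * (s - 1) \<le> f ((2 * C) *\<^sub>R \<eta>)"
  proof (cases "s \<le> 1")
    case True
    then have "(v - 1) * (s - 1) \<le> 0" using False by (intro mult_nonneg_nonpos) auto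
    then show ?thesis using nn order_trans by blast
  next
    case s: False
    have "f ((1 / s) *\<^sub>R (s *\<^sub>R (C *\<^sub>R \<xi>))) \<le> (1 / s) * f (s *\<^sub>R (C *\<^sub>R \<xi>))"
      using s by (intro scale) auto
    then have "s * f (C *\<^sub>R \<xi>) \<le> f (s *\<^sub>R (C *\<^sub>R \<xi>))" using s by (simp add: field_simps)
    also have "\<dots> = f ((2 * C) *\<^sub>R \<eta>)"
      by (rule radial) (use n s C in \<open>simp add: s_def\<close>)
    finally have "s * f (C *\<^sub>R \<xi>) \<le> f ((2 * C) *\<^sub>R \<eta>)" .
    moreover have "(v - 1) * (s - 1) \<le> (v - 1) * s" using False by (intro mult_left_mono) auto
    moreover have "(v - 1) * s \<le> f (C *\<^sub>R \<xi>) * s" using v(1) s by (intro mult_right_mono) auto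
    ultimately show ?thesis by (simp add: mult.commute)
  qed
  with lhs show ?thesis using False by simp
qed

text \<open>
  The essential bounds in \<open>B_iso\<close> are first turned into the pointwise comparison
  \<open>M x \<xi> \<le> M y (C *\<^sub>R \<xi>) + 1\<close>, which is the hypothesis of the
  radial lemma for \<open>f = M y\<close>.
\<close>

lemma jensen_condition_iso:
  fixes M :: "'a::euclidean_space \<Rightarrow> 'a \<Rightarrow> real"
  assumes O: "open \<Omega>" and reg: "regular_N \<Omega> M" and B: "B_iso \<gamma> \<Omega> M"
  shows "jensen_condition \<gamma> \<Omega> M"
proof -
  obtain m c C where m: "\<And>x \<xi>. x \<in> \<Omega> \<Longrightarrow> M x \<xi> = m x (norm \<xi>)" and c: "c \<ge> 1" and C: "C \<ge> 1"
    and le: "\<And>p r \<xi>. 0 < r \<Longrightarrow> r \<le> 1 \<Longrightarrow> norm (\<xi>::'a) \<le> c * r powr (\<gamma> - 1) \<Longrightarrow>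
          N_plus \<Omega> m (ball p r) (norm \<xi>) \<le> N_minus \<Omega> m (ball p r) (C * norm \<xi>) + 1"
    using B unfolding B_iso_def by blast
  note cs = continuous_on_slice[OF regular_N_continuous[OF reg]]
  have pt: "M x \<xi> \<le> M y (C *\<^sub>R \<xi>) + 1"
    if x: "x \<in> \<Omega>" and r: "0 < r" "r \<le> 1" "norm \<xi> \<le> c * r powr (\<gamma> - 1)" and y: "y \<in> \<Omega> \<inter> ball x r" for x y r \<xi>
  proof (rule esssup_essinf_pointwise[where U="ball x r \<inter> \<Omega>" and a="\<lambda>z. m z (norm \<xi>)" and b="\<lambda>z. m z (C * norm \<xi>)"
        and a'="\<lambda>z. M z \<xi>" and b'="\<lambda>z. M z (C *\<^sub>R \<xi>)"])
    show "open (ball x r \<inter> \<Omega>)" using O by auto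
    show "continuous_on (ball x r \<inter> \<Omega>) (\<lambda>z. M z \<xi>)" "continuous_on (ball x r \<inter> \<Omega>) (\<lambda>z. M z (C *\<^sub>R \<xi>))"
      by (rule continuous_on_subset[OF cs], simp)+
    have sp: "AE z in lebesgue_on (ball x r \<inter> \<Omega>). z \<in> \<Omega>"
      using AE_space[of "lebesgue_on (ball x r \<inter> \<Omega>)"] by (rule eventually_mono) (simp add: space_restrict_space)
    show "AE z in lebesgue_on (ball x r \<inter> \<Omega>). m z (norm \<xi>) = M z \<xi>"
      using sp by (rule eventually_mono) (simp add: m)
    show "AE z in lebesgue_on (ball x r \<inter> \<Omega>). m z (C * norm \<xi>) = M z (C *\<^sub>R \<xi>)"
      using sp by (rule eventually_mono) (use C in \<open>simp add: m\<close>)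
    show "esssup (lebesgue_on (ball x r \<inter> \<Omega>)) (\<lambda>z. ereal (m z (norm \<xi>)))
        \<le> essinf (lebesgue_on (ball x r \<inter> \<Omega>)) (\<lambda>z. ereal (m z (C * norm \<xi>))) + 1"
      using le[OF r, of x] by (simp add: N_plus_def N_minus_def)
  qed (use x y r in auto)
  have c0: "c > 0" using c by simp
  show ?thesis
    unfolding jensen_condition_def
  proof (rule exI[of _ c], rule conjI[OF c0], rule exI[of _ "2 * C"], rule exI[of _ 1], intro ballI allI impI)
    fix x r and \<xi> :: 'a assume x: "x \<in> \<Omega>" and r: "0 < r \<and> r \<le> 1 \<and> norm \<xi> \<le> c * r powr (\<gamma> - 1)"
    let ?a = "if M x \<xi> \<le> 1 then 0 else (2 * (M x \<xi> - 1) / (norm \<xi>)\<^sup>2) *\<^sub>R \<xi>"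
    show "\<exists>a. \<forall>y\<in>\<Omega> \<inter> ball x r. \<forall>\<eta>. M x \<xi> + a \<bullet> (\<eta> - \<xi>) \<le> M y ((2 * C) *\<^sub>R \<eta>) + 1"
    proof (intro exI[of _ ?a] ballI allI)
      fix y \<eta> assume y: "y \<in> \<Omega> \<inter> ball x r"
      show "M x \<xi> + ?a \<bullet> (\<eta> - \<xi>) \<le> M y ((2 * C) *\<^sub>R \<eta>) + 1"
      proof (rule radial_affine_minorant)
        show "M y \<zeta> = M y \<zeta>'" if "norm \<zeta> = norm \<zeta>'" for \<zeta> \<zeta>' using y that by (simp add: m)
        show "0 \<le> M y \<zeta>" for \<zeta> using y regular_N_nonneg[OF reg] by simp
        show "M y (t *\<^sub>R \<zeta>) \<le> t * M y \<zeta>" if "0 \<le> t" "t \<le> 1" for t \<zeta>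
          using regular_N_scale[OF reg, of y t \<zeta>] y that by simp
        show "M x \<xi> \<le> M y (C *\<^sub>R \<xi>) + 1" by (rule pt[OF x _ _ _ y]) (use r in auto)
        show "M x \<xi> \<le> 1" if "\<xi> = 0" using that regular_N_zero[OF reg x] by simp
        show "C \<ge> 0" using C by simp
      qed
    qed
  qed
qed

text \<open>
  The one-dimensional functions of a single coordinate are even, hence radial, so the radial
  lemma applies to each of them; the affine minorants add up, and so do the error terms
  \<open>1\<close>. The continuous function \<open>M x (axis i t)\<close> takes the place of the
  profile \<open>m i x \<bar>t\<bar>\<close>.
\<close>

lemma jensen_condition_ort:
  fixes M :: "real^'n \<Rightarrow> real^'n \<Rightarrow> real"
  assumes O: "open \<Omega>" and reg: "regular_N \<Omega> M" and B: "B_ort \<gamma> \<Omega> M"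
  shows "jensen_condition \<gamma> \<Omega> M"
proof -
  obtain m c C where rad: "\<And>i. weak_N_function_radial \<Omega> (m i)"
    and m: "\<And>x \<xi>. x \<in> \<Omega> \<Longrightarrow> M x \<xi> = (\<Sum>i\<in>UNIV. m i x \<bar>\<xi> $ i\<bar>)" and c: "c \<ge> 1" and C: "C \<ge> 1"
    and le: "\<And>p r i t. 0 < r \<Longrightarrow> r \<le> 1 \<Longrightarrow> \<bar>t::real\<bar> \<le> c * r powr (\<gamma> - 1) \<Longrightarrow>
          N_plus \<Omega> (m i) (ball p r) \<bar>t\<bar> \<le> N_minus \<Omega> (m i) (ball p r) (C * \<bar>t\<bar>) + 1"
    using B unfolding B_ort_def by blast
  note cs = continuous_on_slice[OF regular_N_continuous[OF reg]]
  have O': "\<Omega> \<inter> space lebesgue \<in> sets lebesgue" using O by auto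
  have "AE x in lebesgue_on \<Omega>. m i x \<bar>0\<bar> = 0" for i
  proof -
    have "AE x in lebesgue_on \<Omega>. m i x \<bar>0\<bar> = 0 \<and> convex_on UNIV (\<lambda>t. m i x \<bar>t\<bar>)"
      using rad[of i] unfolding weak_N_function_radial_def weak_N_function_def by blast
    then show ?thesis by (rule eventually_mono) simp
  qed
  then have ae0: "AE x in lebesgue_on \<Omega>. \<forall>i\<in>UNIV. m i x 0 = 0"
    by (intro AE_finite_allI) auto
  have sp: "AE x in lebesgue_on \<Omega>. x \<in> \<Omega>"
    using AE_space[of "lebesgue_on \<Omega>"] by (simp add: space_restrict_space)
  have axis: "AE x in lebesgue_on \<Omega>. \<forall>i t. m i x \<bar>t\<bar> = M x (axis i t)"
    using ae0 sp
  proof eventually_elim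
    case (elim x)
    show ?case
    proof (intro allI)
      fix i :: 'n and t :: real
      have "M x (axis i t) = (\<Sum>j\<in>UNIV. if j = i then m i x \<bar>t\<bar> else 0)"
        unfolding m[OF elim(2)] using elim(1) by (intro sum.cong) (auto simp: axis_def)
      then show "m i x \<bar>t\<bar> = M x (axis i t)" by simp
    qed
  qed
  have sum: "M x \<xi> = (\<Sum>i\<in>UNIV. M x (axis i (\<xi> $ i)))" if x: "x \<in> \<Omega>" for x \<xi>
  proof (rule antisym)
    have c': "continuous_on \<Omega> (\<lambda>x. \<Sum>i\<in>UNIV. M x (axis i (\<xi> $ i)))" by (intro continuous_on_sum cs)
    have ae: "AE x in lebesgue_on \<Omega>. M x \<xi> = (\<Sum>i\<in>UNIV. M x (axis i (\<xi> $ i)))"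
      using axis sp
    proof eventually_elim
      case (elim x)
      show ?case unfolding m[OF elim(2), of \<xi>] using elim(1) by (intro sum.cong) auto
    qed
    show "M x \<xi> \<le> (\<Sum>i\<in>UNIV. M x (axis i (\<xi> $ i)))"
      by (rule AE_continuous_le[OF O cs c' _ x]) (rule eventually_mono[OF ae], auto)
    show "(\<Sum>i\<in>UNIV. M x (axis i (\<xi> $ i))) \<le> M x \<xi>"
      by (rule AE_continuous_le[OF O c' cs _ x]) (rule eventually_mono[OF ae], auto)
  qed
  have pt: "M x (axis i t) \<le> M y (axis i (C * t)) + 1"
    if x: "x \<in> \<Omega>" and r: "0 < r" "r \<le> 1" "\<bar>t\<bar> \<le> c * r powr (\<gamma> - 1)" and y: "y \<in> \<Omega> \<inter> ball x r" for x y r i t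
  proof (rule esssup_essinf_pointwise[where U="ball x r \<inter> \<Omega>" and a="\<lambda>z. m i z \<bar>t\<bar>" and b="\<lambda>z. m i z (C * \<bar>t\<bar>)"
        and a'="\<lambda>z. M z (axis i t)" and b'="\<lambda>z. M z (axis i (C * t))"])
    show "open (ball x r \<inter> \<Omega>)" using O by auto
    then have U: "ball x r \<inter> \<Omega> \<inter> space lebesgue \<in> sets lebesgue" by auto
    show "continuous_on (ball x r \<inter> \<Omega>) (\<lambda>z. M z (axis i t))" "continuous_on (ball x r \<inter> \<Omega>) (\<lambda>z. M z (axis i (C * t)))"
      by (rule continuous_on_subset[OF cs], simp)+
    have ax: "AE z in lebesgue_on (ball x r \<inter> \<Omega>). \<forall>i t. m i z \<bar>t\<bar> = M z (axis i t)"
      using axis unfolding AE_restrict_space_iff[OF O'] AE_restrict_space_iff[OF U] by (rule eventually_mono) blast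
    show "AE z in lebesgue_on (ball x r \<inter> \<Omega>). m i z \<bar>t\<bar> = M z (axis i t)"
      using ax by (rule eventually_mono) blast
    have "C * \<bar>t\<bar> = \<bar>C * t\<bar>" using C by (simp add: abs_mult)
    then show "AE z in lebesgue_on (ball x r \<inter> \<Omega>). m i z (C * \<bar>t\<bar>) = M z (axis i (C * t))"
      using ax by (elim eventually_mono) metis
    show "esssup (lebesgue_on (ball x r \<inter> \<Omega>)) (\<lambda>z. ereal (m i z \<bar>t\<bar>))
        \<le> essinf (lebesgue_on (ball x r \<inter> \<Omega>)) (\<lambda>z. ereal (m i z (C * \<bar>t\<bar>))) + 1"
      using le[OF r, of i x] by (simp add: N_plus_def N_minus_def)
  qed (use x y r in auto)
  have axis_scale: "axis i (s * t) = s *\<^sub>R (axis i t :: real^'n)" for i s t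
    by (simp add: vec_eq_iff axis_def)
  have c0: "c > 0" using c by simp
  show ?thesis
    unfolding jensen_condition_def
  proof (rule exI[of _ c], rule conjI[OF c0], rule exI[of _ "2 * C"], rule exI[of _ "real CARD('n)"], intro ballI allI impI)
    fix x r and \<xi> :: "real^'n" assume x: "x \<in> \<Omega>" and r: "0 < r \<and> r \<le> 1 \<and> norm \<xi> \<le> c * r powr (\<gamma> - 1)"
    let ?v = "\<lambda>i. M x (axis i (\<xi> $ i))"
    let ?a = "\<lambda>i. if ?v i \<le> 1 then 0 else (2 * (?v i - 1) / (norm (\<xi> $ i))\<^sup>2) *\<^sub>R (\<xi> $ i)"
    show "\<exists>a. \<forall>y\<in>\<Omega> \<inter> ball x r. \<forall>\<eta>. M x \<xi> + a \<bullet> (\<eta> - \<xi>) \<le> M y ((2 * C) *\<^sub>R \<eta>) + real CARD('n)"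
    proof (intro exI[of _ "\<chi> i. ?a i"] ballI allI)
      fix y \<eta> assume y: "y \<in> \<Omega> \<inter> ball x r"
      then have y': "y \<in> \<Omega>" by simp
      have comp: "?v i + ?a i \<bullet> (\<eta> $ i - \<xi> $ i) \<le> M y (axis i ((2 * C) *\<^sub>R \<eta> $ i)) + 1" for i
      proof (rule radial_affine_minorant[where f="\<lambda>t. M y (axis i t)"])
        show "M y (axis i s) = M y (axis i t)" if "norm s = norm t" for s t
        proof -
          have "s = t \<or> s = - 1 * t" using that by auto
          then show ?thesis
            using regular_N_even[OF reg y', of "axis i t"] axis_scale[of i "-1" t] by auto
        qed
        show "0 \<le> M y (axis i t)" for t using y' regular_N_nonneg[OF reg] by simp
        show "M y (axis i (s *\<^sub>R t)) \<le> s * M y (axis i t)" if "0 \<le> s" "s \<le> 1" for s t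
          using regular_N_scale[OF reg y', of s "axis i t"] that by (simp add: axis_scale)
        have "\<bar>\<xi> $ i\<bar> \<le> c * r powr (\<gamma> - 1)" using component_le_norm_cart[of \<xi> i] r by linarith
        then show "?v i \<le> M y (axis i (C *\<^sub>R \<xi> $ i)) + 1"
          using pt[OF x _ _ _ y, of "\<xi> $ i" i] r by simp
        show "?v i \<le> 1" if "\<xi> $ i = 0"
        proof -
          have "axis i (0::real) = (0::real^'n)" by (simp add: vec_eq_iff axis_def)
          then show ?thesis unfolding that using regular_N_zero[OF reg x] by (simp only: zero_le_one)
        qed
        show "C \<ge> 0" using C by simp
      qed
      have "M x \<xi> + (\<chi> i. ?a i) \<bullet> (\<eta> - \<xi>) = (\<Sum>i\<in>UNIV. ?v i + ?a i \<bullet> (\<eta> $ i - \<xi> $ i))"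
        unfolding sum[OF x, of \<xi>] by (simp add: inner_vec_def sum.distrib)
      also have "\<dots> \<le> (\<Sum>i\<in>UNIV. M y (axis i ((2 * C) *\<^sub>R \<eta> $ i)) + 1)"
        by (rule sum_mono) (rule comp)
      also have "\<dots> = M y ((2 * C) *\<^sub>R \<eta>) + real CARD('n)"
        unfolding sum[OF y', of "(2 * C) *\<^sub>R \<eta>"] by (simp add: sum.distrib)
      finally show "M x \<xi> + (\<chi> i. ?a i) \<bullet> (\<eta> - \<xi>) \<le> M y ((2 * C) *\<^sub>R \<eta>) + real CARD('n)" .
    qed
  qed
qed

section \<open>Modular approximation by test functions\<close>

text \<open>
  The dominating functions \<open>Q k\<close> are allowed to vary as long as they converge in
  \<open>L^1\<close>, because mollification produces mollified dominating functions. The factor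
  \<open>1 / lam\<close> leaves room to shrink the gradients into the range of
  \<open>jensen_condition\<close> and to add approximations.
\<close>

definition modular_approx ::
    "'a::euclidean_space set \<Rightarrow> ('a \<Rightarrow> 'a \<Rightarrow> real) \<Rightarrow> ('a \<Rightarrow> real) \<Rightarrow> ('a \<Rightarrow> 'a) \<Rightarrow> bool" where
  "modular_approx \<Omega> M w G \<longleftrightarrow> integrable lborel w \<and> integrable lborel G \<and>
     (\<exists>\<phi> Q P lam. (\<forall>k::nat. \<phi> k \<in> test_functions \<Omega>) \<and>
       (\<lambda>k. \<integral>x. \<bar>\<phi> k x - w x\<bar> \<partial>lborel) \<longlonglongrightarrow> 0 \<and> (\<lambda>k. \<integral>x. norm (grad (\<phi> k) x - G x) \<partial>lborel) \<longlonglongrightarrow> 0 \<and>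
       integrable lborel P \<and> (\<forall>k. integrable lborel (Q k)) \<and> (\<lambda>k. \<integral>x. \<bar>Q k x - P x\<bar> \<partial>lborel) \<longlonglongrightarrow> 0 \<and>
       0 < lam \<and> (\<forall>k. \<forall>x\<in>\<Omega>. M x ((1 / lam) *\<^sub>R grad (\<phi> k) x) \<le> Q k x))"

lemma grad_eq_0_outside:
  assumes "closed S" "\<And>x. x \<notin> S \<Longrightarrow> \<phi> x = 0" "x \<notin> S"
  shows "grad \<phi> x = 0"
proof (rule grad_unique)
  have "open (- S)" using assms(1) by (rule open_Compl)
  moreover have "x \<in> - S" using assms(3) by simp
  moreover have "0 = \<phi> y" if "y \<in> - S" for y using assms(2)[of y] that by simp
  ultimately show "(\<phi> has_derivative (\<lambda>_. 0)) (at x)"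
    by (rule has_derivative_transform_within_open[OF has_derivative_const])
qed simp

lemma integral_grad_test:
  assumes t: "k \<in> test_functions UNIV"
  shows "(\<integral>x. grad k x \<partial>lborel) = 0"
proof (rule euclidean_eqI)
  fix i :: 'a assume i: "i \<in> Basis"
  have "(\<integral>x. grad k x \<partial>lborel) \<bullet> i = (\<integral>x. grad k x \<bullet> i \<partial>lborel)"
    by (rule integral_inner_left[symmetric]) (rule test_functions_integrable(2)[OF t])
  also have "\<dots> = 0" using integral_partial_derivative[OF t i] i by simp
  finally show "(\<integral>x. grad k x \<partial>lborel) \<bullet> i = 0 \<bullet> i" by simp
qed

text \<open>
  The gradient of the kernel has mean zero, so the value \<open>w x\<close> can be subtracted
  from \<open>w\<close> under the convolution, and only increments of \<open>w\<close> over
  distances at most \<open>\<delta>\<close> contribute.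
\<close>

lemma grad_conv_holder_bound:
  fixes w :: "'a::euclidean_space \<Rightarrow> real"
  assumes k: "mollifier \<delta> k" and d: "\<delta> > 0" and w: "integrable lborel w"
    and H: "\<And>x y. x \<noteq> y \<Longrightarrow> \<bar>w x - w y\<bar> \<le> H * norm (x - y) powr \<gamma>" "H \<ge> 0" "\<gamma> \<ge> 0"
  shows "norm (grad (conv k w) x) \<le> H * \<delta> powr \<gamma> * (\<integral>z. norm (grad k z) \<partial>lborel)"
proof -
  note kD = mollifierD[OF k]
  have i1: "integrable lborel (\<lambda>y. grad k (x - y))"
    by (rule integral_lborel_reflect(2)[OF test_functions_integrable(2)[OF kD(1)]])
  have z: "(\<integral>y. grad k (x - y) \<partial>lborel) = 0"
    using integral_lborel_reflect(1)[OF test_functions_integrable(2)[OF kD(1)], of x] integral_grad_test[OF kD(1)] by simp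
  have i2: "integrable lborel (\<lambda>y. w y *\<^sub>R grad k (x - y))" by (rule integrable_grad_kernel[OF kD(1) w])
  have i3: "integrable lborel (\<lambda>y. w x *\<^sub>R grad k (x - y))" using i1 by simp
  have g0: "grad k u = 0" if "norm u > \<delta>" for u
    by (rule grad_eq_0_outside[of "cball 0 \<delta>"]) (use kD(4) that in auto)
  have "grad (conv k w) x = (\<integral>y. w y *\<^sub>R grad k (x - y) - w x *\<^sub>R grad k (x - y) \<partial>lborel)"
    using i2 i3 z by (simp add: grad_conv[OF kD(1) w])
  also have "norm \<dots> \<le> (\<integral>y. H * \<delta> powr \<gamma> * norm (grad k (x - y)) \<partial>lborel)"
  proof (rule Bochner_Integration.integral_norm_bound_integral)
    show "integrable lborel (\<lambda>y. w y *\<^sub>R grad k (x - y) - w x *\<^sub>R grad k (x - y))" using i2 i3 by simp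
    show "integrable lborel (\<lambda>y. H * \<delta> powr \<gamma> * norm (grad k (x - y)))" using i1 by simp
    fix y
    have "\<bar>w y - w x\<bar> * norm (grad k (x - y)) \<le> (H * \<delta> powr \<gamma>) * norm (grad k (x - y))"
    proof (cases "norm (x - y) > \<delta> \<or> x = y")
      case True
      then show ?thesis
      proof
        assume "norm (x - y) > \<delta>"
        then show ?thesis by (simp add: g0)
      next
        assume "x = y"
        then show ?thesis using H(2) by simp
      qed
    next
      case False
      have "\<bar>w y - w x\<bar> \<le> H * norm (y - x) powr \<gamma>" using False by (intro H(1)) auto
      also have "\<dots> \<le> H * \<delta> powr \<gamma>"
        using False H(2,3) by (intro mult_left_mono powr_mono2) (auto simp: norm_minus_commute)
      finally show ?thesis by (rule mult_right_mono) simp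
    qed
    then show "norm (w y *\<^sub>R grad k (x - y) - w x *\<^sub>R grad k (x - y)) \<le> H * \<delta> powr \<gamma> * norm (grad k (x - y))"
      by (simp add: scaleR_diff_left[symmetric])
  qed
  also have "\<dots> = H * \<delta> powr \<gamma> * (\<integral>z. norm (grad k z) \<partial>lborel)"
    using integral_lborel_reflect(1)[OF integrable_norm[OF test_functions_integrable(2)[OF kD(1)]], of x] by simp
  finally show ?thesis .
qed

text \<open>
  The argument of Jensen's inequality: the affine function from \<open>jensen_condition\<close>
  is evaluated at the vectors \<open>s *\<^sub>R G y\<close> and integrated against the
  probability density \<open>k (x - y)\<close>; its integral is its value at the average. Points
  \<open>y\<close> outside \<open>\<Omega>\<close> carry the vector \<open>0\<close>, for which
  the inequality is taken from \<open>y = x\<close> and \<open>M x 0 = 0\<close>.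
\<close>

lemma mollified_modular_bound:
  fixes M :: "'a::euclidean_space \<Rightarrow> 'a \<Rightarrow> real"
  assumes k: "mollifier \<delta> k" and G: "integrable lborel G" and P: "integrable lborel P"
    and zero: "M x 0 = 0" and x: "x \<in> \<Omega>" "0 < \<delta>"
    and J: "\<And>y \<eta>. y \<in> \<Omega> \<inter> ball x \<delta> \<Longrightarrow> M x (s *\<^sub>R conv k G x) + a \<bullet> (\<eta> - s *\<^sub>R conv k G x) \<le> M y (C *\<^sub>R \<eta>) + N"
    and out: "\<And>y. y \<notin> \<Omega> \<Longrightarrow> G y = 0" "\<And>y. y \<notin> \<Omega> \<Longrightarrow> P y = 0"
    and PM: "AE y in lborel. y \<in> \<Omega> \<longrightarrow> P y = M y (C *\<^sub>R s *\<^sub>R G y)"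
  shows "M x (s *\<^sub>R conv k G x) \<le> conv k P x + N"
proof -
  note kD = mollifierD[OF k]
  let ?\<xi> = "s *\<^sub>R conv k G x"
  have ik: "integrable lborel (\<lambda>y. k (x - y))" "(\<integral>y. k (x - y) \<partial>lborel) = 1"
    using integral_lborel_reflect[OF kD(5), of x] kD(3) by simp_all
  have iG: "integrable lborel (\<lambda>y. k (x - y) *\<^sub>R G y)" by (rule conv_integrable(1)[OF kD(1) G])
  have iP: "integrable lborel (\<lambda>y. k (x - y) * P y)" using conv_integrable(1)[OF kD(1) P, of x] by simp
  have iaG: "integrable lborel (\<lambda>y. s * (a \<bullet> (k (x - y) *\<^sub>R G y)))"
    by (intro integrable_mult_right integrable_inner_right iG)
  have IaG: "(\<integral>y. s * (a \<bullet> (k (x - y) *\<^sub>R G y)) \<partial>lborel) = a \<bullet> ?\<xi>"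
  proof -
    have "(\<integral>y. s * (a \<bullet> (k (x - y) *\<^sub>R G y)) \<partial>lborel) = s * (\<integral>y. a \<bullet> (k (x - y) *\<^sub>R G y) \<partial>lborel)"
      by (rule integral_mult_right_zero)
    also have "(\<integral>y. a \<bullet> (k (x - y) *\<^sub>R G y) \<partial>lborel) = a \<bullet> conv k G x"
      unfolding conv_def by (rule integral_inner_right) (rule iG)
    finally show ?thesis by simp
  qed
  have "M x ?\<xi> = (\<integral>y. (M x ?\<xi> - a \<bullet> ?\<xi>) * k (x - y) + s * (a \<bullet> (k (x - y) *\<^sub>R G y)) \<partial>lborel)"
    using ik iaG IaG by (subst Bochner_Integration.integral_add) simp_all
  also have "\<dots> \<le> (\<integral>y. k (x - y) * P y + N * k (x - y) \<partial>lborel)"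
  proof (rule integral_mono_AE)
    show "integrable lborel (\<lambda>y. (M x ?\<xi> - a \<bullet> ?\<xi>) * k (x - y) + s * (a \<bullet> (k (x - y) *\<^sub>R G y)))"
      using ik iaG by (intro Bochner_Integration.integrable_add) simp_all
    show "integrable lborel (\<lambda>y. k (x - y) * P y + N * k (x - y))" using ik iP by simp
    show "AE y in lborel. (M x ?\<xi> - a \<bullet> ?\<xi>) * k (x - y) + s * (a \<bullet> (k (x - y) *\<^sub>R G y)) \<le> k (x - y) * P y + N * k (x - y)"
      using PM
    proof eventually_elim
      case (elim y)
      show ?case
      proof (cases "k (x - y) = 0")
        case False
        then have yb: "y \<in> ball x \<delta>" using kD(4)[of "x - y"] by (force simp: dist_norm)
        have "M x ?\<xi> + a \<bullet> (s *\<^sub>R G y - ?\<xi>) \<le> P y + N"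
        proof (cases "y \<in> \<Omega>")
          case True
          then show ?thesis using J[of y "s *\<^sub>R G y"] yb elim by simp
        next
          case False
          \<comment> \<open>At such points \<open>G\<close> and \<open>P\<close> vanish.\<close>
          then show ?thesis using J[of x 0] x zero out by simp
        qed
        then have "k (x - y) * (M x ?\<xi> + a \<bullet> (s *\<^sub>R G y - ?\<xi>)) \<le> k (x - y) * (P y + N)"
          using kD(2) by (rule mult_left_mono)
        moreover have "k (x - y) * (M x ?\<xi> + a \<bullet> (s *\<^sub>R G y - ?\<xi>))
            = (M x ?\<xi> - a \<bullet> ?\<xi>) * k (x - y) + s * (a \<bullet> (k (x - y) *\<^sub>R G y))"
          by (simp add: inner_diff_right algebra_simps)
        moreover have "k (x - y) * (P y + N) = k (x - y) * P y + N * k (x - y)"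
          by (simp add: algebra_simps)
        ultimately show ?thesis by linarith
      qed simp
    qed
  qed
  also have "\<dots> = conv k P x + N"
    using ik iP by (simp add: conv_def)
  finally show ?thesis .
qed

text \<open>
  One piece of the partition. The sets \<open>K\<close> and \<open>S\<close> carry the function
  and the kernel; the last hypothesis says that small steps in directions of \<open>S\<close>
  lead from \<open>K\<close> into \<open>\<Omega>\<close>, which places the supports of the
  mollifications inside \<open>\<Omega>\<close>. The zero extension is mollified as a whole, so
  that no correction of the gradient is needed.
\<close>

lemma modular_approx_piece:
  fixes M :: "'a::euclidean_space \<Rightarrow> 'a \<Rightarrow> real" and w :: "'a \<Rightarrow> real"
  assumes O: "open \<Omega>" "bounded \<Omega>" and reg: "regular_N \<Omega> M" and J: "jensen_condition \<gamma> \<Omega> M"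
    and W: "test_limit w G" and H: "\<And>x y. x \<noteq> y \<Longrightarrow> \<bar>w x - w y\<bar> \<le> H * norm (x - y) powr \<gamma>" "H \<ge> 0" "\<gamma> \<ge> 0"
    and G0: "\<And>x. x \<notin> \<Omega> \<Longrightarrow> G x = 0"
    and MG: "\<And>A. integrable (lebesgue_on \<Omega>) (\<lambda>x. M x (A *\<^sub>R G x))"
    and K: "compact K" "\<And>x. x \<notin> K \<Longrightarrow> w x = 0"
    and k: "mollifier 1 k" "compact S" "\<And>y. y \<notin> S \<Longrightarrow> k y = 0"
    and d0: "0 < d0" "d0 \<le> 1" "\<And>\<delta> x y. 0 < \<delta> \<Longrightarrow> \<delta> < d0 \<Longrightarrow> x \<in> K \<Longrightarrow> y \<in> S \<Longrightarrow> x + \<delta> *\<^sub>R y \<in> \<Omega>"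
  shows "modular_approx \<Omega> M w G"
proof -
  have i: "integrable lborel w" "integrable lborel G" using W by (auto simp: test_limit_def)
  obtain c C N where c: "c > 0" and Jc: "\<And>x r \<xi>. x \<in> \<Omega> \<Longrightarrow> 0 < r \<Longrightarrow> r \<le> 1 \<Longrightarrow> norm \<xi> \<le> c * r powr (\<gamma> - 1) \<Longrightarrow>
        \<exists>a. \<forall>y\<in>\<Omega> \<inter> ball x r. \<forall>\<eta>. M x \<xi> + a \<bullet> (\<eta> - \<xi>) \<le> M y (C *\<^sub>R \<eta>) + N"
    using J unfolding jensen_condition_def by blast
  define I where "I = (\<integral>z. norm (grad k z) \<partial>lborel)"
  have I: "I \<ge> 0" unfolding I_def by (intro integral_nonneg_AE) simp
  \<comment> \<open>The gradient bound \<open>H * I * \<delta> powr (\<gamma> - 1)\<close> may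
    exceed the range \<open>c * \<delta> powr (\<gamma> - 1)\<close> of the affine minorants;
    division by \<open>lam\<close> brings it into that range.\<close>
  define lam where "lam = 1 + H * I / c"
  have lam: "lam > 0" "H * I \<le> c * lam"
    using c I H(2) by (auto simp: lam_def field_simps add_pos_nonneg)
  define d where "d n = d0 * inverse (real (Suc (Suc n)))" for n
  have d: "0 < d n" "d n < d0" "d n \<le> 1" for n
  proof -
    have l: "inverse (real (Suc (Suc n))) < 1" by (simp add: inverse_eq_divide)
    show "0 < d n" using d0(1) by (simp add: d_def)
    show "d n < d0" using mult_strict_left_mono[OF l d0(1)] by (simp add: d_def)
    then show "d n \<le> 1" using d0(2) by simp
  qed
  have dlim: "d \<longlonglongrightarrow> 0"
    using tendsto_mult_right_zero[OF LIMSEQ_Suc[OF LIMSEQ_inverse_real_of_nat], of d0] by (simp add: d_def[abs_def])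
  define kk where "kk n = dilate (d n) k" for n
  have kk: "mollifier (d n) (kk n)" for n
    using mollifier_dilate(1)[OF k(1) d(1)[of n]] by (simp add: kk_def)
  note kkD = mollifierD[OF kk]
  have kkI: "(\<integral>x. norm (grad (kk n) x) \<partial>lborel) = I / d n" for n
    unfolding kk_def I_def by (rule mollifier_dilate(3)[OF k(1) d(1)])
  have kkS: "z /\<^sub>R d n \<in> S" if "kk n z \<noteq> 0" for n z
    using that k(3)[of "z /\<^sub>R d n"] by (auto simp: kk_def dilate_def)
  define \<phi> where "\<phi> n = conv (kk n) w" for n
  have gr: "grad (\<phi> n) x = conv (kk n) G x" for n x
    unfolding \<phi>_def by (rule test_limit_grad_conv[OF W kkD(1)])
  have test: "\<phi> n \<in> test_functions \<Omega>" for n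
  proof (rule test_functionsI)
    let ?T = "{x + y |x y. x \<in> K \<and> y \<in> (\<lambda>y. d n *\<^sub>R y) ` S}"
    show "smooth (\<phi> n)" unfolding \<phi>_def by (rule smooth_conv[OF kkD(1) i(1)])
    show "compact ?T" by (rule compact_sums[OF K(1) compact_scaling[OF k(2)]])
    show "?T \<subseteq> \<Omega>" using d0(3)[OF d(1,2)] by auto
    fix x assume x: "x \<notin> ?T"
    show "\<phi> n x = 0"
      unfolding \<phi>_def
    proof (rule conv_eq_0)
      fix y
      show "kk n (x - y) = 0 \<or> w y = 0"
      proof (rule ccontr)
        assume "\<not> ?thesis"
        then have "y \<in> K" "(x - y) /\<^sub>R d n \<in> S" using K(2)[of y] kkS[of n "x - y"] by auto
        moreover have "x = y + d n *\<^sub>R ((x - y) /\<^sub>R d n)" using d(1)[of n] by simp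
        ultimately show False using x by blast
      qed
    qed
  qed
  have m: "(\<lambda>x. M x ((C * (1 / lam)) *\<^sub>R G x)) \<in> borel_measurable (lebesgue_on \<Omega>)"
    using MG by (rule borel_measurable_integrable)
  have Ob: "\<Omega> \<in> sets borel" using O(1) by simp
  obtain P where P: "P \<in> borel_measurable borel" "\<And>x. x \<notin> \<Omega> \<Longrightarrow> P x = 0"
    "AE x in lebesgue_on \<Omega>. M x ((C * (1 / lam)) *\<^sub>R G x) = P x"
    using lebesgue_measurable_borel_version[OF m Ob] by blast
  have Pi: "integrable lborel P"
    using integral_lebesgue_on_open(2)[OF O(1) P] MG by blast
  have Pb: "AE y in lborel. y \<in> \<Omega> \<longrightarrow> P y = M y (C *\<^sub>R (1 / lam) *\<^sub>R G y)"
  proof -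
    have O': "\<Omega> \<inter> space lebesgue \<in> sets lebesgue" using O(1) by auto
    have "AE x in lebesgue. x \<in> \<Omega> \<longrightarrow> M x ((C * (1 / lam)) *\<^sub>R G x) = P x"
      using P(3) unfolding AE_restrict_space_iff[OF O'] .
    then have "AE x in lborel. x \<in> \<Omega> \<longrightarrow> M x ((C * (1 / lam)) *\<^sub>R G x) = P x"
      by (simp only: AE_completion_iff)
    then show ?thesis by (rule eventually_mono) simp
  qed
  have Nint: "integrable lborel (\<lambda>x. N * indicator \<Omega> x)"
    using O emeasure_bounded_finite[OF O(2)] by (intro integrable_mult_right integrable_real_indicator) auto
  have conv_int: "integrable lborel (conv (kk n) f)" "(\<lambda>n. \<integral>x. norm (conv (kk n) f x - f x) \<partial>lborel) \<longlonglongrightarrow> 0"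
    if "integrable lborel f" for f :: "'a \<Rightarrow> 'b::euclidean_space" and n
    using conv_L1_tendsto[OF kk dlim that] by auto
  have bound: "M x ((1 / lam) *\<^sub>R grad (\<phi> n) x) \<le> conv (kk n) P x + N * indicator \<Omega> x" if x: "x \<in> \<Omega>" for n x
  proof -
    have "norm (grad (\<phi> n) x) \<le> H * d n powr \<gamma> * (I / d n)"
      unfolding \<phi>_def using grad_conv_holder_bound[OF kk d(1) i(1) H, of n x] by (simp add: kkI)
    also have "\<dots> = H * I * d n powr (\<gamma> - 1)"
      using d(1)[of n] by (simp add: powr_diff)
    also have "\<dots> \<le> c * lam * d n powr (\<gamma> - 1)"
      using lam(2) by (rule mult_right_mono) simp
    finally have "norm ((1 / lam) *\<^sub>R conv (kk n) G x) \<le> c * d n powr (\<gamma> - 1)"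
      using lam(1) by (simp add: gr divide_le_eq mult_ac)
    from Jc[OF x d(1) d(3) this] obtain a where
      a: "\<forall>y\<in>\<Omega> \<inter> ball x (d n). \<forall>\<eta>. M x ((1 / lam) *\<^sub>R conv (kk n) G x) + a \<bullet> (\<eta> - (1 / lam) *\<^sub>R conv (kk n) G x) \<le> M y (C *\<^sub>R \<eta>) + N" by blast
    have "M x ((1 / lam) *\<^sub>R conv (kk n) G x) \<le> conv (kk n) P x + N"
      by (rule mollified_modular_bound[OF kk i(2) Pi regular_N_zero[OF reg x] x d(1) _ G0 P(2) Pb]) (use a in blast)
    then show ?thesis using x by (simp add: gr)
  qed
  show ?thesis
    unfolding modular_approx_def
  proof (intro conjI i, rule exI[of _ \<phi>], rule exI[of _ "\<lambda>n x. conv (kk n) P x + N * indicator \<Omega> x"],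
      rule exI[of _ "\<lambda>x. P x + N * indicator \<Omega> x"], rule exI[of _ lam], intro conjI allI ballI test lam(1) bound)
    show "(\<lambda>k. \<integral>x. \<bar>\<phi> k x - w x\<bar> \<partial>lborel) \<longlonglongrightarrow> 0"
      using conv_int(2)[OF i(1)] by (simp add: \<phi>_def)
    show "(\<lambda>k. \<integral>x. norm (grad (\<phi> k) x - G x) \<partial>lborel) \<longlonglongrightarrow> 0"
      using conv_int(2)[OF i(2)] by (simp add: gr)
    show "integrable lborel (\<lambda>x. P x + N * indicator \<Omega> x)" using Pi Nint by simp
    show "integrable lborel (\<lambda>x. conv (kk n) P x + N * indicator \<Omega> x)" for n using conv_int(1)[OF Pi] Nint by simp
    show "(\<lambda>n. \<integral>x. \<bar>conv (kk n) P x + N * indicator \<Omega> x - (P x + N * indicator \<Omega> x)\<bar> \<partial>lborel) \<longlonglongrightarrow> 0"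
      using conv_int(2)[OF Pi] by simp
  qed
qed

lemma tendsto_L1_add:
  fixes f f' :: "nat \<Rightarrow> 'a \<Rightarrow> 'b::{banach, second_countable_topology}"
  assumes "\<And>k. integrable N (f k)" "integrable N g" "\<And>k. integrable N (f' k)" "integrable N g'"
    and l: "(\<lambda>k. \<integral>x. norm (f k x - g x) \<partial>N) \<longlonglongrightarrow> 0" "(\<lambda>k. \<integral>x. norm (f' k x - g' x) \<partial>N) \<longlonglongrightarrow> 0"
  shows "(\<lambda>k. \<integral>x. norm (f k x + f' k x - (g x + g' x)) \<partial>N) \<longlonglongrightarrow> 0"
proof (rule tendsto_sandwich[OF _ _ tendsto_const])
  show "(\<lambda>k. (\<integral>x. norm (f k x - g x) \<partial>N) + (\<integral>x. norm (f' k x - g' x) \<partial>N)) \<longlonglongrightarrow> 0"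
    using tendsto_add[OF l] by simp
  have "(\<integral>x. norm (f k x + f' k x - (g x + g' x)) \<partial>N) \<le> (\<integral>x. norm (f k x - g x) + norm (f' k x - g' x) \<partial>N)" for k
  proof (rule integral_mono)
    show "integrable N (\<lambda>x. norm (f k x + f' k x - (g x + g' x)))" using assms(1-4) by simp
    show "integrable N (\<lambda>x. norm (f k x - g x) + norm (f' k x - g' x))" using assms(1-4) by simp
    show "norm (f k x + f' k x - (g x + g' x)) \<le> norm (f k x - g x) + norm (f' k x - g' x)" for x
      by (simp add: add_diff_add norm_triangle_ineq)
  qed
  also have "(\<integral>x. norm (f k x - g x) + norm (f' k x - g' x) \<partial>N) = (\<integral>x. norm (f k x - g x) \<partial>N) + (\<integral>x. norm (f' k x - g' x) \<partial>N)" for k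
    using assms(1-4) by simp
  finally show "\<forall>\<^sub>F k in sequentially. (\<integral>x. norm (f k x + f' k x - (g x + g' x)) \<partial>N) \<le> (\<integral>x. norm (f k x - g x) \<partial>N) + (\<integral>x. norm (f' k x - g' x) \<partial>N)"
    by simp
qed (auto intro!: always_eventually integral_nonneg_AE)

lemma modular_approx_0:
  assumes reg: "regular_N \<Omega> M"
  shows "modular_approx \<Omega> M (\<lambda>x. 0) (\<lambda>x. 0)"
proof -
  have g: "grad (\<lambda>x::'a. 0) x = 0" for x by (rule grad_unique[OF has_derivative_const]) simp
  show ?thesis
    unfolding modular_approx_def
    by (intro conjI exI[of _ "\<lambda>_ _. 0"] exI[of _ "\<lambda>_. 0"] exI[of _ 1])
      (use regular_N_zero[OF reg] in \<open>auto simp: test_functions_0 g\<close>)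
qed

text \<open>
  The constant for the sum is \<open>2 * (lam + lam')\<close>: convexity splits \<open>M
  x\<close> of a sum of gradients at the cost of a factor \<open>2\<close>, and enlarging the
  denominators only lowers \<open>M x\<close>.
\<close>

lemma modular_approx_add:
  assumes reg: "regular_N \<Omega> M" and "modular_approx \<Omega> M w G" "modular_approx \<Omega> M w' G'"
  shows "modular_approx \<Omega> M (\<lambda>x. w x + w' x) (\<lambda>x. G x + G' x)"
proof -
  obtain \<phi> Q P lam where 1: "integrable lborel w" "integrable lborel G" "\<And>k. \<phi> k \<in> test_functions \<Omega>"
    "(\<lambda>k. \<integral>x. \<bar>\<phi> k x - w x\<bar> \<partial>lborel) \<longlonglongrightarrow> 0" "(\<lambda>k. \<integral>x. norm (grad (\<phi> k) x - G x) \<partial>lborel) \<longlonglongrightarrow> 0"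
    "integrable lborel P" "\<And>k. integrable lborel (Q k)" "(\<lambda>k. \<integral>x. \<bar>Q k x - P x\<bar> \<partial>lborel) \<longlonglongrightarrow> 0"
    "0 < lam" "\<And>k x. x \<in> \<Omega> \<Longrightarrow> M x ((1 / lam) *\<^sub>R grad (\<phi> k) x) \<le> Q k x"
    using assms(2) unfolding modular_approx_def by blast
  obtain \<phi>' Q' P' lam' where 2: "integrable lborel w'" "integrable lborel G'" "\<And>k. \<phi>' k \<in> test_functions \<Omega>"
    "(\<lambda>k. \<integral>x. \<bar>\<phi>' k x - w' x\<bar> \<partial>lborel) \<longlonglongrightarrow> 0" "(\<lambda>k. \<integral>x. norm (grad (\<phi>' k) x - G' x) \<partial>lborel) \<longlonglongrightarrow> 0"
    "integrable lborel P'" "\<And>k. integrable lborel (Q' k)" "(\<lambda>k. \<integral>x. \<bar>Q' k x - P' x\<bar> \<partial>lborel) \<longlonglongrightarrow> 0"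
    "0 < lam'" "\<And>k x. x \<in> \<Omega> \<Longrightarrow> M x ((1 / lam') *\<^sub>R grad (\<phi>' k) x) \<le> Q' k x"
    using assms(3) unfolding modular_approx_def by blast
  note ti = test_functions_integrable[OF 1(3)] test_functions_integrable[OF 2(3)]
  let ?L = "2 * (lam + lam')"
  have L: "?L > 0" using 1(9) 2(9) by simp
  have g: "grad (\<lambda>x. \<phi> k x + \<phi>' k x) x = grad (\<phi> k) x + grad (\<phi>' k) x" for k x
    by (rule grad_add) (rule test_functions_smooth[OF 1(3)] test_functions_smooth[OF 2(3)])+
  have bound: "M x ((1 / ?L) *\<^sub>R grad (\<lambda>x. \<phi> k x + \<phi>' k x) x) \<le> Q k x + Q' k x" if x: "x \<in> \<Omega>" for k x
  proof -
    have "M x ((1 / ?L) *\<^sub>R grad (\<lambda>x. \<phi> k x + \<phi>' k x) x)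
        \<le> M x ((2 * (1 / ?L)) *\<^sub>R grad (\<phi> k) x) + M x ((2 * (1 / ?L)) *\<^sub>R grad (\<phi>' k) x)"
      using regular_N_add[OF reg x, of "(1 / ?L) *\<^sub>R grad (\<phi> k) x" "(1 / ?L) *\<^sub>R grad (\<phi>' k) x"]
      by (simp add: g scaleR_add_right)
    also have "M x ((2 * (1 / ?L)) *\<^sub>R grad (\<phi> k) x) \<le> M x ((1 / lam) *\<^sub>R grad (\<phi> k) x)"
      using 1(9) 2(9) by (intro regular_N_scale_mono[OF reg x]) (simp add: field_simps)
    also have "M x ((2 * (1 / ?L)) *\<^sub>R grad (\<phi>' k) x) \<le> M x ((1 / lam') *\<^sub>R grad (\<phi>' k) x)"
      using 1(9) 2(9) by (intro regular_N_scale_mono[OF reg x]) (simp add: field_simps)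
    finally show ?thesis using 1(10)[OF x, of k] 2(10)[OF x, of k] by simp
  qed
  show ?thesis
    unfolding modular_approx_def
  proof (intro conjI Bochner_Integration.integrable_add 1(1,2) 2(1,2), rule exI[of _ "\<lambda>k x. \<phi> k x + \<phi>' k x"],
      rule exI[of _ "\<lambda>k x. Q k x + Q' k x"], rule exI[of _ "\<lambda>x. P x + P' x"], rule exI[of _ ?L],
      intro conjI allI ballI L bound)
    show "(\<lambda>x. \<phi> k x + \<phi>' k x) \<in> test_functions \<Omega>" for k by (rule test_functions_add[OF 1(3) 2(3)])
    show "(\<lambda>k. \<integral>x. \<bar>\<phi> k x + \<phi>' k x - (w x + w' x)\<bar> \<partial>lborel) \<longlonglongrightarrow> 0"
      using tendsto_L1_add[of lborel \<phi> w \<phi>' w'] ti(1,3) 1(1,4) 2(1,4) by simp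
    show "(\<lambda>k. \<integral>x. norm (grad (\<lambda>x. \<phi> k x + \<phi>' k x) x - (G x + G' x)) \<partial>lborel) \<longlonglongrightarrow> 0"
      unfolding g using tendsto_L1_add[of lborel "\<lambda>k. grad (\<phi> k)" G "\<lambda>k. grad (\<phi>' k)" G'] ti(2,4) 1(2,5) 2(2,5) by simp
    show "(\<lambda>k. \<integral>x. \<bar>Q k x + Q' k x - (P x + P' x)\<bar> \<partial>lborel) \<longlonglongrightarrow> 0"
      using tendsto_L1_add[of lborel Q P Q' P'] 1(6-8) 2(6-8) by simp
  qed (use 1 2 in simp_all)
qed

lemma modular_approx_sum:
  assumes reg: "regular_N \<Omega> M" and "\<And>i. i \<in> I \<Longrightarrow> modular_approx \<Omega> M (w i) (G i)"
  shows "modular_approx \<Omega> M (\<lambda>x. \<Sum>i\<in>I. w i x) (\<lambda>x. \<Sum>i\<in>I. G i x)"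
  using assms(2)
proof (induction I rule: infinite_finite_induct)
  case (insert i I)
  then have "modular_approx \<Omega> M (\<lambda>x. w i x + (\<Sum>i\<in>I. w i x)) (\<lambda>x. G i x + (\<Sum>i\<in>I. G i x))"
    by (intro modular_approx_add[OF reg]) auto
  then show ?case using insert.hyps by simp
qed (simp_all add: modular_approx_0[OF reg])

subsection \<open>Kernels that push a piece into a Lipschitz domain\<close>

text \<open>
  Small multiples of vectors in the support of the kernel move the part of the closed domain
  near \<open>p\<close> into the open domain.
\<close>

definition inward_kernel :: "'a::euclidean_space set \<Rightarrow> 'a \<Rightarrow> real \<Rightarrow> bool" where
  "inward_kernel \<Omega> p r \<longleftrightarrow> 0 < r \<and>
     (\<exists>k S d0. mollifier 1 k \<and> compact S \<and> (\<forall>y. y \<notin> S \<longrightarrow> k y = 0) \<and> 0 < d0 \<and> d0 \<le> 1 \<and>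
       (\<forall>\<delta> x y. 0 < \<delta> \<and> \<delta> < d0 \<and> x \<in> closure \<Omega> \<inter> cball p r \<and> y \<in> S \<longrightarrow> x + \<delta> *\<^sub>R y \<in> \<Omega>))"

text \<open>
  At an interior point any centred kernel does. At a boundary point the kernel is concentrated
  in a small ball of radius \<open>s\<close> around \<open>e / 2\<close>, where \<open>e\<close>
  is the direction of the graph: a step \<open>\<delta> *\<^sub>R y\<close> raises the height by
  at least \<open>\<delta> * (1 / 2 - s)\<close> and changes the graph function by at most
  \<open>\<delta> * K * s\<close>, which is less for \<open>s\<close> small compared with
  \<open>1 / (K + 1)\<close>. In particular the step leads from the closed epigraph into the
  open one.
\<close>

lemma inward_kernel_exists:
  fixes \<Omega> :: "'a::euclidean_space set"
  assumes L: "lipschitz_domain \<Omega>" and p: "p \<in> closure \<Omega>"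
  shows "\<exists>r. inward_kernel \<Omega> p r"
proof (cases "p \<in> \<Omega>")
  case True
  have "open \<Omega>" using L by (simp add: lipschitz_domain_def)
  then obtain r where r: "r > 0" "cball p r \<subseteq> \<Omega>" using True unfolding open_contains_cball by blast
  obtain k :: "'a \<Rightarrow> real" where k: "mollifier (norm (0::'a) + 1) k" "\<And>x. x \<notin> ball 0 1 \<Longrightarrow> k x = 0"
    by (rule mollifier_exists[of 1 "0::'a"]) auto
  have "x + \<delta> *\<^sub>R y \<in> \<Omega>" if "0 < \<delta>" "\<delta> < min 1 (r / 2)" "x \<in> cball p (r / 2)" "y \<in> cball 0 1" for \<delta> x y
  proof -
    have "norm (\<delta> *\<^sub>R y) \<le> \<delta>" using that by simp
    moreover have "dist p (x + \<delta> *\<^sub>R y) \<le> dist p x + norm (\<delta> *\<^sub>R y)"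
      using dist_triangle[of p "x + \<delta> *\<^sub>R y" x] by (simp add: dist_norm)
    moreover have "dist p x \<le> r / 2" "\<delta> < r / 2" using that by auto
    ultimately have "dist p (x + \<delta> *\<^sub>R y) \<le> r" by linarith
    then show ?thesis using r(2) by (auto simp: subset_iff)
  qed
  then have "inward_kernel \<Omega> p (r / 2)"
    unfolding inward_kernel_def using r(1) k
    by (intro conjI exI[of _ k] exI[of _ "cball 0 1"] exI[of _ "min 1 (r / 2)"]) (auto simp: less_eq_real_def)
  then show ?thesis by blast
next
  case False
  then have "p \<in> frontier \<Omega>" using p L by (simp add: frontier_def lipschitz_domain_def interior_open)
  then obtain e g K r where e: "norm e = 1" and g: "K-lipschitz_on {y. y \<bullet> e = 0} g" and r: "r > 0"
    and epi: "\<And>x. x \<in> ball p r \<Longrightarrow> x \<in> \<Omega> \<longleftrightarrow> g (x - (x \<bullet> e) *\<^sub>R e) < x \<bullet> e"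
    using L unfolding lipschitz_domain_def by blast
  have K: "K \<ge> 0" using g by (rule lipschitz_on_nonneg)
  have ee: "e \<bullet> e = 1" using e by (simp add: power2_norm_eq_inner[symmetric])
  define pr where "pr x = x - (x \<bullet> e) *\<^sub>R e" for x :: 'a
  have pr_in: "pr x \<in> {y. y \<bullet> e = 0}" for x by (simp add: pr_def inner_diff_left ee)
  have pr_lin: "pr (x + t *\<^sub>R y) = pr x + t *\<^sub>R pr y" for x y t
    by (simp add: pr_def inner_add_left algebra_simps)
  have lip: "\<bar>g (pr x) - g (pr y)\<bar> \<le> K * norm (pr x - pr y)" for x y
    using lipschitz_onD[OF g pr_in pr_in, of x y] by (simp add: dist_norm)
  have cont: "continuous_on UNIV (\<lambda>x. g (pr x))"
  proof (rule continuous_on_compose2[OF lipschitz_on_continuous_on[OF g]])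
    show "continuous_on UNIV pr" unfolding pr_def[abs_def] by (intro continuous_intros)
  qed (use pr_in in auto)
  \<comment> \<open>Points of the closure satisfy the weak inequality, by continuity of the
    graph function.\<close>
  have closed: "g (pr x) \<le> x \<bullet> e" if x: "x \<in> closure \<Omega>" "x \<in> ball p r" for x
  proof (rule ccontr)
    assume n: "\<not> ?thesis"
    have "open ((\<lambda>x. g (pr x) - x \<bullet> e) -` {0<..} \<inter> UNIV)"
      by (rule continuous_on_open_vimage[THEN iffD1, rule_format]) (auto intro!: continuous_intros cont)
    then have o: "open ((\<lambda>x. g (pr x) - x \<bullet> e) -` {0<..} \<inter> ball p r)" by (simp add: open_Int)
    have "x \<in> (\<lambda>x. g (pr x) - x \<bullet> e) -` {0<..} \<inter> ball p r" using n x by simp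
    then obtain y where "y \<in> \<Omega>" "y \<in> (\<lambda>x. g (pr x) - x \<bullet> e) -` {0<..} \<inter> ball p r"
      using x(1) o unfolding closure_iff_nhds_not_empty by blast
    then show False using epi[of y] by (simp add: pr_def)
  qed
  define s where "s = 1 / (2 * (K + 2))"
  have s: "0 < s" "s \<le> 1 / 4" "s + K * s < 1 / 2" using K by (auto simp: s_def field_simps)
  define z where "z = (1 / 2) *\<^sub>R e"
  have nz: "norm z = 1 / 2" using e by (simp add: z_def)
  obtain k :: "'a \<Rightarrow> real" where k: "mollifier (norm z + s) k" "\<And>x. x \<notin> ball z s \<Longrightarrow> k x = 0"
    using mollifier_exists[OF s(1), of z] by blast
  have k1: "mollifier 1 k" using k(1) s(2) nz by (auto simp: mollifier_def)
  have "x + \<delta> *\<^sub>R y \<in> \<Omega>" if d: "0 < \<delta>" "\<delta> < min 1 (r / 2)" and x: "x \<in> closure \<Omega> \<inter> cball p (r / 2)" and y: "y \<in> cball z s" for \<delta> x y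
  proof -
    have ny: "norm (y - z) \<le> s" using y by (simp add: dist_norm norm_minus_commute)
    have "norm y \<le> norm z + norm (y - z)" using norm_triangle_ineq[of z "y - z"] by simp
    then have "norm y \<le> 1" using ny nz s(2) by simp
    then have "norm (\<delta> *\<^sub>R y) \<le> \<delta>" using d by simp
    moreover have "dist p (x + \<delta> *\<^sub>R y) \<le> dist p x + norm (\<delta> *\<^sub>R y)"
      using dist_triangle[of p "x + \<delta> *\<^sub>R y" x] by (simp add: dist_norm)
    moreover have "dist p x \<le> r / 2" "\<delta> < r / 2" using x d by auto
    ultimately have "dist p (x + \<delta> *\<^sub>R y) < r" by linarith
    then have xb: "x + \<delta> *\<^sub>R y \<in> ball p r" by simp
    have xr: "x \<in> ball p r" using x r by simp
    have "\<bar>(y - z) \<bullet> e\<bar> \<le> norm (y - z) * norm e" by (rule Cauchy_Schwarz_ineq2)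
    then have ye: "y \<bullet> e \<ge> 1 / 2 - s" using ny e by (simp add: z_def inner_diff_left ee)
    have "pr z = 0" by (simp add: pr_def z_def ee)
    then have "pr y = pr (y - z)" using pr_lin[of y "-1" z] by simp
    moreover have "norm (pr u) \<le> norm u" for u
    proof (rule power2_le_imp_le)
      have "(norm (pr u))\<^sup>2 = (norm u)\<^sup>2 - (u \<bullet> e)\<^sup>2"
        unfolding power2_norm_eq_inner pr_def
        by (simp add: inner_diff_left inner_diff_right ee inner_commute power2_eq_square)
      then show "(norm (pr u))\<^sup>2 \<le> (norm u)\<^sup>2" by simp
    qed simp
    ultimately have npr: "norm (pr y) \<le> s" using ny order_trans by metis
    have "g (pr (x + \<delta> *\<^sub>R y)) \<le> g (pr x) + K * norm (pr (x + \<delta> *\<^sub>R y) - pr x)"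
      using lip[of "x + \<delta> *\<^sub>R y" x] by linarith
    also have "norm (pr (x + \<delta> *\<^sub>R y) - pr x) = \<delta> * norm (pr y)" using d by (simp add: pr_lin)
    also have "g (pr x) + K * (\<delta> * norm (pr y)) \<le> x \<bullet> e + K * (\<delta> * s)"
      using closed[of x] x xr K d npr by (intro add_mono mult_left_mono) auto
    also have "\<dots> < x \<bullet> e + \<delta> * (1 / 2 - s)"
      using mult_strict_left_mono[OF s(3) d(1)] by (simp add: algebra_simps)
    also have "\<dots> \<le> x \<bullet> e + \<delta> * (y \<bullet> e)" using ye d by simp
    finally have "g (pr (x + \<delta> *\<^sub>R y)) < (x + \<delta> *\<^sub>R y) \<bullet> e" by (simp add: inner_add_left)
    then show ?thesis using epi[OF xb] by (simp add: pr_def)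
  qed
  then have "inward_kernel \<Omega> p (r / 2)"
    unfolding inward_kernel_def using r k1 k(2) ball_subset_cball[of z s]
    by (intro conjI exI[of _ k] exI[of _ "cball z s"] exI[of _ "min 1 (r / 2)"]) (auto simp: less_eq_real_def)
  then show ?thesis by blast
qed

subsection \<open>Partition of unity\<close>

text \<open>
  The normalised indicators \<open>a i\<close> of finitely many covering balls sum to
  \<open>1\<close> on a neighbourhood of \<open>C\<close>. Mollifying them at a scale below the
  width of that neighbourhood keeps the sum equal to \<open>1\<close> on \<open>C\<close>, so no
  division of smooth functions is involved.
\<close>

lemma partition_of_unity:
  fixes C :: "'a::euclidean_space set"
  assumes C: "compact C" and r: "\<And>p. p \<in> C \<Longrightarrow> 0 < r p"
  obtains I \<psi> where "finite I" "I \<subseteq> C" "\<And>i. i \<in> I \<Longrightarrow> \<psi> i \<in> test_functions UNIV"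
    "\<And>i x. i \<in> I \<Longrightarrow> x \<notin> cball i (r i) \<Longrightarrow> \<psi> i x = (0::real)" "\<And>x. x \<in> C \<Longrightarrow> (\<Sum>i\<in>I. \<psi> i x) = 1"
proof -
  have "C \<subseteq> (\<Union>p\<in>C. ball p (r p / 2))" using r by force
  then obtain I where I: "I \<subseteq> C" "finite I" "C \<subseteq> (\<Union>p\<in>I. ball p (r p / 2))"
    using compactE_image[OF C, of C "\<lambda>p. ball p (r p / 2)"] by auto
  let ?U = "\<Union>p\<in>I. ball p (r p / 2)"
  have "open ?U" by auto
  then obtain \<epsilon> where \<epsilon>: "\<epsilon> > 0" "(\<Union>x\<in>C. ball x \<epsilon>) \<subseteq> ?U"
    using compact_subset_open_imp_ball_epsilon_subset[OF C _ I(3)] by blast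
  \<comment> \<open>A scale small enough for the neighbourhood of \<open>C\<close> and for the
    supports to stay in the given balls.\<close>
  define e where "e = Min (insert \<epsilon> ((\<lambda>i. r i / 2) ` I))"
  have "e \<in> insert \<epsilon> ((\<lambda>i. r i / 2) ` I)" unfolding e_def by (rule Min_in) (use I(2) in auto)
  then have e0: "e > 0" using \<epsilon>(1) r I(1) by auto
  have e\<epsilon>: "e \<le> \<epsilon>" unfolding e_def by (rule Min_le) (use I(2) in auto)
  have er: "e \<le> r i / 2" if "i \<in> I" for i unfolding e_def by (rule Min_le) (use I(2) that in auto)
  obtain k :: "'a \<Rightarrow> real" where k': "mollifier (norm (0::'a) + e) k" using mollifier_exists[OF e0, of 0] by blast
  then have k: "mollifier e k" by simp
  note kD = mollifierD[OF k]
  let ?b = "\<lambda>i. indicator (ball i (r i / 2)) :: 'a \<Rightarrow> real"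
  define a where "a i x = ?b i x / (\<Sum>j\<in>I. ?b j x)" for i x
  have S0: "0 \<le> (\<Sum>j\<in>I. ?b j x)" for x by (rule sum_nonneg) simp
  have S1: "1 \<le> (\<Sum>j\<in>I. ?b j x)" if "x \<in> ball i (r i / 2)" "i \<in> I" for i x
  proof -
    have "?b i x \<le> (\<Sum>j\<in>I. ?b j x)" by (rule member_le_sum) (use that I(2) in auto)
    then show ?thesis using that by simp
  qed
  have ab: "0 \<le> a i x" "a i x \<le> ?b i x" if "i \<in> I" for i x
    using S0[of x] S1[OF _ that, of x] by (auto simp: a_def indicator_def divide_le_eq_1)
  have ai: "integrable lborel (a i)" if "i \<in> I" for i
  proof (rule Bochner_Integration.integrable_bound)
    show "integrable lborel (?b i)"
      by (rule integrable_real_indicator) (auto intro: emeasure_bounded_finite[unfolded infinity_ennreal_def])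
    show "a i \<in> borel_measurable lborel" unfolding a_def[abs_def]
      by (intro borel_measurable_divide borel_measurable_sum borel_measurable_indicator) auto
    show "AE x in lborel. norm (a i x) \<le> norm (?b i x)" using ab[OF that] by (intro AE_I2) simp
  qed
  define \<psi> where "\<psi> i = conv k (a i)" for i
  have out: "\<psi> i x = 0" if i: "i \<in> I" and x: "x \<notin> cball i (r i)" for i x
    unfolding \<psi>_def
  proof (rule conv_eq_0)
    fix y
    show "k (x - y) = 0 \<or> a i y = 0"
    proof (cases "y \<in> ball i (r i / 2)")
      case True
      have "dist i x \<le> dist i y + norm (x - y)" using dist_triangle[of i x y] by (simp add: dist_norm norm_minus_commute)
      then have "e \<le> norm (x - y)" using True x er[OF i] by simp
      then show ?thesis using kD(4) by simp
    next
      case False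
      then show ?thesis by (simp add: a_def)
    qed
  qed
  show ?thesis
  proof (rule that[OF I(2,1)])
    show "\<psi> i \<in> test_functions UNIV" if "i \<in> I" for i
      by (rule test_functionsI[of _ "cball i (r i)"])
        (use out[OF that] smooth_conv[OF kD(1) ai[OF that]] in \<open>auto simp: \<psi>_def\<close>)
    show "\<psi> i x = 0" if "i \<in> I" "x \<notin> cball i (r i)" for i x by (rule out[OF that])
    fix x assume x: "x \<in> C"
    have "(\<Sum>i\<in>I. \<psi> i x) = (\<integral>y. (\<Sum>i\<in>I. k (x - y) *\<^sub>R a i y) \<partial>lborel)"
      unfolding \<psi>_def conv_def
      by (rule Bochner_Integration.integral_sum[symmetric]) (rule conv_integrable(1)[OF kD(1) ai])
    also have "\<dots> = (\<integral>y. k (x - y) \<partial>lborel)"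
    proof (rule Bochner_Integration.integral_cong)
      fix y
      show "(\<Sum>i\<in>I. k (x - y) *\<^sub>R a i y) = k (x - y)"
      proof (cases "k (x - y) = 0")
        case False
        then have "norm (x - y) < e" using kD(4)[of "x - y"] by force
        then have "y \<in> ball x \<epsilon>" using e\<epsilon> by (simp add: dist_norm)
        then have "y \<in> ?U" using \<epsilon>(2) x by blast
        then obtain i where "i \<in> I" "y \<in> ball i (r i / 2)" by blast
        then have "(\<Sum>j\<in>I. ?b j y) \<noteq> 0" using S1[of y i] by simp
        then have "(\<Sum>i\<in>I. a i y) = 1" by (simp add: a_def sum_divide_distrib[symmetric])
        then show ?thesis by (simp add: sum_distrib_left[symmetric])
      qed simp
    qed simp
    also have "\<dots> = 1" using integral_lborel_reflect(1)[OF kD(5), of x] kD(3) by simp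
    finally show "(\<Sum>i\<in>I. \<psi> i x) = 1" .
  qed
qed

text \<open>
  Multiplication by a test function preserves Hoelder continuity of bounded functions, because
  \<open>\<psi>\<close> is itself Hoelder of any exponent in \<open>[0,1]\<close>: Lipschitz at
  distances up to \<open>1\<close>, and bounded beyond.
\<close>

lemma holder_mult_test:
  fixes w :: "'a::euclidean_space \<Rightarrow> real"
  assumes H: "\<And>x y. x \<noteq> y \<Longrightarrow> \<bar>w x - w y\<bar> \<le> H * norm (x - y) powr \<gamma>" and g: "0 \<le> \<gamma>" "\<gamma> \<le> 1"
    and W: "\<And>x. \<bar>w x\<bar> \<le> W" and t: "\<psi> \<in> test_functions UNIV"
    and B: "0 \<le> B" "\<And>x. \<bar>\<psi> x\<bar> \<le> B" "\<And>x. norm (grad \<psi> x) \<le> B" and xy: "x \<noteq> y"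
  shows "\<bar>\<psi> x * w x - \<psi> y * w y\<bar> \<le> (B * H + 2 * B * W) * norm (x - y) powr \<gamma>"
proof -
  let ?d = "norm (x - y)"
  have d: "?d > 0" using xy by simp
  have W_nonneg: "0 \<le> W" using W[of x] by linarith
  have lip: "\<bar>\<psi> x - \<psi> y\<bar> \<le> B * ?d"
    by (rule grad_bound_imp_lipschitz) (use smooth_differentiable[OF test_functions_smooth[OF t]] B in auto)
  have "\<bar>\<psi> x - \<psi> y\<bar> \<le> 2 * B * ?d powr \<gamma>"
  proof (cases "?d \<le> 1")
    case True
    have "?d = ?d powr 1" using d by simp
    also have "\<dots> \<le> ?d powr \<gamma>" using True d g by (intro powr_mono') auto
    finally have "B * ?d \<le> B * ?d powr \<gamma>" using B(1) by (rule mult_left_mono)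
    moreover have "B * ?d powr \<gamma> \<le> 2 * B * ?d powr \<gamma>" using B(1) by simp
    ultimately show ?thesis using lip by linarith
  next
    case False
    have "1 \<le> ?d powr \<gamma>" using False g by (intro ge_one_powr_ge_zero) auto
    then have "2 * B * 1 \<le> 2 * B * ?d powr \<gamma>" using B(1) by (intro mult_left_mono) auto
    moreover have "\<bar>\<psi> x - \<psi> y\<bar> \<le> 2 * B" using B(2)[of x] B(2)[of y] by linarith
    ultimately show ?thesis by linarith
  qed
  then have 1: "\<bar>\<psi> x - \<psi> y\<bar> * \<bar>w y\<bar> \<le> (2 * B * ?d powr \<gamma>) * W"
    using W[of y] B(1) by (intro mult_mono) auto
  have 2: "\<bar>\<psi> x\<bar> * \<bar>w x - w y\<bar> \<le> B * (H * ?d powr \<gamma>)"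
    using B(1,2) H[OF xy] by (intro mult_mono) auto
  have "\<psi> x * w x - \<psi> y * w y = \<psi> x * (w x - w y) + (\<psi> x - \<psi> y) * w y" by (simp add: algebra_simps)
  then have "\<bar>\<psi> x * w x - \<psi> y * w y\<bar> \<le> \<bar>\<psi> x\<bar> * \<bar>w x - w y\<bar> + \<bar>\<psi> x - \<psi> y\<bar> * \<bar>w y\<bar>"
    using abs_triangle_ineq[of "\<psi> x * (w x - w y)" "(\<psi> x - \<psi> y) * w y"] by (simp add: abs_mult)
  then show ?thesis using 1 2 by (simp add: algebra_simps)
qed

lemma borel_measurable_lebesgue_on_borel:
  fixes f :: "'a::euclidean_space \<Rightarrow> 'b::euclidean_space"
  shows "f \<in> borel_measurable borel \<Longrightarrow> f \<in> borel_measurable (lebesgue_on \<Omega>)"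
  by (rule measurable_restrict_space1) (simp add: measurable_completion)

text \<open>
  The pieces \<open>\<psi> i * w\<close> inherit all hypotheses. Their gradients contain the
  extra term \<open>w x *\<^sub>R grad (\<psi> i) x\<close>, which is bounded because the
  Hoelder function \<open>w\<close> is. For \<open>\<gamma> = 0\<close> the Hoelder hypothesis
  only says that \<open>w\<close> has bounded oscillation.
\<close>

proposition modular_approx_lipschitz_domain:
  fixes M :: "'a::euclidean_space \<Rightarrow> 'a \<Rightarrow> real" and w :: "'a \<Rightarrow> real"
  assumes L: "bounded \<Omega>" "lipschitz_domain \<Omega>" and reg: "regular_N \<Omega> M" and J: "jensen_condition \<gamma> \<Omega> M"
    and g: "0 \<le> \<gamma>" "\<gamma> \<le> 1"
    and W: "test_limit w G" and H: "\<And>x y. x \<noteq> y \<Longrightarrow> \<bar>w x - w y\<bar> \<le> H * norm (x - y) powr \<gamma>" "0 \<le> H"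
    and out: "\<And>x. x \<notin> \<Omega> \<Longrightarrow> w x = 0" "\<And>x. x \<notin> \<Omega> \<Longrightarrow> G x = 0"
    and MG: "\<And>A. integrable (lebesgue_on \<Omega>) (\<lambda>x. M x (A *\<^sub>R G x))"
  shows "modular_approx \<Omega> M w G"
proof -
  have O: "open \<Omega>" using L(2) by (simp add: lipschitz_domain_def)
  have i: "integrable lborel w" "integrable lborel G" using W by (auto simp: test_limit_def)
  have sp: "AE x in lebesgue_on \<Omega>. x \<in> \<Omega>"
    using AE_space[of "lebesgue_on \<Omega>"] by (simp add: space_restrict_space)
  have [measurable]: "w \<in> borel_measurable borel" "G \<in> borel_measurable borel"
    using i by (simp_all add: borel_measurable_integrable)
  obtain D where D: "\<And>x. x \<in> \<Omega> \<Longrightarrow> norm x \<le> D" using L(1) unfolding bounded_iff by blast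
  obtain y0 where y0: "y0 \<notin> \<Omega>" using L(1) not_bounded_UNIV[where 'a='a] by (metis UNIV_eq_I)
  \<comment> \<open>A bound for \<open>w\<close>, by comparison with a point outside
    \<open>\<Omega>\<close>, where \<open>w\<close> vanishes.\<close>
  define W where "W = H * (\<bar>D\<bar> + norm y0) powr \<gamma>"
  have Wb: "\<bar>w x\<bar> \<le> W" for x
  proof (cases "x \<in> \<Omega>")
    case True
    then have "\<bar>w x - w y0\<bar> \<le> H * norm (x - y0) powr \<gamma>" using y0 by (intro H(1)) auto
    also have "\<dots> \<le> W"
      unfolding W_def using D[OF True] norm_triangle_ineq4[of x y0] H(2) g(1)
      by (intro mult_left_mono powr_mono2) auto
    finally show ?thesis using out(1)[OF y0] by simp
  qed (use H(2) in \<open>simp add: out W_def\<close>)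
  have "\<exists>r. \<forall>p\<in>closure \<Omega>. inward_kernel \<Omega> p (r p)"
    using inward_kernel_exists[OF L(2)] by (intro bchoice) auto
  then obtain r where r: "\<And>p. p \<in> closure \<Omega> \<Longrightarrow> inward_kernel \<Omega> p (r p)" by blast
  have r0: "0 < r p" if "p \<in> closure \<Omega>" for p using r[OF that] by (simp add: inward_kernel_def)
  have cC: "compact (closure \<Omega>)" using L(1) by (simp add: compact_closure)
  obtain I \<psi> where I: "finite I" "I \<subseteq> closure \<Omega>" and t: "\<And>i. i \<in> I \<Longrightarrow> \<psi> i \<in> test_functions UNIV"
    and s: "\<And>i x. i \<in> I \<Longrightarrow> x \<notin> cball i (r i) \<Longrightarrow> \<psi> i x = (0::real)"
    and sum1: "\<And>x. x \<in> closure \<Omega> \<Longrightarrow> (\<Sum>i\<in>I. \<psi> i x) = 1"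
    by (rule partition_of_unity[OF cC, of r], rule r0, assumption, rule that)
  let ?w = "\<lambda>i x. \<psi> i x * w x" and ?G = "\<lambda>i x. \<psi> i x *\<^sub>R G x + w x *\<^sub>R grad (\<psi> i) x"
  have piece: "modular_approx \<Omega> M (?w i) (?G i)" if iI: "i \<in> I" for i
  proof -
    note ti = t[OF iI]
    obtain B where B: "B > 0" "\<And>x. \<bar>\<psi> i x\<bar> \<le> B" "\<And>x. norm (grad (\<psi> i) x) \<le> B"
      by (rule test_functions_bounded[OF ti]) (rule that)
    have [measurable]: "\<psi> i \<in> borel_measurable borel" "grad (\<psi> i) \<in> borel_measurable borel"
      using test_functions_borel[OF ti] test_functions_borel_grad[OF ti] by auto
    have "\<exists>k S d0. mollifier 1 k \<and> compact S \<and> (\<forall>y. y \<notin> S \<longrightarrow> k y = 0) \<and> 0 < d0 \<and> d0 \<le> 1 \<and>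
       (\<forall>\<delta> x y. 0 < \<delta> \<and> \<delta> < d0 \<and> x \<in> closure \<Omega> \<inter> cball i (r i) \<and> y \<in> S \<longrightarrow> x + \<delta> *\<^sub>R y \<in> \<Omega>)"
      using r[OF subsetD[OF I(2) iI]] unfolding inward_kernel_def by (rule conjunct2)
    then obtain k S d0 where ks: "mollifier 1 k \<and> compact S \<and> (\<forall>y. y \<notin> S \<longrightarrow> k y = 0) \<and> 0 < d0 \<and> d0 \<le> 1 \<and>
       (\<forall>\<delta> x y. 0 < \<delta> \<and> \<delta> < d0 \<and> x \<in> closure \<Omega> \<inter> cball i (r i) \<and> y \<in> S \<longrightarrow> x + \<delta> *\<^sub>R y \<in> \<Omega>)"
      by (elim exE) (rule that)
    have k: "mollifier 1 k" "compact S" "\<And>y. y \<notin> S \<Longrightarrow> k y = 0" and d0: "0 < d0" "d0 \<le> 1"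
      using ks by simp_all
    have push: "x + \<delta> *\<^sub>R y \<in> \<Omega>" if "0 < \<delta>" "\<delta> < d0" "x \<in> closure \<Omega> \<inter> cball i (r i)" "y \<in> S" for \<delta> x y
      using ks that by blast
    show ?thesis
    proof (rule modular_approx_piece[OF O L(1) reg J, where K="closure \<Omega> \<inter> cball i (r i)" and k=k and S=S and ?d0.0=d0])
      show "test_limit (?w i) (?G i)" by (rule test_limit_mult[OF W test_functions_smooth[OF ti] B(2,3)])
      show "\<bar>?w i x - ?w i y\<bar> \<le> (B * H + 2 * B * W) * norm (x - y) powr \<gamma>" if "x \<noteq> y" for x y
        by (rule holder_mult_test[OF H(1) g Wb ti less_imp_le[OF B(1)] B(2,3) that])
      show "0 \<le> B * H + 2 * B * W" using B(1) H(2) Wb[of y0] by (simp add: order_trans[OF abs_ge_zero])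
      show "?G i x = 0" if "x \<notin> \<Omega>" for x using that by (simp add: out)
      show "compact (closure \<Omega> \<inter> cball i (r i))" using cC by (intro compact_Int_closed) auto
      show "?w i x = 0" if "x \<notin> closure \<Omega> \<inter> cball i (r i)" for x
        using that s[OF iI, of x] out(1)[of x] closure_subset[of \<Omega>] by auto
      show "integrable (lebesgue_on \<Omega>) (\<lambda>x. M x (A *\<^sub>R ?G i x))" for A
      proof -
        obtain B' where B': "B' \<ge> 0" "\<And>x \<xi>. x \<in> \<Omega> \<Longrightarrow> norm \<xi> \<le> \<bar>2 * A\<bar> * (W * B) \<Longrightarrow> M x \<xi> \<le> B'"
          using regular_N_bounded[OF reg, of "\<bar>2 * A\<bar> * (W * B)"] by blast
        show ?thesis
        proof (rule Bochner_Integration.integrable_bound)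
          show "integrable (lebesgue_on \<Omega>) (\<lambda>x. M x ((2 * A * B) *\<^sub>R G x) + B')"
            using MG[of "2 * A * B"] integrable_const_bounded[OF O L(1), of B'] by simp
          show "(\<lambda>x. M x (A *\<^sub>R ?G i x)) \<in> borel_measurable (lebesgue_on \<Omega>)"
            by (rule regular_N_measurable[OF O reg]) (rule borel_measurable_lebesgue_on_borel, measurable)
          show "AE x in lebesgue_on \<Omega>. norm (M x (A *\<^sub>R ?G i x)) \<le> norm (M x ((2 * A * B) *\<^sub>R G x) + B')"
            using sp
          proof eventually_elim
            case (elim x)
            have "M x (A *\<^sub>R ?G i x) \<le> M x (2 *\<^sub>R (A *\<^sub>R \<psi> i x *\<^sub>R G x)) + M x (2 *\<^sub>R (A *\<^sub>R w x *\<^sub>R grad (\<psi> i) x))"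
              using regular_N_add[OF reg elim, of "A *\<^sub>R \<psi> i x *\<^sub>R G x" "A *\<^sub>R w x *\<^sub>R grad (\<psi> i) x"] by (simp add: scaleR_add_right)
            also have "M x (2 *\<^sub>R (A *\<^sub>R \<psi> i x *\<^sub>R G x)) = M x ((2 * A * \<psi> i x) *\<^sub>R G x)" by (simp add: mult.assoc)
            also have "\<dots> \<le> M x ((2 * A * B) *\<^sub>R G x)"
              using B(1) B(2)[of x] by (intro regular_N_scale_mono[OF reg elim]) (simp add: abs_mult mult_left_mono)
            also have "M x (2 *\<^sub>R (A *\<^sub>R w x *\<^sub>R grad (\<psi> i) x)) \<le> B'"
            proof (rule B'(2)[OF elim])
              have "\<bar>w x\<bar> * norm (grad (\<psi> i) x) \<le> W * B"
                using Wb[of x] B(3)[of x] order_trans[OF abs_ge_zero Wb] by (intro mult_mono) auto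
              then have "\<bar>2 * A\<bar> * (\<bar>w x\<bar> * norm (grad (\<psi> i) x)) \<le> \<bar>2 * A\<bar> * (W * B)"
                by (intro mult_left_mono) auto
              then show "norm (2 *\<^sub>R (A *\<^sub>R w x *\<^sub>R grad (\<psi> i) x)) \<le> \<bar>2 * A\<bar> * (W * B)"
                by (simp add: abs_mult mult.assoc)
            qed
            finally show ?case
              using regular_N_nonneg[OF reg elim, of "A *\<^sub>R ?G i x"] regular_N_nonneg[OF reg elim, of "(2 * A * B) *\<^sub>R G x"] B'(1) by simp
          qed
        qed
      qed
      show "x + \<delta> *\<^sub>R y \<in> \<Omega>" if "0 < \<delta>" "\<delta> < d0" "x \<in> closure \<Omega> \<inter> cball i (r i)" "y \<in> S" for \<delta> x y
        by (rule push[OF that])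
    qed (use k d0 g in auto)
  qed
  have "modular_approx \<Omega> M (\<lambda>x. \<Sum>i\<in>I. ?w i x) (\<lambda>x. \<Sum>i\<in>I. ?G i x)"
    by (rule modular_approx_sum[OF reg piece])
  moreover have "(\<Sum>i\<in>I. ?w i x) = w x" for x
  proof (cases "x \<in> \<Omega>")
    case True
    then show ?thesis using sum1[of x] closure_subset[of \<Omega>] by (auto simp: sum_distrib_right[symmetric])
  qed (simp add: out)
  moreover have "(\<Sum>i\<in>I. ?G i x) = G x" for x
  proof (cases "x \<in> \<Omega>")
    case True
    have "((\<lambda>x. \<Sum>i\<in>I. \<psi> i x) has_derivative (\<lambda>_. 0)) (at x)"
    proof (rule has_derivative_transform_within_open[OF has_derivative_const[of 1] O True])
      show "1 = (\<Sum>i\<in>I. \<psi> i y)" if "y \<in> \<Omega>" for y using sum1[of y] that closure_subset[of \<Omega>] by auto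
    qed
    then have "grad (\<lambda>x. \<Sum>i\<in>I. \<psi> i x) x = 0" by (rule grad_unique) simp
    then have g0: "(\<Sum>i\<in>I. grad (\<psi> i) x) = 0"
      using grad_sum[of I \<psi> x] test_functions_smooth[OF t] by simp
    have "(\<Sum>i\<in>I. ?G i x) = (\<Sum>i\<in>I. \<psi> i x) *\<^sub>R G x + w x *\<^sub>R (\<Sum>i\<in>I. grad (\<psi> i) x)"
      by (simp add: sum.distrib scaleR_sum_left scaleR_sum_right)
    then show ?thesis using sum1[of x] True closure_subset[of \<Omega>] g0 by auto
  qed (simp add: out)
  ultimately show ?thesis by simp
qed

section \<open>Boundary values\<close>

text \<open>
  Since \<open>flat_exp 2\<close> is the derivative of \<open>flat_exp 0\<close>, this bounds
  the derivative of the truncation used in the next lemma.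
\<close>

lemma flat_exp_2_bound: "\<bar>flat_exp 2 t\<bar> \<le> 2"
proof (cases "t > 0")
  case True
  have "(1 / t)\<^sup>2 / 2 \<le> exp (1 / t)"
  proof -
    have "0 \<le> 1 / t" using True by simp
    then show ?thesis using exp_lower_Taylor_quadratic[of "1 / t"] by linarith
  qed
  moreover have "X / E \<le> 2" if "X / 2 \<le> E" "0 < E" for X E :: real
    using that by (simp add: divide_le_eq)
  ultimately have "(1 / t)\<^sup>2 / exp (1 / t) \<le> 2" using exp_gt_zero[of "1 / t"] by blast
  then show ?thesis using True by (simp add: flat_exp_def del: power_divide)
qed (simp add: flat_exp_def)

text \<open>
  The smooth truncation \<open>T t = flat_exp 0 c - flat_exp 0 (c - t)\<close> vanishes at
  \<open>0\<close> and is constant for \<open>t \<ge> c\<close>. So near \<open>p\<close> the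
  function \<open>T (w x)\<close> takes two distinct values, one inside and one outside
  \<open>\<Omega>\<close>, while its gradient in the sense of \<open>test_limit\<close> is zero.
  Mollifications then have zero gradient near \<open>p\<close> and are constant there, although
  they take both values at centres of balls on either side.
\<close>

lemma test_limit_no_jump:
  assumes W: "test_limit w G" and out: "\<And>x. x \<notin> \<Omega> \<Longrightarrow> w x = 0" "\<And>x. x \<notin> \<Omega> \<Longrightarrow> G x = 0"
    and c: "0 < c" "\<And>x. x \<in> \<Omega> \<inter> ball p r \<Longrightarrow> c \<le> w x"
    and x1: "x1 \<in> ball p (r / 2)" "ball x1 s \<subseteq> \<Omega>" and x2: "x2 \<in> ball p (r / 2)" "ball x2 s \<inter> \<Omega> = {}"
    and s: "0 < s"
  shows False
proof -
  have "dist p x1 < r / 2" using x1(1) by simp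
  then have r: "r > 0" using zero_le_dist[of p x1] by linarith
  define T where "T t = flat_exp 0 c - flat_exp 0 (c - t)" for t
  define T' where "T' t = flat_exp 2 (c - t)" for t
  have T_smooth: "smooth T"
    unfolding T_def[abs_def] using smooth_diff[OF smooth_const smooth_affine[OF smooth_flat_exp[of 0], of c "-1"]] by simp
  have T_deriv: "(T has_real_derivative T' t) (at t)" for t
  proof -
    have "((\<lambda>t. flat_exp 0 (c - t)) has_real_derivative flat_exp 2 (c - t) * (- 1)) (at t)"
      by (rule DERIV_chain2[of "flat_exp 0"])
        (use flat_exp_DERIV[of 0 "c - t"] in \<open>auto intro!: derivative_eq_intros simp: numeral_2_eq_2\<close>)
    from DERIV_diff[OF DERIV_const this] show ?thesis by (simp add: T_def[abs_def] T'_def)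
  qed
  have T'_cont: "continuous_on UNIV T'"
    unfolding T'_def[abs_def]
    by (rule continuous_on_compose2[OF smooth_continuous[OF smooth_flat_exp]]) (auto intro!: continuous_intros)
  have W': "test_limit (\<lambda>x. T (w x)) (\<lambda>x. T' (w x) *\<^sub>R G x)"
    by (rule test_limit_compose[OF W T_smooth _ T_deriv T'_cont, of 2])
      (simp_all add: T_def T'_def flat_exp_2_bound)
  define \<kappa> where "\<kappa> = flat_exp 0 c"
  have \<kappa>: "\<kappa> > 0" using c(1) by (simp add: \<kappa>_def flat_exp_def)
  have Tin: "T (w x) = \<kappa>" if "x \<in> \<Omega> \<inter> ball p r" for x
    using c(2)[OF that] by (simp add: T_def \<kappa>_def flat_exp_def)
  have Tout: "T (w x) = 0" if "x \<notin> \<Omega>" for x using out(1)[OF that] by (simp add: T_def)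
  have Gin: "T' (w x) *\<^sub>R G x = 0" if "x \<in> ball p r" for x
  proof (cases "x \<in> \<Omega>")
    case True
    then show ?thesis using c(2)[of x] that by (simp add: T'_def flat_exp_def)
  qed (simp add: out)
  define e where "e = min s (r / 2)"
  have e: "0 < e" "e \<le> s" "e \<le> r / 2" using s r by (auto simp: e_def)
  obtain k :: "'a \<Rightarrow> real" where "mollifier (norm (0::'a) + e) k" using mollifier_exists[OF e(1), of 0] by blast
  then have k: "mollifier e k" by simp
  note kD = mollifierD[OF k]
  have near: "dist x y < e" if "k (x - y) \<noteq> 0" for x y
    using kD(4)[of "x - y"] that by (force simp: dist_norm)
  have inr: "y \<in> ball p r" if "x \<in> ball p (r / 2)" "dist x y < e" for x y
    using that e(3) dist_triangle[of p y x] by simp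
  let ?h = "conv k (\<lambda>x. T (w x))"
  have iT: "integrable lborel (\<lambda>x. T (w x))" using W' by (simp add: test_limit_def)
  have "\<exists>a. \<forall>x\<in>ball p (r / 2). ?h x = a"
  proof (rule has_derivative_zero_constant)
    show "convex (ball p (r / 2))" by (rule convex_ball)
    fix x assume x: "x \<in> ball p (r / 2)"
    have "grad ?h x = conv k (\<lambda>x. T' (w x) *\<^sub>R G x) x" by (rule test_limit_grad_conv[OF W' kD(1)])
    also have "\<dots> = 0"
    proof (rule conv_eq_0)
      fix y show "k (x - y) = 0 \<or> T' (w y) *\<^sub>R G y = 0"
        using near[of x y] inr[OF x, of y] Gin[of y] by blast
    qed
    finally have "grad ?h x = 0" .
    then show "(?h has_derivative (\<lambda>h. 0)) (at x within ball p (r / 2))"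
      using has_derivative_grad[OF smooth_differentiable[OF smooth_conv[OF kD(1) iT]], of x]
      by (simp add: has_derivative_at_withinI)
  qed
  then have eq: "?h x1 = ?h x2" using x1(1) x2(1) by auto
  have "?h x1 = (\<integral>y. \<kappa> * k (x1 - y) \<partial>lborel)"
    unfolding conv_def
  proof (rule Bochner_Integration.integral_cong)
    fix y
    show "k (x1 - y) *\<^sub>R T (w y) = \<kappa> * k (x1 - y)"
    proof (cases "k (x1 - y) = 0")
      case False
      then have d: "dist x1 y < e" by (rule near)
      then have "y \<in> \<Omega> \<inter> ball p r" using inr[OF x1(1) d] x1(2) e(2) by auto
      then show ?thesis by (simp add: Tin)
    qed simp
  qed simp
  also have "\<dots> = \<kappa>" using integral_lborel_reflect(1)[OF kD(5), of x1] kD(3) by simp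
  finally have "?h x1 = \<kappa>" .
  moreover have "?h x2 = 0"
  proof (rule conv_eq_0)
    fix y
    show "k (x2 - y) = 0 \<or> T (w y) = 0"
    proof (cases "k (x2 - y) = 0")
      case False
      then have "dist x2 y < e" by (rule near)
      then have "y \<in> ball x2 s" using e(2) by simp
      then have "y \<notin> \<Omega>" using x2(2) by blast
      then show ?thesis by (simp add: Tout)
    qed simp
  qed
  ultimately show False using eq \<kappa> by simp
qed

text \<open>
  Below the graph: from the boundary point \<open>p\<close>, a step against the direction
  \<open>e\<close> leads to a point strictly below the graph, and a neighbourhood of it stays
  below by continuity.
\<close>

lemma lipschitz_domain_exterior:
  fixes \<Omega> :: "'a::euclidean_space set"
  assumes L: "lipschitz_domain \<Omega>" and p: "p \<in> frontier \<Omega>" and r: "0 < r"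
  obtains x s where "x \<in> ball p r" "0 < s" "ball x s \<inter> \<Omega> = {}"
proof -
  obtain e g K r' where e: "norm e = 1" and g: "K-lipschitz_on {y. y \<bullet> e = 0} g" and r': "r' > 0"
    and epi: "\<And>x. x \<in> ball p r' \<Longrightarrow> x \<in> \<Omega> \<longleftrightarrow> g (x - (x \<bullet> e) *\<^sub>R e) < x \<bullet> e"
    using L p unfolding lipschitz_domain_def by blast
  have O: "open \<Omega>" using L by (simp add: lipschitz_domain_def)
  have ee: "e \<bullet> e = 1" using e by (simp add: power2_norm_eq_inner[symmetric])
  have "p \<notin> \<Omega>" using p O by (simp add: frontier_def interior_open)
  then have pg: "p \<bullet> e \<le> g (p - (p \<bullet> e) *\<^sub>R e)" using epi[of p] r' by simp
  define pr where "pr x = x - (x \<bullet> e) *\<^sub>R e" for x :: 'a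
  have pr_in: "pr x \<in> {y. y \<bullet> e = 0}" for x by (simp add: pr_def inner_diff_left ee)
  have cont: "continuous_on UNIV (\<lambda>x. g (pr x) - x \<bullet> e)"
  proof (intro continuous_on_diff)
    show "continuous_on UNIV (\<lambda>x. g (pr x))"
    proof (rule continuous_on_compose2[OF lipschitz_on_continuous_on[OF g]])
      show "continuous_on UNIV pr" unfolding pr_def[abs_def] by (intro continuous_intros)
    qed (use pr_in in auto)
  qed (intro continuous_intros)
  define t where "t = min r r' / 2"
  have t: "0 < t" "t < r" "t < r'" using r r' by (auto simp: t_def)
  define x where "x = p - t *\<^sub>R e"
  have xp: "dist p x = t" using t(1) e by (simp add: x_def dist_norm)
  have prx: "pr x = pr p" by (simp add: x_def pr_def inner_diff_left ee algebra_simps)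
  have "g (pr x) - x \<bullet> e > 0"
    unfolding prx using pg t(1) by (simp add: x_def pr_def inner_diff_left ee)
  then have xin: "x \<in> (\<lambda>x. g (pr x) - x \<bullet> e) -` {0<..} \<inter> ball p r'" using xp t(3) by simp
  have "open ((\<lambda>x. g (pr x) - x \<bullet> e) -` {0<..})"
    using cont by (intro open_vimage) auto
  then have "open ((\<lambda>x. g (pr x) - x \<bullet> e) -` {0<..} \<inter> ball p r')" by (simp add: open_Int)
  then obtain s where s: "s > 0" "ball x s \<subseteq> (\<lambda>x. g (pr x) - x \<bullet> e) -` {0<..} \<inter> ball p r'"
    using xin unfolding open_contains_ball by blast
  have "ball x s \<inter> \<Omega> = {}"
  proof (rule ccontr)
    assume "\<not> ?thesis"
    then obtain y where y: "y \<in> ball x s" "y \<in> \<Omega>" by blast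
    then have "y \<in> ball p r'" "0 < g (pr y) - y \<bullet> e" using s(2) by blast+
    then show False using epi[of y] y(2) by (simp add: pr_def)
  qed
  then show ?thesis using that[of x s] xp t(2) s(1) by simp
qed

text \<open>
  If the value stayed at least \<open>\<epsilon>\<close> at points arbitrarily close to
  \<open>p\<close>, Hoelder continuity would keep the function at least \<open>\<epsilon> /
  2\<close>, with a fixed sign, on a whole one-sided neighbourhood of \<open>p\<close>, which
  the previous two lemmas exclude.
\<close>

lemma test_limit_holder_boundary:
  fixes w :: "'a::euclidean_space \<Rightarrow> real"
  assumes L: "lipschitz_domain \<Omega>" and W: "test_limit w G"
    and out: "\<And>x. x \<notin> \<Omega> \<Longrightarrow> w x = 0" "\<And>x. x \<notin> \<Omega> \<Longrightarrow> G x = 0"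
    and H: "\<And>x y. x \<in> \<Omega> \<Longrightarrow> y \<in> \<Omega> \<Longrightarrow> x \<noteq> y \<Longrightarrow> \<bar>w x - w y\<bar> \<le> H * norm (x - y) powr \<gamma>" "0 \<le> H" "0 < \<gamma>"
    and p: "p \<in> frontier \<Omega>" and \<epsilon>: "0 < \<epsilon>"
  shows "\<exists>\<delta>>0. \<forall>x\<in>\<Omega> \<inter> ball p \<delta>. \<bar>w x\<bar> < \<epsilon>"
proof (rule ccontr)
  assume n: "\<not> ?thesis"
  have O: "open \<Omega>" using L by (simp add: lipschitz_domain_def)
  have no: False if W: "test_limit w G" and out: "\<And>x. x \<notin> \<Omega> \<Longrightarrow> w x = 0" "\<And>x. x \<notin> \<Omega> \<Longrightarrow> G x = 0"
    and c: "0 < c" "\<And>x. x \<in> \<Omega> \<inter> ball p r \<Longrightarrow> c \<le> w x" and r: "r > 0" for w G r and c :: real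
  proof -
    have r2: "0 < r / 2" using r by simp
    obtain x2 s2 where x2: "x2 \<in> ball p (r / 2)" "0 < s2" "ball x2 s2 \<inter> \<Omega> = {}"
      by (rule lipschitz_domain_exterior[OF L p r2])
    have "p \<in> closure \<Omega>" using p by (simp add: frontier_def)
    then obtain x1 where x1: "x1 \<in> \<Omega>" "dist x1 p < r / 2" using r2 unfolding closure_approachable by blast
    obtain s1 where s1: "0 < s1" "ball x1 s1 \<subseteq> \<Omega>" using O x1(1) unfolding open_contains_ball by blast
    have "ball x1 (min s1 s2) \<subseteq> ball x1 s1" "ball x2 (min s1 s2) \<subseteq> ball x2 s2" by auto
    then have b: "ball x1 (min s1 s2) \<subseteq> \<Omega>" "ball x2 (min s1 s2) \<inter> \<Omega> = {}" using s1(2) x2(3) by blast+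
    have "x1 \<in> ball p (r / 2)" "0 < min s1 s2" using x1(2) s1(1) x2(2) by (simp_all add: dist_commute)
    then show False
      using test_limit_no_jump[where \<Omega>=\<Omega> and p=p and r=r and ?x1.0=x1 and ?x2.0=x2 and s="min s1 s2", OF W out c] b x2(1)
      by blast
  qed
  define z where "z = \<epsilon> / (2 * (H + 1))"
  have "K * (\<epsilon> / (2 * K)) = \<epsilon> / 2" if "0 < K" for K :: real using that by simp
  from this[of "H + 1"] have z: "0 < z" "(H + 1) * z = \<epsilon> / 2" using \<epsilon> H(2) by (simp_all only: z_def) simp
  \<comment> \<open>Chosen such that the oscillation on a ball of radius \<open>r\<close> is at
    most \<open>\<epsilon> / 2\<close>.\<close>
  define r where "r = z powr (1 / \<gamma>) / 2"
  have "0 < z powr (1 / \<gamma>)" using z(1) by simp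
  then have r: "r > 0" unfolding r_def by (rule half_gt_zero)
  have Hr: "H * (2 * r) powr \<gamma> \<le> \<epsilon> / 2"
  proof -
    have "(2 * r) powr \<gamma> = z" using z(1) H(3) by (simp add: r_def powr_powr)
    then have "H * (2 * r) powr \<gamma> \<le> (H + 1) * z" using z(1) by simp
    then show ?thesis using z(2) by simp
  qed
  have "\<not> (\<forall>x\<in>\<Omega> \<inter> ball p r. \<bar>w x\<bar> < \<epsilon>)" using n r by blast
  then obtain x0 where x0: "x0 \<in> \<Omega>" "x0 \<in> ball p r" "\<epsilon> \<le> \<bar>w x0\<bar>" by (auto simp: not_less)
  have close: "\<bar>w x - w x0\<bar> \<le> \<epsilon> / 2" if x: "x \<in> \<Omega> \<inter> ball p r" for x
  proof (cases "x = x0")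
    case False
    have "norm (x - x0) \<le> 2 * r"
      using x x0(2) dist_triangle[of x x0 p] by (simp add: dist_norm[symmetric] dist_commute)
    have "\<bar>w x - w x0\<bar> \<le> H * norm (x - x0) powr \<gamma>" using x x0(1) False by (intro H(1)) auto
    also have "\<dots> \<le> H * (2 * r) powr \<gamma>"
      using \<open>norm (x - x0) \<le> 2 * r\<close> H(2,3) by (intro mult_left_mono powr_mono2) auto
    finally show ?thesis using Hr by simp
  qed (use \<epsilon> in simp)
  have e2: "0 < \<epsilon> / 2" using \<epsilon> by simp
  show False
  proof (cases "w x0 \<ge> 0")
    case True
    show False
    proof (rule no[OF W out e2 _ r])
      show "\<epsilon> / 2 \<le> w x" if "x \<in> \<Omega> \<inter> ball p r" for x
        using close[OF that] x0(3) True by linarith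
    qed
  next
    case False
    have g0: "grad (\<lambda>x::'a. - 1) x = 0" for x by (rule grad_unique[OF has_derivative_const]) simp
    have "test_limit (\<lambda>x. (- 1) * w x) (\<lambda>x. (- 1) *\<^sub>R G x + w x *\<^sub>R grad (\<lambda>x. - 1) x)"
      by (rule test_limit_mult[OF W smooth_const, of "-1" 1]) (simp_all add: g0)
    then have W': "test_limit (\<lambda>x. - w x) (\<lambda>x. - G x)" by (simp add: g0)
    show False
    proof (rule no[OF W' _ _ e2 _ r])
      show "\<epsilon> / 2 \<le> - w x" if "x \<in> \<Omega> \<inter> ball p r" for x
        using close[OF that] x0(3) False by linarith
    qed (simp_all add: out)
  qed
qed

text \<open>
  A segment from a point inside to a point outside meets the frontier, where the function tends
  to zero; the increment up to that point already bounds the value, with the same constant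
  \<open>H\<close>.
\<close>

lemma test_limit_holder_extension:
  fixes w :: "'a::euclidean_space \<Rightarrow> real"
  assumes L: "lipschitz_domain \<Omega>" and W: "test_limit w G"
    and out: "\<And>x. x \<notin> \<Omega> \<Longrightarrow> w x = 0" "\<And>x. x \<notin> \<Omega> \<Longrightarrow> G x = 0"
    and H: "\<And>x y. x \<in> \<Omega> \<Longrightarrow> y \<in> \<Omega> \<Longrightarrow> x \<noteq> y \<Longrightarrow> \<bar>w x - w y\<bar> \<le> H * norm (x - y) powr \<gamma>" "0 \<le> H" "0 < \<gamma>"
    and xy: "x \<noteq> y"
  shows "\<bar>w x - w y\<bar> \<le> H * norm (x - y) powr \<gamma>"
proof -
  have O: "open \<Omega>" using L by (simp add: lipschitz_domain_def)
  have half: "\<bar>w x\<bar> \<le> H * norm (x - y) powr \<gamma>" if x: "x \<in> \<Omega>" and y: "y \<notin> \<Omega>" for x y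
  proof -
    have "closed_segment x y \<inter> frontier \<Omega> \<noteq> {}"
      by (rule connected_Int_frontier) (use x y in \<open>auto intro: ends_in_segment\<close>)
    then obtain q where q: "q \<in> closed_segment x y" "q \<in> frontier \<Omega>" by blast
    have qx: "norm (x - q) \<le> norm (x - y)"
      using segment_bound(1)[OF q(1)] by (simp add: norm_minus_commute)
    have "q \<notin> \<Omega>" using q(2) O by (simp add: frontier_def interior_open)
    then have nq: "x \<noteq> q" using x by blast
    have "q \<in> closure \<Omega>" using q(2) by (simp add: frontier_def)
    then obtain z where z: "\<And>n. z n \<in> \<Omega>" "z \<longlonglongrightarrow> q" unfolding closure_sequential by blast
    have wz: "(\<lambda>n. \<bar>w (z n)\<bar>) \<longlonglongrightarrow> 0"
    proof (rule tendsto_rabs_zero, rule LIMSEQ_I)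
      fix e :: real assume "0 < e"
      then obtain d where d: "d > 0" "\<forall>x\<in>\<Omega> \<inter> ball q d. \<bar>w x\<bar> < e"
        using test_limit_holder_boundary[OF L W out H q(2)] by blast
      obtain N where N: "\<And>n. n \<ge> N \<Longrightarrow> dist (z n) q < d"
        using z(2) d(1) unfolding lim_sequentially by blast
      have "norm (w (z n) - 0) < e" if "n \<ge> N" for n
        using d(2) z(1)[of n] N[OF that] by (simp add: dist_commute)
      then show "\<exists>N. \<forall>n\<ge>N. norm (w (z n) - 0) < e" by blast
    qed
    have lim: "(\<lambda>n. \<bar>w (z n)\<bar> + H * norm (x - z n) powr \<gamma>) \<longlonglongrightarrow> 0 + H * norm (x - q) powr \<gamma>"
      using nq by (intro tendsto_add wz tendsto_mult tendsto_const tendsto_powr tendsto_norm tendsto_diff z(2)) simp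
    have le: "\<bar>w x\<bar> \<le> \<bar>w (z n)\<bar> + H * norm (x - z n) powr \<gamma>" for n
    proof (cases "x = z n")
      case False
      have "\<bar>w x - w (z n)\<bar> \<le> H * norm (x - z n) powr \<gamma>" by (rule H(1)[OF x z(1) False])
      then show ?thesis by linarith
    qed (use H(2) in simp)
    have "\<bar>w x\<bar> \<le> 0 + H * norm (x - q) powr \<gamma>"
      by (rule LIMSEQ_le_const[OF lim]) (use le in blast)
    also have "\<dots> \<le> H * norm (x - y) powr \<gamma>"
      using qx H(2,3) by (simp add: mult_left_mono powr_mono2)
    finally show ?thesis .
  qed
  consider "x \<in> \<Omega>" "y \<in> \<Omega>" | "x \<in> \<Omega>" "y \<notin> \<Omega>" | "x \<notin> \<Omega>" "y \<in> \<Omega>" | "x \<notin> \<Omega>" "y \<notin> \<Omega>" by blast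
  then show ?thesis
  proof cases
    case 1
    then show ?thesis using H(1) xy by blast
  next
    case 2
    then show ?thesis using half[of x y] out(1) by simp
  next
    case 3
    then show ?thesis using half[of y x] out(1) by (simp add: norm_minus_commute)
  next
    case 4
    then show ?thesis using H(2) out(1) by simp
  qed
qed

section \<open>Passing to the limit in the energy\<close>

text \<open>
  The proof of the Riesz--Fischer theorem: along a subsequence with integrals below
  \<open>2^{-j}\<close> the sum of all terms is integrable, and it dominates each of them.
\<close>

lemma L1_dominated_subsequence:
  fixes s :: "nat \<Rightarrow> 'a \<Rightarrow> real"
  assumes i: "\<And>k. integrable N (s k)" and nn: "\<And>k x. 0 \<le> s k x" and l: "(\<lambda>k. \<integral>x. s k x \<partial>N) \<longlonglongrightarrow> 0"
  obtains r S where "integrable N S" "AE x in N. (\<lambda>j. s (r j) x) \<longlonglongrightarrow> 0 \<and> (\<forall>j::nat. s (r j) x \<le> S x)"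
proof -
  have "\<exists>k. (\<integral>x. s k x \<partial>N) < (1 / 2) ^ j" for j
    using order_tendstoD(2)[OF l, of "(1 / 2) ^ j"] by (auto simp: eventually_sequentially)
  then obtain r where r: "\<And>j. (\<integral>x. s (r j) x \<partial>N) < (1 / 2) ^ j" by metis
  have [measurable]: "s k \<in> borel_measurable N" for k using i by (rule borel_measurable_integrable)
  define Z where "Z x = (\<Sum>j. ennreal (s (r j) x))" for x
  have [measurable]: "Z \<in> borel_measurable N" unfolding Z_def[abs_def] by measurable
  have "(\<integral>\<^sup>+x. Z x \<partial>N) = (\<Sum>j. \<integral>\<^sup>+x. ennreal (s (r j) x) \<partial>N)"
    unfolding Z_def by (rule nn_integral_suminf) simp
  also have "\<dots> \<le> (\<Sum>j. ennreal ((1 / 2) ^ j))"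
  proof (rule suminf_le)
    show "(\<integral>\<^sup>+x. ennreal (s (r j) x) \<partial>N) \<le> ennreal ((1 / 2) ^ j)" for j
      using r[of j] nn i by (subst nn_integral_eq_integral) (auto intro!: ennreal_leI)
  qed auto
  also have "\<dots> = ennreal (\<Sum>j. (1 / 2) ^ j)"
    by (rule suminf_ennreal2) (auto intro: summable_geometric)
  also have "\<dots> < \<infinity>" by simp
  finally have fin: "(\<integral>\<^sup>+x. Z x \<partial>N) < \<infinity>" .
  then have ae: "AE x in N. Z x \<noteq> \<infinity>" by (intro nn_integral_PInf_AE) auto
  show ?thesis
  proof (rule that[of "\<lambda>x. enn2real (Z x)" r])
    show "integrable N (\<lambda>x. enn2real (Z x))"
      unfolding integrable_iff_bounded
    proof
      have "(\<integral>\<^sup>+x. ennreal (norm (enn2real (Z x))) \<partial>N) \<le> (\<integral>\<^sup>+x. Z x \<partial>N)"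
        by (rule nn_integral_mono) (simp add: ennreal_enn2real_if)
      then show "(\<integral>\<^sup>+x. ennreal (norm (enn2real (Z x))) \<partial>N) < \<infinity>" using fin by (rule le_less_trans)
    qed simp
    show "AE x in N. (\<lambda>j. s (r j) x) \<longlonglongrightarrow> 0 \<and> (\<forall>j. s (r j) x \<le> enn2real (Z x))"
      using ae
    proof eventually_elim
      case (elim x)
      have sm: "summable (\<lambda>j. s (r j) x)"
        by (rule summable_suminf_not_top) (use nn elim in \<open>auto simp: Z_def\<close>)
      have Zx: "enn2real (Z x) = (\<Sum>j. s (r j) x)"
        unfolding Z_def using nn sm by (simp add: suminf_ennreal2 suminf_nonneg)
      have "s (r j) x \<le> (\<Sum>j. s (r j) x)" for j
        using sum_le_suminf[OF sm, of "{j}"] nn by simp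
      then show ?case using summable_LIMSEQ_zero[OF sm] by (simp add: Zx)
    qed
  qed
qed

lemma AE_lborel_imp_lebesgue_on:
  assumes "open \<Omega>" "AE x in lborel. P x"
  shows "AE x in lebesgue_on \<Omega>. P x"
proof -
  have O: "\<Omega> \<inter> space lebesgue \<in> sets lebesgue" using assms(1) by auto
  have "AE x in lebesgue. P x" using assms(2) by (rule AE_completion)
  then show ?thesis unfolding AE_restrict_space_iff[OF O] by (rule eventually_mono) simp
qed

text \<open>
  What the passage to the limit needs: an upper bound by \<open>M\<close> for dominated
  convergence, and nonnegativity so that the energy is the integral of \<open>F\<close> itself.
\<close>

locale growth_setting =
  fixes \<Omega> :: "'a::euclidean_space set" and F :: "'a \<Rightarrow> real \<Rightarrow> 'a \<Rightarrow> real" and M :: "'a \<Rightarrow> 'a \<Rightarrow> real" and L :: real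
  assumes dom: "open \<Omega>" "bounded \<Omega>"
    and reg: "regular_N \<Omega> M" and D2: "Delta2 \<Omega> M"
    and F_meas: "\<And>z \<xi>. (\<lambda>x. F x z \<xi>) \<in> borel_measurable (lebesgue_on \<Omega>)"
    and F_cont: "\<And>x. x \<in> \<Omega> \<Longrightarrow> continuous_on UNIV (\<lambda>(z, \<xi>). F x z \<xi>)"
    and L_nonneg: "0 \<le> L"
    and F_bounds: "\<And>x z \<xi>. x \<in> \<Omega> \<Longrightarrow> 0 \<le> F x z \<xi> \<and> F x z \<xi> \<le> L * (M x \<xi> + 1)"
begin

text \<open>
  The energy as a function of a pair, which need not consist of a function and its chosen weak
  gradient.
\<close>

definition pair_energy :: "('a \<Rightarrow> real) \<Rightarrow> ('a \<Rightarrow> 'a) \<Rightarrow> ennreal" where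
  "pair_energy u g = (\<integral>\<^sup>+x. ennreal (F x (u x) (g x)) \<partial>lebesgue_on \<Omega>)"

lemma AE_in_domain: "AE x in lebesgue_on \<Omega>. x \<in> \<Omega>"
  using AE_space[of "lebesgue_on \<Omega>"] by (simp add: space_restrict_space)

lemma energy_eq_pair_energy: "has_weak_gradient \<Omega> u g \<Longrightarrow> energy \<Omega> F u = pair_energy u g"
  unfolding energy_def pair_energy_def
  by (rule nn_integral_cong_AE, rule eventually_mono[OF weak_gradient_AE[OF dom(1)]]) auto

lemma F_superposition_measurable:
  assumes "u \<in> borel_measurable (lebesgue_on \<Omega>)" "g \<in> borel_measurable (lebesgue_on \<Omega>)"
  shows "(\<lambda>x. F x (u x) (g x)) \<in> borel_measurable (lebesgue_on \<Omega>)"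
proof -
  have "(\<lambda>x. (\<lambda>(z, \<xi>). F x z \<xi>) (u x, g x)) \<in> borel_measurable (lebesgue_on \<Omega>)"
  proof (rule caratheodory_measurable[where H="\<lambda>x (z, \<xi>). F x z \<xi>" and p="\<lambda>x. (u x, g x)"])
    show "(\<lambda>x. (\<lambda>(z, \<xi>). F x z \<xi>) c) \<in> borel_measurable (lebesgue_on \<Omega>)" for c
      using F_meas[of "fst c" "snd c"] by (simp add: case_prod_unfold)
    show "continuous_on UNIV (\<lambda>(z, \<xi>). F x z \<xi>)" if "x \<in> space (lebesgue_on \<Omega>)" for x
      using F_cont that by (simp add: space_restrict_space)
    show "(\<lambda>x. (u x, g x)) \<in> borel_measurable (lebesgue_on \<Omega>)"
      using assms by (rule borel_measurable_Pair)
  qed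
  then show ?thesis by simp
qed

lemma pair_energy_tendsto:
  assumes m: "\<And>k. u k \<in> borel_measurable (lebesgue_on \<Omega>)" "\<And>k. g k \<in> borel_measurable (lebesgue_on \<Omega>)"
      "u' \<in> borel_measurable (lebesgue_on \<Omega>)" "g' \<in> borel_measurable (lebesgue_on \<Omega>)"
    and l: "AE x in lebesgue_on \<Omega>. (\<lambda>k. u k x) \<longlonglongrightarrow> u' x" "AE x in lebesgue_on \<Omega>. (\<lambda>k. g k x) \<longlonglongrightarrow> g' x"
    and D: "integrable (lebesgue_on \<Omega>) D" "\<And>k. AE x in lebesgue_on \<Omega>. M x (g k x) \<le> D x"
  shows "(\<lambda>k. pair_energy (u k) (g k)) \<longlonglongrightarrow> pair_energy u' g'"
  unfolding pair_energy_def
proof (rule nn_integral_dominated_convergence[where w="\<lambda>x. ennreal (L * (D x + 1))"])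
  show "(\<lambda>x. ennreal (F x (u k x) (g k x))) \<in> borel_measurable (lebesgue_on \<Omega>)" for k
    using F_superposition_measurable[OF m(1,2)] by (intro measurable_compose[OF _ measurable_ennreal])
  show "(\<lambda>x. ennreal (F x (u' x) (g' x))) \<in> borel_measurable (lebesgue_on \<Omega>)"
    using F_superposition_measurable[OF m(3,4)] by (intro measurable_compose[OF _ measurable_ennreal])
  have Di: "integrable (lebesgue_on \<Omega>) (\<lambda>x. L * (D x + 1))"
    using D(1) integrable_const_bounded[OF dom, of 1] by simp
  then show "(\<lambda>x. ennreal (L * (D x + 1))) \<in> borel_measurable (lebesgue_on \<Omega>)"
    by (intro measurable_compose[OF _ measurable_ennreal] borel_measurable_integrable)
  have "(\<integral>\<^sup>+x. ennreal (L * (D x + 1)) \<partial>lebesgue_on \<Omega>) \<le> (\<integral>\<^sup>+x. norm (L * (D x + 1)) \<partial>lebesgue_on \<Omega>)"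
    by (rule nn_integral_mono) (simp add: ennreal_leI)
  also have "\<dots> < \<infinity>" using Di[unfolded integrable_iff_bounded, THEN conjunct2] .
  finally show "(\<integral>\<^sup>+x. ennreal (L * (D x + 1)) \<partial>lebesgue_on \<Omega>) < \<infinity>" .
  show "AE x in lebesgue_on \<Omega>. ennreal (F x (u k x) (g k x)) \<le> ennreal (L * (D x + 1))" for k
    using D(2)[of k] AE_in_domain
  proof eventually_elim
    case (elim x)
    have "F x (u k x) (g k x) \<le> L * (M x (g k x) + 1)" using F_bounds[OF elim(2)] by blast
    also have "\<dots> \<le> L * (D x + 1)" using elim(1) L_nonneg by (intro mult_left_mono) auto
    finally show ?case by (rule ennreal_leI)
  qed
  show "AE x in lebesgue_on \<Omega>. (\<lambda>k. ennreal (F x (u k x) (g k x))) \<longlonglongrightarrow> ennreal (F x (u' x) (g' x))"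
    using l AE_in_domain
  proof eventually_elim
    case (elim x)
    have "(\<lambda>k. (u k x, g k x)) \<longlonglongrightarrow> (u' x, g' x)" by (rule tendsto_Pair[OF elim(1,2)])
    from continuous_on_tendsto_compose[OF F_cont[OF elim(3)] this]
    have "(\<lambda>k. F x (u k x) (g k x)) \<longlonglongrightarrow> F x (u' x) (g' x)" by simp
    then show ?case by (rule tendsto_ennrealI)
  qed
qed

text \<open>
  Along a fast subsequence the approximants, their gradients and the dominating functions
  converge almost everywhere with one integrable bound \<open>S\<close> on all deviations.
  Convexity separates the contribution of \<open>u0\<close> from that of the test function, and
  \<open>Delta2\<close> turns the bound at \<open>grad (\<phi> k) x / lam\<close> into one at
  \<open>2 *\<^sub>R grad (\<phi> k) x\<close>.
\<close>

lemma inf_energy_le_of_modular_approx: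
  assumes u0: "u0 \<in> borel_measurable (lebesgue_on \<Omega>)" "has_weak_gradient \<Omega> u0 g0" "g0 \<in> borel_measurable (lebesgue_on \<Omega>)"
    and Mg0: "integrable (lebesgue_on \<Omega>) (\<lambda>x. M x (2 *\<^sub>R g0 x))"
    and ma: "modular_approx \<Omega> M w G"
  shows "(INF u\<in>translate u0 (test_functions \<Omega>). energy \<Omega> F u) \<le> pair_energy (\<lambda>x. u0 x + w x) (\<lambda>x. g0 x + G x)"
proof -
  obtain \<phi> Q P lam where i: "integrable lborel w" "integrable lborel G" and t: "\<And>k. \<phi> k \<in> test_functions \<Omega>"
    and l: "(\<lambda>k. \<integral>x. \<bar>\<phi> k x - w x\<bar> \<partial>lborel) \<longlonglongrightarrow> 0" "(\<lambda>k. \<integral>x. norm (grad (\<phi> k) x - G x) \<partial>lborel) \<longlonglongrightarrow> 0"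
    and P: "integrable lborel P" and Q: "\<And>k. integrable lborel (Q k)" "(\<lambda>k. \<integral>x. \<bar>Q k x - P x\<bar> \<partial>lborel) \<longlonglongrightarrow> 0"
    and lam: "0 < lam" and b: "\<And>k x. x \<in> \<Omega> \<Longrightarrow> M x ((1 / lam) *\<^sub>R grad (\<phi> k) x) \<le> Q k x"
    using ma unfolding modular_approx_def by blast
  have tU: "\<phi> k \<in> test_functions UNIV" for k using t test_functions_mono by blast
  note ti = test_functions_integrable[OF t]
  define s where "s k x = \<bar>\<phi> k x - w x\<bar> + norm (grad (\<phi> k) x - G x) + \<bar>Q k x - P x\<bar>" for k x
  have si: "integrable lborel (\<lambda>x. \<bar>\<phi> k x - w x\<bar>)" "integrable lborel (\<lambda>x. norm (grad (\<phi> k) x - G x))"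
    "integrable lborel (\<lambda>x. \<bar>Q k x - P x\<bar>)" for k
    using ti[of k] i P Q(1)[of k] by simp_all
  have s_int: "integrable lborel (s k)" for k unfolding s_def[abs_def] using si[of k] by simp
  have "(\<integral>x. s k x \<partial>lborel) = (\<integral>x. \<bar>\<phi> k x - w x\<bar> \<partial>lborel) + (\<integral>x. norm (grad (\<phi> k) x - G x) \<partial>lborel) + (\<integral>x. \<bar>Q k x - P x\<bar> \<partial>lborel)" for k
    unfolding s_def using si[of k] by simp
  then have s_lim: "(\<lambda>k. \<integral>x. s k x \<partial>lborel) \<longlonglongrightarrow> 0"
    using tendsto_add[OF tendsto_add[OF l] Q(2)] by simp
  have s_nn: "0 \<le> s k x" for k x by (simp add: s_def)
  obtain r S where S: "integrable lborel S" "AE x in lborel. (\<lambda>j. s (r j) x) \<longlonglongrightarrow> 0 \<and> (\<forall>j::nat. s (r j) x \<le> S x)"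
    by (rule L1_dominated_subsequence[OF s_int s_nn s_lim]) (rule that)
  have ae: "AE x in lebesgue_on \<Omega>. (\<lambda>j. s (r j) x) \<longlonglongrightarrow> 0 \<and> (\<forall>j. s (r j) x \<le> S x)"
    by (rule AE_lborel_imp_lebesgue_on[OF dom(1) S(2)])
  obtain c h where c: "0 \<le> c" and h: "integrable (lebesgue_on \<Omega>) h"
    and ch: "AE x in lebesgue_on \<Omega>. \<forall>\<xi>. M x ((2 * lam) *\<^sub>R \<xi>) \<le> c * M x \<xi> + h x"
    using Delta2_scale[OF dom reg D2, of "2 * lam"] by blast
  let ?D = "\<lambda>x. M x (2 *\<^sub>R g0 x) + (c * (\<bar>P x\<bar> + S x) + h x)"
  have wm: "w \<in> borel_measurable (lebesgue_on \<Omega>)" "G \<in> borel_measurable (lebesgue_on \<Omega>)"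
    using i by (auto intro!: borel_measurable_lebesgue_on_borel dest: borel_measurable_integrable)
  have tm: "\<phi> k \<in> borel_measurable (lebesgue_on \<Omega>)" "grad (\<phi> k) \<in> borel_measurable (lebesgue_on \<Omega>)" for k
    using test_functions_borel[OF t] test_functions_borel_grad[OF t] borel_measurable_lebesgue_on_borel by blast+
  have lim: "(\<lambda>j. pair_energy (\<lambda>x. u0 x + \<phi> (r j) x) (\<lambda>x. g0 x + grad (\<phi> (r j)) x))
      \<longlonglongrightarrow> pair_energy (\<lambda>x. u0 x + w x) (\<lambda>x. g0 x + G x)"
  proof (rule pair_energy_tendsto)
    show "(\<lambda>x. u0 x + \<phi> (r j) x) \<in> borel_measurable (lebesgue_on \<Omega>)" for j by (rule borel_measurable_add[OF u0(1) tm(1)])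
    show "(\<lambda>x. g0 x + grad (\<phi> (r j)) x) \<in> borel_measurable (lebesgue_on \<Omega>)" for j by (rule borel_measurable_add[OF u0(3) tm(2)])
    show "(\<lambda>x. u0 x + w x) \<in> borel_measurable (lebesgue_on \<Omega>)" by (rule borel_measurable_add[OF u0(1) wm(1)])
    show "(\<lambda>x. g0 x + G x) \<in> borel_measurable (lebesgue_on \<Omega>)" by (rule borel_measurable_add[OF u0(3) wm(2)])
    show "AE x in lebesgue_on \<Omega>. (\<lambda>j. u0 x + \<phi> (r j) x) \<longlonglongrightarrow> u0 x + w x"
      using ae
    proof eventually_elim
      case (elim x)
      have "(\<lambda>j. \<phi> (r j) x - w x) \<longlonglongrightarrow> 0"
        by (rule Lim_null_comparison[OF always_eventually conjunct1[OF elim]]) (simp add: s_def)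
      then show ?case by (intro tendsto_add tendsto_const) (rule LIM_zero_cancel)
    qed
    show "AE x in lebesgue_on \<Omega>. (\<lambda>j. g0 x + grad (\<phi> (r j)) x) \<longlonglongrightarrow> g0 x + G x"
      using ae
    proof eventually_elim
      case (elim x)
      have "(\<lambda>j. grad (\<phi> (r j)) x - G x) \<longlonglongrightarrow> 0"
        by (rule Lim_null_comparison[OF always_eventually conjunct1[OF elim]]) (simp add: s_def)
      then show ?case by (intro tendsto_add tendsto_const) (rule LIM_zero_cancel)
    qed
    show "integrable (lebesgue_on \<Omega>) ?D"
      using Mg0 h integrable_lborel_imp_lebesgue_on[OF dom(1) integrable_abs[OF P]] integrable_lborel_imp_lebesgue_on[OF dom(1) S(1)]
      by simp
    show "AE x in lebesgue_on \<Omega>. M x (g0 x + grad (\<phi> (r j)) x) \<le> ?D x" for j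
      using ae ch AE_in_domain
    proof eventually_elim
      case (elim x)
      have "M x (g0 x + grad (\<phi> (r j)) x) \<le> M x (2 *\<^sub>R g0 x) + M x (2 *\<^sub>R grad (\<phi> (r j)) x)"
        by (rule regular_N_add[OF reg elim(3)])
      also have "M x (2 *\<^sub>R grad (\<phi> (r j)) x) = M x ((2 * lam) *\<^sub>R ((1 / lam) *\<^sub>R grad (\<phi> (r j)) x))"
        using lam by simp
      also have "\<dots> \<le> c * M x ((1 / lam) *\<^sub>R grad (\<phi> (r j)) x) + h x" using elim(2) by blast
      also have "\<dots> \<le> c * (\<bar>P x\<bar> + S x) + h x"
      proof (intro add_right_mono mult_left_mono c)
        have "\<bar>Q (r j) x - P x\<bar> \<le> S x" using elim(1) unfolding s_def by (smt (verit) abs_ge_zero norm_ge_zero)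
        then show "M x ((1 / lam) *\<^sub>R grad (\<phi> (r j)) x) \<le> \<bar>P x\<bar> + S x" using b[OF elim(3), of "r j"] by linarith
      qed
      finally show ?case by simp
    qed
  qed
  show ?thesis
  proof (rule LIMSEQ_le_const[OF lim], intro exI[of _ 0] allI impI)
    fix j
    have "energy \<Omega> F (\<lambda>x. u0 x + \<phi> (r j) x) = pair_energy (\<lambda>x. u0 x + \<phi> (r j) x) (\<lambda>x. g0 x + grad (\<phi> (r j)) x)"
      by (rule energy_eq_pair_energy[OF has_weak_gradient_add[OF dom(1) u0(2) has_weak_gradient_test[OF dom(1) tU]]])
    moreover have "(\<lambda>x. u0 x + \<phi> (r j) x) \<in> translate u0 (test_functions \<Omega>)"
      using t by (auto simp: translate_def)
    ultimately show "(INF u\<in>translate u0 (test_functions \<Omega>). energy \<Omega> F u) \<le> pair_energy (\<lambda>x. u0 x + \<phi> (r j) x) (\<lambda>x. g0 x + grad (\<phi> (r j)) x)"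
      by (metis INF_lower)
  qed
qed

lemma V1_L_data:
  assumes "u0 \<in> V1_L \<Omega> M"
  shows "u0 \<in> borel_measurable (lebesgue_on \<Omega>)" "has_weak_gradient \<Omega> u0 (weak_gradient \<Omega> u0)"
    "weak_gradient \<Omega> u0 \<in> borel_measurable (lebesgue_on \<Omega>)"
    "integrable (lebesgue_on \<Omega>) (\<lambda>x. M x (A *\<^sub>R weak_gradient \<Omega> u0 x))"
proof -
  have u: "u0 \<in> W11 \<Omega>" "weak_gradient \<Omega> u0 \<in> L_M \<Omega> M" using assms by (auto simp: V1_L_def)
  show "u0 \<in> borel_measurable (lebesgue_on \<Omega>)" using u(1) by (auto simp: W11_def)
  show "has_weak_gradient \<Omega> u0 (weak_gradient \<Omega> u0)"
    using u(1) has_weak_gradient_weak_gradient by (auto simp: W11_def)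
  show "weak_gradient \<Omega> u0 \<in> borel_measurable (lebesgue_on \<Omega>)"
    "integrable (lebesgue_on \<Omega>) (\<lambda>x. M x (A *\<^sub>R weak_gradient \<Omega> u0 x))"
    using L_M_modular[OF dom reg D2 u(2)] by auto
qed

text \<open>
  A competitor as a pair of Borel functions on the whole space: the hypotheses of the
  approximation theorem except Hoelder continuity.
\<close>

lemma V1_0_L_extension:
  assumes v: "v \<in> V1_0_L \<Omega> M"
    and w: "w \<in> borel_measurable borel" "\<And>x. x \<notin> \<Omega> \<Longrightarrow> w x = 0" "AE x in lebesgue_on \<Omega>. v x = w x"
  obtains G where "test_limit w G" "\<And>x. x \<notin> \<Omega> \<Longrightarrow> G x = 0" "AE x in lebesgue_on \<Omega>. weak_gradient \<Omega> v x = G x"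
    "\<And>A. integrable (lebesgue_on \<Omega>) (\<lambda>x. M x (A *\<^sub>R G x))"
proof -
  have vW: "v \<in> W11_0 \<Omega>" "v \<in> V1_L \<Omega> M" using v by (auto simp: V1_0_L_def V1_L_def W11_0_def)
  have Ob: "\<Omega> \<in> sets borel" using dom(1) by simp
  obtain G where G: "G \<in> borel_measurable borel" "\<And>x. x \<notin> \<Omega> \<Longrightarrow> G x = 0" "AE x in lebesgue_on \<Omega>. weak_gradient \<Omega> v x = G x"
    using lebesgue_measurable_borel_version[OF V1_L_data(3)[OF vW(2)] Ob] by blast
  show ?thesis
  proof (rule that[OF _ G(2,3)])
    show "test_limit w G" by (rule W11_0_extension[OF dom(1) vW(1) w G])
    show "integrable (lebesgue_on \<Omega>) (\<lambda>x. M x (A *\<^sub>R G x))" for A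
    proof (rule integrable_cong_AE_imp[OF V1_L_data(4)[OF vW(2), of A]])
      show "(\<lambda>x. M x (A *\<^sub>R G x)) \<in> borel_measurable (lebesgue_on \<Omega>)"
        by (rule regular_N_measurable[OF dom(1) reg])
          (rule borel_measurable_lebesgue_on_borel[OF borel_measurable_scaleR[OF borel_measurable_const G(1)]])
      show "AE x in lebesgue_on \<Omega>. M x (A *\<^sub>R weak_gradient \<Omega> v x) = M x (A *\<^sub>R G x)"
        using G(3) by (rule eventually_mono) simp
    qed
  qed
qed

lemma energy_translate_eq:
  assumes u0: "u0 \<in> V1_L \<Omega> M" and v: "v \<in> V1_0_L \<Omega> M"
    and ae: "AE x in lebesgue_on \<Omega>. v x = w x" "AE x in lebesgue_on \<Omega>. weak_gradient \<Omega> v x = G x"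
  shows "energy \<Omega> F (\<lambda>x. u0 x + v x) = pair_energy (\<lambda>x. u0 x + w x) (\<lambda>x. weak_gradient \<Omega> u0 x + G x)"
proof -
  have "v \<in> V1_L \<Omega> M" using v by (auto simp: V1_0_L_def V1_L_def W11_0_def)
  note hv = V1_L_data(2)[OF this]
  have "energy \<Omega> F (\<lambda>x. u0 x + v x) = pair_energy (\<lambda>x. u0 x + v x) (\<lambda>x. weak_gradient \<Omega> u0 x + weak_gradient \<Omega> v x)"
    by (rule energy_eq_pair_energy[OF has_weak_gradient_add[OF dom(1) V1_L_data(2)[OF u0] hv]])
  also have "\<dots> = pair_energy (\<lambda>x. u0 x + w x) (\<lambda>x. weak_gradient \<Omega> u0 x + G x)"
    unfolding pair_energy_def
  proof (rule nn_integral_cong_AE)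
    show "AE x in lebesgue_on \<Omega>. ennreal (F x (u0 x + v x) (weak_gradient \<Omega> u0 x + weak_gradient \<Omega> v x))
        = ennreal (F x (u0 x + w x) (weak_gradient \<Omega> u0 x + G x))"
      using ae by eventually_elim simp
  qed
  finally show ?thesis .
qed

text \<open>
  The zero extension of a Hoelder competitor is Hoelder on the whole space by
  \<open>test_limit_holder_extension\<close>, so the approximation theorem applies to it.
\<close>

proposition inf_energy_le_holder:
  assumes L: "lipschitz_domain \<Omega>" and J: "jensen_condition \<gamma> \<Omega> M" and g: "0 < \<gamma>" "\<gamma> \<le> 1"
    and u0: "u0 \<in> V1_L \<Omega> M" and v: "v \<in> V1_0_L \<Omega> M" "v \<in> holder_functions \<gamma> \<Omega>"
  shows "(INF u\<in>translate u0 (test_functions \<Omega>). energy \<Omega> F u) \<le> energy \<Omega> F (\<lambda>x. u0 x + v x)"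
proof -
  obtain H0 where H0: "\<And>x y. x \<in> \<Omega> \<Longrightarrow> y \<in> \<Omega> \<Longrightarrow> x \<noteq> y \<Longrightarrow> \<bar>v x - v y\<bar> / norm (x - y) powr \<gamma> \<le> H0"
    using v(2) unfolding holder_functions_def bdd_above_def by blast
  define H where "H = max 0 H0"
  have H: "0 \<le> H" "\<bar>v x - v y\<bar> \<le> H * norm (x - y) powr \<gamma>" if "x \<in> \<Omega>" "y \<in> \<Omega>" "x \<noteq> y" for x y
  proof -
    have "0 < norm (x - y) powr \<gamma>" using that(3) by simp
    then have "\<bar>v x - v y\<bar> \<le> H0 * norm (x - y) powr \<gamma>" using H0[OF that] by (simp add: divide_le_eq)
    also have "\<dots> \<le> H * norm (x - y) powr \<gamma>" by (intro mult_right_mono) (auto simp: H_def)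
    finally show "\<bar>v x - v y\<bar> \<le> H * norm (x - y) powr \<gamma>" .
  qed (simp add: H_def)
  have Hnn: "0 \<le> H" by (simp add: H_def)
  have cont: "continuous_on \<Omega> v"
    unfolding continuous_on_def
  proof
    fix x assume x: "x \<in> \<Omega>"
    have "((\<lambda>y. H * norm (y - x) powr \<gamma>) \<longlongrightarrow> H * norm (x - x) powr \<gamma>) (at x within \<Omega>)"
      using g(1) by (intro tendsto_mult tendsto_const tendsto_powr' tendsto_norm tendsto_diff tendsto_ident_at) auto
    then have lim: "((\<lambda>y. H * norm (y - x) powr \<gamma>) \<longlongrightarrow> 0) (at x within \<Omega>)" by simp
    have "eventually (\<lambda>y. norm (v y - v x) \<le> H * norm (y - x) powr \<gamma>) (at x within \<Omega>)"
      unfolding eventually_at_filter using H(2)[OF _ x] by (intro always_eventually) auto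
    then have "((\<lambda>y. v y - v x) \<longlongrightarrow> 0) (at x within \<Omega>)" by (rule Lim_null_comparison[OF _ lim])
    then show "(v \<longlongrightarrow> v x) (at x within \<Omega>)" by (rule LIM_zero_cancel)
  qed
  define w where "w x = indicator \<Omega> x *\<^sub>R v x" for x
  have w: "w \<in> borel_measurable borel" "\<And>x. x \<notin> \<Omega> \<Longrightarrow> w x = 0"
  proof -
    have "\<Omega> \<in> sets borel" using dom(1) by simp
    then show "w \<in> borel_measurable borel"
      unfolding w_def[abs_def] using cont by (rule borel_measurable_continuous_on_indicator)
  qed (simp add: w_def)
  have wv: "w x = v x" if "x \<in> \<Omega>" for x using that by (simp add: w_def)
  have ae: "AE x in lebesgue_on \<Omega>. v x = w x"
    using AE_in_domain by (rule eventually_mono) (simp add: wv)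
  obtain G where G: "test_limit w G" "\<And>x. x \<notin> \<Omega> \<Longrightarrow> G x = 0" "AE x in lebesgue_on \<Omega>. weak_gradient \<Omega> v x = G x"
    "\<And>A. integrable (lebesgue_on \<Omega>) (\<lambda>x. M x (A *\<^sub>R G x))"
    by (rule V1_0_L_extension[OF v(1) w ae], assumption, rule that)
  have Hw: "\<bar>w x - w y\<bar> \<le> H * norm (x - y) powr \<gamma>" if "x \<noteq> y" for x y
  proof (rule test_limit_holder_extension[OF L G(1) w(2) G(2) _ Hnn g(1) that])
    show "\<bar>w x - w y\<bar> \<le> H * norm (x - y) powr \<gamma>" if "x \<in> \<Omega>" "y \<in> \<Omega>" "x \<noteq> y" for x y
      using H(2)[OF that] that by (simp add: wv)
  qed
  have "modular_approx \<Omega> M w G"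
    by (rule modular_approx_lipschitz_domain[OF dom(2) L reg J less_imp_le[OF g(1)] g(2) G(1) Hw Hnn w(2) G(2) G(4)])
  then show ?thesis
    unfolding energy_translate_eq[OF u0 v(1) ae G(3)]
    by (rule inf_energy_le_of_modular_approx[OF V1_L_data(1,2,3)[OF u0] V1_L_data(4)[OF u0]])
qed

text \<open>
  The functions \<open>j * sin (v / j)\<close> are bounded smooth truncations of
  \<open>v\<close> with gradients \<open>cos (v / j) *\<^sub>R G\<close>, where \<open>G\<close>
  is the gradient of \<open>v\<close>. They converge pointwise with their gradients, and
  \<open>M\<close> of the gradients is at most \<open>M\<close> of \<open>G\<close>. So the
  infimum, which is at most the energy of \<open>u0\<close> plus any of them, is at most that of
  \<open>u0 + v\<close>.
\<close>

proposition inf_energy_le_unrestricted: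
  assumes L: "lipschitz_domain \<Omega>" and J: "jensen_condition 0 \<Omega> M"
    and u0: "u0 \<in> V1_L \<Omega> M" and v: "v \<in> V1_0_L \<Omega> M"
  shows "(INF u\<in>translate u0 (test_functions \<Omega>). energy \<Omega> F u) \<le> energy \<Omega> F (\<lambda>x. u0 x + v x)"
proof -
  have Ob: "\<Omega> \<in> sets borel" using dom(1) by simp
  have "v \<in> V1_L \<Omega> M" using v by (auto simp: V1_0_L_def V1_L_def W11_0_def)
  from V1_L_data(1)[OF this] obtain w where w: "w \<in> borel_measurable borel" "\<And>x. x \<notin> \<Omega> \<Longrightarrow> w x = 0" "AE x in lebesgue_on \<Omega>. v x = w x"
    using lebesgue_measurable_borel_version[OF _ Ob] by blast
  obtain G where G: "test_limit w G" "\<And>x. x \<notin> \<Omega> \<Longrightarrow> G x = 0" "AE x in lebesgue_on \<Omega>. weak_gradient \<Omega> v x = G x"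
    "\<And>A. integrable (lebesgue_on \<Omega>) (\<lambda>x. M x (A *\<^sub>R G x))"
    by (rule V1_0_L_extension[OF v w], assumption, rule that)
  have Gb: "G \<in> borel_measurable borel" using G(1) by (auto simp: test_limit_def dest: borel_measurable_integrable)
  define j where "j n = real (Suc n)" for n
  have j: "j n > 0" for n by (simp add: j_def)
  let ?w = "\<lambda>n x. j n * sin (1 / j n * w x)" and ?G = "\<lambda>n x. cos (1 / j n * w x) *\<^sub>R G x"
  have W: "test_limit (?w n) (?G n)" for n
  proof -
    have D: "((\<lambda>t. j n * sin (1 / j n * t)) has_real_derivative cos (1 / j n * t)) (at t)" for t
      using j[of n] by (auto intro!: derivative_eq_intros)
    have c: "continuous_on UNIV (\<lambda>t. cos (1 / j n * t))" by (intro continuous_intros)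
    have ab: "\<bar>cos (1 / j n * t)\<bar> \<le> 1" for t by simp
    show ?thesis by (rule test_limit_compose[OF G(1) smooth_sin _ D c ab]) simp
  qed
  have MG: "M x (A *\<^sub>R ?G n x) \<le> M x (A *\<^sub>R G x)" if "x \<in> \<Omega>" for x A n
  proof -
    have "\<bar>A * cos (1 / j n * w x)\<bar> \<le> \<bar>A\<bar>"
      using mult_left_mono[OF abs_cos_le_one[of "1 / j n * w x"] abs_ge_zero[of A]] by (simp add: abs_mult)
    from regular_N_scale_mono[OF reg that this, of "G x"] show ?thesis by simp
  qed
  have wm: "?w n \<in> borel_measurable borel" "?G n \<in> borel_measurable borel" for n
    using w(1) Gb by (simp_all add: borel_measurable_scaleR)
  have ma: "modular_approx \<Omega> M (?w n) (?G n)" for n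
  proof (rule modular_approx_lipschitz_domain[OF dom(2) L reg J _ _ W])
    \<comment> \<open>Boundedness is Hoelder continuity with exponent \<open>0\<close>, as
      \<open>norm (x - y) powr 0 = 1\<close> for \<open>x \<noteq> y\<close>.\<close>
    show "\<bar>?w n x - ?w n y\<bar> \<le> (2 * j n) * norm (x - y) powr 0" if "x \<noteq> y" for x y
    proof -
      have "\<bar>?w n x\<bar> \<le> j n" for x using j[of n] by (simp add: abs_mult)
      from this[of x] this[of y] have "\<bar>?w n x - ?w n y\<bar> \<le> 2 * j n" by linarith
      then show ?thesis using that by simp
    qed
    show "integrable (lebesgue_on \<Omega>) (\<lambda>x. M x (A *\<^sub>R ?G n x))" for A
    proof (rule Bochner_Integration.integrable_bound[OF G(4)[of A]])
      show "(\<lambda>x. M x (A *\<^sub>R ?G n x)) \<in> borel_measurable (lebesgue_on \<Omega>)"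
        by (rule regular_N_measurable[OF dom(1) reg])
          (rule borel_measurable_lebesgue_on_borel[OF borel_measurable_scaleR[OF borel_measurable_const wm(2)]])
      show "AE x in lebesgue_on \<Omega>. norm (M x (A *\<^sub>R ?G n x)) \<le> norm (M x (A *\<^sub>R G x))"
        using AE_in_domain
      proof eventually_elim
        case (elim x)
        show ?case using MG[OF elim, of A n] regular_N_nonneg[OF reg elim] by simp
      qed
    qed
  qed (use j[of n] in \<open>simp_all add: w G\<close>)
  let ?g0 = "weak_gradient \<Omega> u0"
  note d0 = V1_L_data[OF u0]
  have le: "(INF u\<in>translate u0 (test_functions \<Omega>). energy \<Omega> F u) \<le> pair_energy (\<lambda>x. u0 x + ?w n x) (\<lambda>x. ?g0 x + ?G n x)" for n
    by (rule inf_energy_le_of_modular_approx[OF d0(1,2,3,4) ma])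
  have j0: "(\<lambda>n. 1 / j n) \<longlonglongrightarrow> 0"
    using LIMSEQ_inverse_real_of_nat by (simp add: j_def inverse_eq_divide)
  have "(\<lambda>n. pair_energy (\<lambda>x. u0 x + ?w n x) (\<lambda>x. ?g0 x + ?G n x)) \<longlonglongrightarrow> pair_energy (\<lambda>x. u0 x + w x) (\<lambda>x. ?g0 x + G x)"
  proof (rule pair_energy_tendsto)
    show "(\<lambda>x. u0 x + ?w n x) \<in> borel_measurable (lebesgue_on \<Omega>)" for n
      by (rule borel_measurable_add[OF d0(1) borel_measurable_lebesgue_on_borel[OF wm(1)]])
    show "(\<lambda>x. ?g0 x + ?G n x) \<in> borel_measurable (lebesgue_on \<Omega>)" for n
      by (rule borel_measurable_add[OF d0(3) borel_measurable_lebesgue_on_borel[OF wm(2)]])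
    show "(\<lambda>x. u0 x + w x) \<in> borel_measurable (lebesgue_on \<Omega>)"
      by (rule borel_measurable_add[OF d0(1) borel_measurable_lebesgue_on_borel[OF w(1)]])
    show "(\<lambda>x. ?g0 x + G x) \<in> borel_measurable (lebesgue_on \<Omega>)"
      by (rule borel_measurable_add[OF d0(3) borel_measurable_lebesgue_on_borel[OF Gb]])
    show "AE x in lebesgue_on \<Omega>. (\<lambda>n. u0 x + ?w n x) \<longlonglongrightarrow> u0 x + w x"
    proof (rule AE_I2, intro tendsto_add tendsto_const)
      fix x
      have "((\<lambda>t. sin (w x * t)) has_real_derivative w x) (at 0)"
        by (auto intro!: derivative_eq_intros)
      then have "((\<lambda>t. (sin (w x * t)) / t) \<longlongrightarrow> w x) (at 0)" by (simp add: DERIV_def)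
      moreover have "filterlim (\<lambda>n. 1 / j n) (at 0) sequentially"
        using j0 j by (intro filterlim_atI) (auto simp: less_imp_neq[symmetric] intro: always_eventually)
      ultimately have "(\<lambda>n. (sin (w x * (1 / j n))) / (1 / j n)) \<longlonglongrightarrow> w x" by (rule filterlim_compose)
      then show "(\<lambda>n. ?w n x) \<longlonglongrightarrow> w x" by (simp add: mult.commute)
    qed
    show "AE x in lebesgue_on \<Omega>. (\<lambda>n. ?g0 x + ?G n x) \<longlonglongrightarrow> ?g0 x + G x"
    proof (rule AE_I2, intro tendsto_add tendsto_const)
      fix x
      have "(\<lambda>n. cos (1 / j n * w x) *\<^sub>R G x) \<longlonglongrightarrow> cos (0 * w x) *\<^sub>R G x"
        by (intro tendsto_scaleR tendsto_cos tendsto_mult tendsto_const j0)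
      then show "(\<lambda>n. ?G n x) \<longlonglongrightarrow> G x" by simp
    qed
    show "integrable (lebesgue_on \<Omega>) (\<lambda>x. M x (2 *\<^sub>R ?g0 x) + M x (2 *\<^sub>R G x))"
      using d0(4)[of 2] G(4)[of 2] by simp
    show "AE x in lebesgue_on \<Omega>. M x (?g0 x + ?G n x) \<le> M x (2 *\<^sub>R ?g0 x) + M x (2 *\<^sub>R G x)" for n
      using AE_in_domain
    proof eventually_elim
      case (elim x)
      show ?case using regular_N_add[OF reg elim, of "?g0 x" "?G n x"] MG[OF elim, of 2 n] by linarith
    qed
  qed
  then have "(INF u\<in>translate u0 (test_functions \<Omega>). energy \<Omega> F u) \<le> pair_energy (\<lambda>x. u0 x + w x) (\<lambda>x. ?g0 x + G x)"
    by (rule LIMSEQ_le_const) (use le in blast)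
  then show ?thesis unfolding energy_translate_eq[OF u0 v w(3) G(3)] .
qed

lemma inf_energy_eq:
  assumes sub: "test_functions \<Omega> \<subseteq> V"
    and le: "\<And>v. v \<in> V \<Longrightarrow> (INF u\<in>translate u0 (test_functions \<Omega>). energy \<Omega> F u) \<le> energy \<Omega> F (\<lambda>x. u0 x + v x)"
  shows "(INF u\<in>translate u0 V. energy \<Omega> F u) = (INF u\<in>translate u0 (test_functions \<Omega>). energy \<Omega> F u)"
proof (rule antisym)
  show "(INF u\<in>translate u0 V. energy \<Omega> F u) \<le> (INF u\<in>translate u0 (test_functions \<Omega>). energy \<Omega> F u)"
    by (rule INF_superset_mono) (use sub in \<open>auto simp: translate_def\<close>)
  show "(INF u\<in>translate u0 (test_functions \<Omega>). energy \<Omega> F u) \<le> (INF u\<in>translate u0 V. energy \<Omega> F u)"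
    by (rule INF_greatest) (use le in \<open>auto simp: translate_def\<close>)
qed

end

lemma test_functions_holder:
  fixes \<Omega> :: "'a::euclidean_space set"
  assumes b: "bounded \<Omega>" and t: "\<phi> \<in> test_functions \<Omega>" and g: "\<gamma> \<le> 1"
  shows "\<phi> \<in> holder_functions \<gamma> \<Omega>"
proof -
  obtain B where B: "B > 0" "\<And>x. norm (grad \<phi> x) \<le> B" using test_functions_bounded[OF t] by metis
  obtain D where D: "\<And>x. x \<in> \<Omega> \<Longrightarrow> norm x \<le> D" using b unfolding bounded_iff by blast
  have "\<bar>\<phi> x - \<phi> y\<bar> / norm (x - y) powr \<gamma> \<le> B * (2 * D) powr (1 - \<gamma>)" if xy: "x \<in> \<Omega>" "y \<in> \<Omega>" "x \<noteq> y" for x y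
  proof -
    let ?d = "norm (x - y)"
    have d: "0 < ?d" "?d \<le> 2 * D"
      using xy(3) D[OF xy(1)] D[OF xy(2)] norm_triangle_ineq4[of x y] by auto
    have "\<bar>\<phi> x - \<phi> y\<bar> \<le> B * ?d"
      by (rule grad_bound_imp_lipschitz[OF smooth_differentiable[OF test_functions_smooth[OF t]] B(2)])
    then have "\<bar>\<phi> x - \<phi> y\<bar> / ?d powr \<gamma> \<le> B * ?d / ?d powr \<gamma>" by (intro divide_right_mono) auto
    also have "\<dots> = B * ?d powr (1 - \<gamma>)" using d(1) by (simp add: powr_diff)
    also have "\<dots> \<le> B * (2 * D) powr (1 - \<gamma>)"
      using d B(1) g by (intro mult_left_mono powr_mono2) auto
    finally show ?thesis .
  qed
  then show ?thesis
    unfolding holder_functions_def bdd_above_def by (auto intro!: exI[of _ "B * (2 * D) powr (1 - \<gamma>)"])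
qed

theorem theorem1:
  fixes \<Omega> :: "(real^'n) set"
    and F :: "real^'n \<Rightarrow> real \<Rightarrow> real^'n \<Rightarrow> real"
    and M :: "real^'n \<Rightarrow> real^'n \<Rightarrow> real"
    and \<nu> \<beta> L :: real
  assumes domain: "bounded \<Omega>" "lipschitz_domain \<Omega>"
    and F_measurable: "\<And>z \<xi>. (\<lambda>x. F x z \<xi>) \<in> borel_measurable (lebesgue_on \<Omega>)"
    and F_continuous: "\<And>x. x \<in> \<Omega> \<Longrightarrow> continuous_on UNIV (\<lambda>(z, \<xi>). F x z \<xi>)"
    and M_weak_N: "weak_N_function \<Omega> M"
    and M_continuous: "continuous_on (\<Omega> \<times> UNIV) (\<lambda>(x, \<xi>). M x \<xi>)"
    and M_Delta2: "Delta2 \<Omega> M"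
    and constants: "0 < \<nu>" "\<nu> < 1" "0 < \<beta>" "\<beta> < 1" "1 < L"
    and growth: "\<And>x z \<xi>. x \<in> \<Omega> \<Longrightarrow>
        \<nu> * M x (\<beta> *\<^sub>R \<xi>) \<le> F x z \<xi> \<and> F x z \<xi> \<le> L * (M x \<xi> + 1)"
  shows "(\<forall>u0. u0 \<in> V1_L \<Omega> M \<and> (B_iso 0 \<Omega> M \<or> B_ort 0 \<Omega> M) \<longrightarrow>
            (INF u\<in>translate u0 (V1_0_L \<Omega> M). energy \<Omega> F u) =
            (INF u\<in>translate u0 (test_functions \<Omega>). energy \<Omega> F u)) \<and>
         (\<forall>\<gamma> u0. 0 < \<gamma> \<and> \<gamma> < 1 \<and> u0 \<in> V1_L \<Omega> M \<inter> holder_functions \<gamma> \<Omega> \<and>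
            (B_iso \<gamma> \<Omega> M \<or> B_ort \<gamma> \<Omega> M) \<longrightarrow>
            (INF u\<in>translate u0 (V1_0_L \<Omega> M \<inter> holder_functions \<gamma> \<Omega>). energy \<Omega> F u) =
            (INF u\<in>translate u0 (test_functions \<Omega>). energy \<Omega> F u)) \<and>
         (\<forall>u0. u0 \<in> V1_L \<Omega> M \<inter> holder_functions 1 \<Omega> \<longrightarrow>
            (INF u\<in>translate u0 (V1_0_L \<Omega> M \<inter> holder_functions 1 \<Omega>). energy \<Omega> F u) =
            (INF u\<in>translate u0 (test_functions \<Omega>). energy \<Omega> F u))"
proof -
  have O: "open \<Omega>" using domain(2) by (simp add: lipschitz_domain_def)
  have reg: "regular_N \<Omega> M" by (rule weak_N_function_regular[OF O M_weak_N M_continuous])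
  interpret growth_setting \<Omega> F M L
  proof
    show "0 \<le> F x z \<xi> \<and> F x z \<xi> \<le> L * (M x \<xi> + 1)" if "x \<in> \<Omega>" for x z \<xi>
    proof -
      have "0 \<le> \<nu> * M x (\<beta> *\<^sub>R \<xi>)" using constants(1) regular_N_nonneg[OF reg that] by simp
      then show ?thesis using growth[OF that, of \<xi> z] by linarith
    qed
  qed (use O domain reg M_Delta2 F_measurable F_continuous constants in auto)
  have J: "jensen_condition \<gamma> \<Omega> M" if "B_iso \<gamma> \<Omega> M \<or> B_ort \<gamma> \<Omega> M" for \<gamma>
    using that jensen_condition_iso[OF O reg] jensen_condition_ort[OF O reg] by blast
  have sub: "test_functions \<Omega> \<subseteq> V1_0_L \<Omega> M"
    using test_functions_V1_0_L[OF O domain(1) reg] by blast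
  have sub': "test_functions \<Omega> \<subseteq> V1_0_L \<Omega> M \<inter> holder_functions \<gamma> \<Omega>" if "\<gamma> \<le> 1" for \<gamma>
    using sub test_functions_holder[OF domain(1) _ that] by blast
  show ?thesis
  proof (intro conjI allI impI)
    fix u0 assume *: "u0 \<in> V1_L \<Omega> M \<and> (B_iso 0 \<Omega> M \<or> B_ort 0 \<Omega> M)"
    show "(INF u\<in>translate u0 (V1_0_L \<Omega> M). energy \<Omega> F u) = (INF u\<in>translate u0 (test_functions \<Omega>). energy \<Omega> F u)"
      by (rule inf_energy_eq[OF sub]) (use * J in \<open>blast intro: inf_energy_le_unrestricted[OF domain(2)]\<close>)
  next
    fix \<gamma> u0 assume *: "0 < \<gamma> \<and> \<gamma> < 1 \<and> u0 \<in> V1_L \<Omega> M \<inter> holder_functions \<gamma> \<Omega> \<and> (B_iso \<gamma> \<Omega> M \<or> B_ort \<gamma> \<Omega> M)"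
    then have g: "0 < \<gamma>" "\<gamma> \<le> 1" and u0: "u0 \<in> V1_L \<Omega> M" and Jg: "jensen_condition \<gamma> \<Omega> M" using J by auto
    show "(INF u\<in>translate u0 (V1_0_L \<Omega> M \<inter> holder_functions \<gamma> \<Omega>). energy \<Omega> F u) = (INF u\<in>translate u0 (test_functions \<Omega>). energy \<Omega> F u)"
      by (rule inf_energy_eq[OF sub'[OF g(2)]]) (use inf_energy_le_holder[OF domain(2) Jg g u0] in blast)
  next
    fix u0 assume *: "u0 \<in> V1_L \<Omega> M \<inter> holder_functions 1 \<Omega>"
    then have u0: "u0 \<in> V1_L \<Omega> M" by blast
    show "(INF u\<in>translate u0 (V1_0_L \<Omega> M \<inter> holder_functions 1 \<Omega>). energy \<Omega> F u) = (INF u\<in>translate u0 (test_functions \<Omega>). energy \<Omega> F u)"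
      by (rule inf_energy_eq[OF sub'[OF order_refl]])
        (use inf_energy_le_holder[OF domain(2) jensen_condition_1[OF reg] zero_less_one order_refl u0] in blast)
  qed
qed

end
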